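(* Let $M$ be an $n$-dimensional smooth real manifold, $Z\to M$ a torus bundle with fibers real $n$-tori and zero section $s$, and $\widehat{Z}\to M$ the dual torus bundle. A semi-flat generalized almost complex structure $\mathcal{J}$ on $Z$ is integrable if and only if its mirror structure $\widehat{\mathcal{J}}$ on $\widehat{Z}$ is integrable.
   Context: Generalized almost complex structures. On $W\oplus W^\vee$ ($W$ a real vector bundle) use the pairing $\langle v+f,w+g\rangle=-\tfrac12(f(w)+g(v))$. A generalized almost complex structure on $W$ is an automorphism $\mathcal{J}$ of $W\oplus W^\vee$ which is orthogonal for this pairing and satisfies $\mathcal{J}^2=-1$. A generalized almost complex structure on a manifold $N$ is one on $W=T_N$. The Courant bracket is $[X+\xi,Y+\eta]=[X,Y]+\mathcal{L}_X\eta-\mathcal{L}_Y\xi+\tfrac12 d(\iota_Y\xi-\iota_X\eta)$. A generalized almost complex structure on $N$ is integrable if the sheaf of sections of its $(+i)$-eigenbundle $E\subseteq(T_N\oplus T_N^\vee)\otimes\mathbb{C}$ is closed under the ($\mathbb{C}$-bilinearly extended) Courant bracket. Torus bundles. $p:Z\to M$ is a smooth fiber bundle with fiber an $n$-torus and a global section $s$; its structure group is taken to be reduced to $GL(n,\mathbb{Z})$, so $Z$ is a bundle of Lie groups with zero section $s$. Put $V=s^*T_{Z/M}$, a rank $n$ vector bundle; translation along the fibers gives $T_{Z/M}\cong p^*V$. There is a bundle of lattices $\Lambda\subset \mathrm{tot}(V)$ with $Z\cong \mathrm{tot}(V)/\Lambda$, and $V$ carries the flat connection $\nabla$ for which local sections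 of $\Lambda$ are flat. On $X=\mathrm{tot}(V)\xrightarrow{\pi}M$, with tautological section $S$ of $\pi^*V$, the map $D=(\pi^*\nabla)(S):T_X\to\pi^*V$ splits the sequence $0\to\pi^*V\to T_X\to\pi^*T_M\to0$; it is invariant under translation by $\Lambda$, so it descends to a splitting of $0\to p^*V\xrightarrow{j}T_Z\xrightarrow{dp}p^*T_M\to0$, again denoted $D:T_Z\to p^*V$ ($D\circ j=1$), with corresponding $\alpha:p^*T_M\to T_Z$ ($dp\circ\alpha=1$, $D\circ\alpha=0$). Let $$F:T_Z\oplus T_Z^\vee\to p^*V\oplus p^*T_M\oplus p^*V^\vee\oplus p^*T_M^\vee,\quad F(w+\xi)=(Dw,\ dp\,w,\ j^\vee\xi,\ \alpha^\vee\xi),$$ which is an isomorphism. The dual torus bundle is $\hat p:\widehat{Z}=\mathrm{tot}(V^\vee)/\widehat\Lambda\to M$, where $\widehat\Lambda=\mathrm{Hom}_{\mathbb{Z}}(\Lambda,\mathbb{Z})\subset\mathrm{tot}(V^\vee)$ is the dual lattice bundle; the corresponding flat connection on $V^\vee$ is $\nabla^\vee$, and the same construction with $(V^\vee,\nabla^\vee,\widehat\Lambda)$ gives maps $\hat j,\widehat D,\hat\alpha$ and an isomorphism $\widehat F:T_{\widehat Z}\oplus T_{\widehat Z}^\vee\to \hat p^*V^\vee\oplus\hat p^*T_M\oplus\hat p^*V\oplus\hat p^*T_M^\vee$. Semi-flat and mirror. With $\dim M=n$ equal to the fiber dimension, a semi-flat generalized almost complex structure on $Z$ is one of the form $\mathcal{J}=F^{-1}(p^*\underline{\mathcal{J}})F$,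 where $\underline{\mathcal{J}}$ is a generalized almost complex structure on $V\oplus T_M$ which is adapted: $\underline{\mathcal{J}}(V\oplus V^\vee)=T_M\oplus T_M^\vee$. Its mirror is $\widehat{\mathcal{J}}=\widehat F^{-1}(\hat p^*\widehat{\underline{\mathcal{J}}})\widehat F$ on $\widehat Z$, where $\widehat{\underline{\mathcal{J}}}=\tau\underline{\mathcal{J}}\tau^{-1}$ and $\tau:V\oplus T_M\oplus V^\vee\oplus T_M^\vee\to V^\vee\oplus T_M\oplus V\oplus T_M^\vee$ is the permutation interchanging the summands $V$ and $V^\vee$. *)

theory Defs
  imports "HOL-Analysis.Analysis" "HOL-Library.Function_Algebras"
begin

text \<open>
  Fibres of vector bundles are subspaces of a type of class \<open>real_vector\<close>. Tangent vectors and
  linear functionals are functions, so functions get the pointwise vector space structure.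
\<close>

instantiation "fun" :: (type, real_vector) real_vector
begin

definition scaleR_fun_def: "scaleR r f = (\<lambda>x. r *\<^sub>R f x)"

instance
  by standard (auto simp: scaleR_fun_def plus_fun_def scaleR_add_right scaleR_add_left)

end


section \<open>Smooth manifolds\<close>

text \<open>For open \<open>S\<close>, the predicate \<open>Ck_on k S f\<close> says that \<open>f\<close> is of class $C^k$ on \<open>S\<close>.\<close>

primrec Ck_on ::
  "nat \<Rightarrow> 'a::real_normed_vector set \<Rightarrow> ('a \<Rightarrow> 'b::real_normed_vector) \<Rightarrow> bool" where
  "Ck_on 0 S f = continuous_on S f"
| "Ck_on (Suc k) S f =
     ((\<forall>x\<in>S. f differentiable (at x)) \<and> (\<forall>v. Ck_on k S (\<lambda>x. frechet_derivative f (at x) v)))"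

definition smooth_on :: "'a::real_normed_vector set \<Rightarrow> ('a \<Rightarrow> 'b::real_normed_vector) \<Rightarrow> bool" where
  "smooth_on S f \<longleftrightarrow> (\<forall>k. Ck_on k S f)"

text \<open>A chart is a domain with a coordinate map; only the values of the map on the domain matter.\<close>

type_synonym ('a, 'e) chart = "'a set \<times> ('a \<Rightarrow> 'e)"

definition chart_inv :: "('a, 'e) chart \<Rightarrow> 'e \<Rightarrow> 'a" where
  "chart_inv c = inv_into (fst c) (snd c)"

definition is_chart :: "('a, 'e::euclidean_space) chart \<Rightarrow> bool" where
  "is_chart c \<longleftrightarrow> inj_on (snd c) (fst c) \<and> open (snd c ` fst c)"

definition compatible :: "('a, 'e::euclidean_space) chart \<Rightarrow> ('a, 'e) chart \<Rightarrow> bool" where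
  "compatible c c' \<longleftrightarrow>
     open (snd c ` (fst c \<inter> fst c')) \<and> open (snd c' ` (fst c \<inter> fst c')) \<and>
     smooth_on (snd c ` (fst c \<inter> fst c')) (snd c' \<circ> chart_inv c) \<and>
     smooth_on (snd c' ` (fst c \<inter> fst c')) (snd c \<circ> chart_inv c')"

definition carrier_of :: "('a, 'e) chart set \<Rightarrow> 'a set" where
  "carrier_of A = \<Union> (fst ` A)"

definition smooth_atlas :: "('a, 'e::euclidean_space) chart set \<Rightarrow> bool" where
  "smooth_atlas A \<longleftrightarrow> (\<forall>c\<in>A. is_chart c) \<and> (\<forall>c\<in>A. \<forall>c'\<in>A. compatible c c')"

definition max_atlas :: "('a, 'e::euclidean_space) chart set \<Rightarrow> ('a, 'e) chart set" where
  "max_atlas A = {c. is_chart c \<and> fst c \<subseteq> carrier_of A \<and> (\<forall>c'\<in>A. compatible c c')}"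

text \<open>The topology of an atlas: the one for which all charts are homeomorphisms from open sets.\<close>

definition mtop :: "('a, 'e::euclidean_space) chart set \<Rightarrow> 'a topology" where
  "mtop A = topology (\<lambda>U. U \<subseteq> carrier_of A \<and> (\<forall>c\<in>A. open (snd c ` (U \<inter> fst c))))"

lemma openin_mtop:
  assumes "smooth_atlas A"
  shows "openin (mtop A) U \<longleftrightarrow> U \<subseteq> carrier_of A \<and> (\<forall>c\<in>A. open (snd c ` (U \<inter> fst c)))"
proof -
  let ?L = "\<lambda>U. U \<subseteq> carrier_of A \<and> (\<forall>c\<in>A. open (snd c ` (U \<inter> fst c)))"
  have "istopology ?L"
    unfolding istopology_def
  proof (intro conjI allI impI ballI)
    fix S T c assume S: "?L S" and T: "?L T" and c: "c \<in> A"
    have inj: "inj_on (snd c) (fst c)"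
      using assms c by (auto simp: smooth_atlas_def is_chart_def)
    have "snd c ` (S \<inter> T \<inter> fst c) = snd c ` ((S \<inter> fst c) \<inter> (T \<inter> fst c))"
      by (rule arg_cong[where f = "\<lambda>X. snd c ` X"]) blast
    also have "\<dots> = snd c ` (S \<inter> fst c) \<inter> snd c ` (T \<inter> fst c)"
      by (rule inj_on_image_Int[OF inj]) auto
    finally show "open (snd c ` (S \<inter> T \<inter> fst c))"
      using S T c by auto
  next
    fix \<K> c assume K: "\<forall>S\<in>\<K>. ?L S" and c: "c \<in> A"
    have "snd c ` (\<Union>\<K> \<inter> fst c) = (\<Union>S\<in>\<K>. snd c ` (S \<inter> fst c))"
      by blast
    then show "open (snd c ` (\<Union>\<K> \<inter> fst c))"
      using K c by auto
  qed auto
  then show ?thesis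
    by (simp add: mtop_def topology_inverse')
qed

text \<open>
  A smooth manifold is given by its maximal atlas; its dimension is that of the model space \<open>'e\<close>.
\<close>

definition smooth_manifold :: "('a, 'e::euclidean_space) chart set \<Rightarrow> bool" where
  "smooth_manifold A \<longleftrightarrow>
     smooth_atlas A \<and> max_atlas A = A \<and> Hausdorff_space (mtop A) \<and> second_countable (mtop A)"


section \<open>Tangent vectors\<close>

text \<open>
  A tangent vector at \<open>x\<close> is a family of coordinate vectors, one for each chart around \<open>x\<close>, related
  by the derivatives of the coordinate changes (and \<open>0\<close> at all other indices).
\<close>

type_synonym ('a, 'e) tvector = "('a, 'e) chart \<Rightarrow> 'e"

definition tangent_space :: "('a, 'e::euclidean_space) chart set \<Rightarrow> 'a \<Rightarrow> ('a, 'e) tvector set" where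
  "tangent_space A x =
     {v. (\<forall>c\<in>A. \<forall>c'\<in>A. x \<in> fst c \<longrightarrow> x \<in> fst c' \<longrightarrow>
            v c' = frechet_derivative (snd c' \<circ> chart_inv c) (at (snd c x)) (v c)) \<and>
         (\<forall>c. \<not> (c \<in> A \<and> x \<in> fst c) \<longrightarrow> v c = 0)}"

definition chart_at :: "('a, 'e) chart set \<Rightarrow> 'a \<Rightarrow> ('a, 'e) chart" where
  "chart_at A x = (SOME c. c \<in> A \<and> x \<in> fst c)"

text \<open>The tangent vector at \<open>x\<close> with coordinates \<open>b\<close> in the chart \<open>c\<close>.\<close>

definition tvec ::
  "('a, 'e::euclidean_space) chart set \<Rightarrow> ('a, 'e) chart \<Rightarrow> 'a \<Rightarrow> 'e \<Rightarrow> ('a, 'e) tvector" where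
  "tvec A c x b =
     (\<lambda>c'. if c' \<in> A \<and> x \<in> fst c'
           then frechet_derivative (snd c' \<circ> chart_inv c) (at (snd c x)) b else 0)"

definition differential ::
  "('a, 'e::euclidean_space) chart set \<Rightarrow> ('a \<Rightarrow> 'b::real_normed_vector) \<Rightarrow> 'a \<Rightarrow> ('a, 'e) tvector \<Rightarrow> 'b"
  where
  "differential A f x v =
     (let c = chart_at A x in frechet_derivative (f \<circ> chart_inv c) (at (snd c x)) (v c))"

definition tangent_map ::
  "('a, 'e::euclidean_space) chart set \<Rightarrow> ('b, 'f::euclidean_space) chart set \<Rightarrow> ('a \<Rightarrow> 'b) \<Rightarrow>
   'a \<Rightarrow> ('a, 'e) tvector \<Rightarrow> ('b, 'f) tvector" where
  "tangent_map A B f x v =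
     (\<lambda>c. if c \<in> B \<and> f x \<in> fst c then differential A (snd c \<circ> f) x v else 0)"

definition velocity ::
  "('a, 'e::euclidean_space) chart set \<Rightarrow> (real \<Rightarrow> 'a) \<Rightarrow> real \<Rightarrow> ('a, 'e) tvector" where
  "velocity A \<gamma> t =
     (\<lambda>c. if c \<in> A \<and> \<gamma> t \<in> fst c then vector_derivative (snd c \<circ> \<gamma>) (at t) else 0)"


section \<open>Vector bundles\<close>

text \<open>
  The dual of a subspace \<open>S\<close> of a real vector space; the functionals are defined on the ambient type
  and vanish outside \<open>S\<close> by convention.
\<close>

definition dual_space :: "'v::real_vector set \<Rightarrow> ('v \<Rightarrow> real) set" where
  "dual_space S =
     {f. (\<forall>v\<in>S. \<forall>w\<in>S. f (v + w) = f v + f w) \<and> (\<forall>r. \<forall>v\<in>S. f (r *\<^sub>R v) = r * f v) \<and>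
         (\<forall>v. v \<notin> S \<longrightarrow> f v = 0)}"

text \<open>
  A vector bundle is given by its fibres and by local trivializations \<open>(U, t)\<close>, where
  \<open>t x\<close> is a linear isomorphism from the fibre over \<open>x \<in> U\<close> to the model space \<open>'e\<close>.
\<close>

record ('a, 'v, 'e) vbundle =
  fib :: "'a \<Rightarrow> 'v set"
  vtrivs :: "('a set \<times> ('a \<Rightarrow> 'v \<Rightarrow> 'e)) set"

definition smooth_section ::
  "('a, 'd::euclidean_space) chart set \<Rightarrow> ('a, 'v, 'e::euclidean_space) vbundle \<Rightarrow>
   'a set \<Rightarrow> ('a \<Rightarrow> 'v) \<Rightarrow> bool" where
  "smooth_section A W U \<sigma> \<longleftrightarrow>
     (\<forall>x\<in>U. \<sigma> x \<in> fib W x) \<and>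
     (\<forall>c\<in>A. \<forall>(U', t)\<in>vtrivs W.
        smooth_on (snd c ` (U \<inter> U' \<inter> fst c)) ((\<lambda>x. t x (\<sigma> x)) \<circ> chart_inv c))"

definition tangent_bundle ::
  "('a, 'e::euclidean_space) chart set \<Rightarrow> ('a, ('a, 'e) tvector, 'e) vbundle" where
  "tangent_bundle A = \<lparr> fib = tangent_space A, vtrivs = (\<lambda>c. (fst c, \<lambda>x v. v c)) ` A \<rparr>"

definition sum_bundle ::
  "('a, 'v, 'e) vbundle \<Rightarrow> ('a, 'w, 'f) vbundle \<Rightarrow> ('a, 'v \<times> 'w, 'e \<times> 'f) vbundle" where
  "sum_bundle V W =
     \<lparr> fib = (\<lambda>x. fib V x \<times> fib W x),
       vtrivs = (\<lambda>((U, t), (U', t')). (U \<inter> U', \<lambda>x (v, w). (t x v, t' x w))) ` (vtrivs V \<times> vtrivs W) \<rparr>"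

text \<open>The trivialization of the dual is contragredient; the model space is self-dual by its inner product.\<close>

definition dual_bundle ::
  "('a, 'v::real_vector, 'e::euclidean_space) vbundle \<Rightarrow> ('a, 'v \<Rightarrow> real, 'e) vbundle" where
  "dual_bundle V =
     \<lparr> fib = (\<lambda>x. dual_space (fib V x)),
       vtrivs = (\<lambda>(U, t). (U, \<lambda>x f. \<Sum>b\<in>Basis. f (inv_into (fib V x) (t x) b) *\<^sub>R b)) ` vtrivs V \<rparr>"

definition double_bundle ::
  "('a, 'v::real_vector, 'e::euclidean_space) vbundle \<Rightarrow> ('a, 'v \<times> ('v \<Rightarrow> real), 'e \<times> 'e) vbundle" where
  "double_bundle W = sum_bundle W (dual_bundle W)"


section \<open>Generalized almost complex structures and integrability\<close>

definition dual_pairing :: "'v \<times> ('v \<Rightarrow> real) \<Rightarrow> 'v \<times> ('v \<Rightarrow> real) \<Rightarrow> real" where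
  "dual_pairing a b = - (1/2) * (snd a (fst b) + snd b (fst a))"

text \<open>
  Smoothness of the automorphism \<open>J\<close> of \<open>W \<oplus> W\<^sup>\<or>\<close> is expressed on local sections; bijectivity is
  contained in \<open>J\<^sup>2 = -1\<close>.
\<close>

definition generalized_almost_complex ::
  "('a, 'd::euclidean_space) chart set \<Rightarrow> ('a, 'v::real_vector, 'e::euclidean_space) vbundle \<Rightarrow>
   ('a \<Rightarrow> 'v \<times> ('v \<Rightarrow> real) \<Rightarrow> 'v \<times> ('v \<Rightarrow> real)) \<Rightarrow> bool" where
  "generalized_almost_complex A W J \<longleftrightarrow>
     (\<forall>x\<in>carrier_of A.
        (\<forall>a\<in>fib (double_bundle W) x. J x a \<in> fib (double_bundle W) x) \<and>
        (\<forall>a\<in>fib (double_bundle W) x. \<forall>b\<in>fib (double_bundle W) x. J x (a + b) = J x a + J x b) \<and>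
        (\<forall>r. \<forall>a\<in>fib (double_bundle W) x. J x (r *\<^sub>R a) = r *\<^sub>R J x a) \<and>
        (\<forall>a\<in>fib (double_bundle W) x. \<forall>b\<in>fib (double_bundle W) x.
            dual_pairing (J x a) (J x b) = dual_pairing a b) \<and>
        (\<forall>a\<in>fib (double_bundle W) x. J x (J x a) = - a)) \<and>
     (\<forall>U \<sigma>. openin (mtop A) U \<longrightarrow> smooth_section A (double_bundle W) U \<sigma> \<longrightarrow>
        smooth_section A (double_bundle W) U (\<lambda>x. J x (\<sigma> x)))"

type_synonym ('a, 'e) vfield = "'a \<Rightarrow> ('a, 'e) tvector"
type_synonym ('a, 'e) oneform = "'a \<Rightarrow> ('a, 'e) tvector \<Rightarrow> real"
type_synonym ('a, 'e) gfield = "'a \<Rightarrow> ('a, 'e) tvector \<times> (('a, 'e) tvector \<Rightarrow> real)"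

text \<open>In each chart $[X,Y]^i = X^k \partial_k Y^i - Y^k \partial_k X^i$.\<close>

definition lie_bracket ::
  "('a, 'e::euclidean_space) chart set \<Rightarrow> ('a, 'e) vfield \<Rightarrow> ('a, 'e) vfield \<Rightarrow> ('a, 'e) vfield" where
  "lie_bracket A X Y x =
     (\<lambda>c. if c \<in> A \<and> x \<in> fst c
          then frechet_derivative ((\<lambda>z. Y z c) \<circ> chart_inv c) (at (snd c x)) (X x c)
             - frechet_derivative ((\<lambda>z. X z c) \<circ> chart_inv c) (at (snd c x)) (Y x c)
          else 0)"

text \<open>In a chart $(L_X \eta)_j = X^k \partial_k \eta_j + \eta_k \partial_j X^k$.\<close>

definition lie_derivative ::
  "('a, 'e::euclidean_space) chart set \<Rightarrow> ('a, 'e) vfield \<Rightarrow> ('a, 'e) oneform \<Rightarrow> ('a, 'e) oneform" where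
  "lie_derivative A X \<eta> x =
     (\<lambda>v. if v \<in> tangent_space A x
          then let c = chart_at A x in
               frechet_derivative ((\<lambda>z. \<eta> z (tvec A c z (v c))) \<circ> chart_inv c) (at (snd c x)) (X x c)
             + \<eta> x (tvec A c x
                  (frechet_derivative ((\<lambda>z. X z c) \<circ> chart_inv c) (at (snd c x)) (v c)))
          else 0)"

definition exterior_derivative ::
  "('a, 'e::euclidean_space) chart set \<Rightarrow> ('a \<Rightarrow> real) \<Rightarrow> ('a, 'e) oneform" where
  "exterior_derivative A f x = (\<lambda>v. if v \<in> tangent_space A x then differential A f x v else 0)"

definition courant_bracket ::
  "('a, 'e::euclidean_space) chart set \<Rightarrow> ('a, 'e) gfield \<Rightarrow> ('a, 'e) gfield \<Rightarrow> ('a, 'e) gfield" where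
  "courant_bracket A a b x =
     (let X = fst \<circ> a; \<xi> = snd \<circ> a; Y = fst \<circ> b; \<eta> = snd \<circ> b in
      (lie_bracket A X Y x,
       lie_derivative A X \<eta> x - lie_derivative A Y \<xi> x
       + (1/2) *\<^sub>R exterior_derivative A (\<lambda>z. \<xi> z (Y z) - \<eta> z (X z)) x))"

text \<open>
  A section $a_0 + i a_1$ of the complexified bundle is the pair $(a_0, a_1)$ of real sections.
\<close>

definition courant_bracket_complex ::
  "('a, 'e::euclidean_space) chart set \<Rightarrow> ('a, 'e) gfield \<times> ('a, 'e) gfield \<Rightarrow>
   ('a, 'e) gfield \<times> ('a, 'e) gfield \<Rightarrow> ('a, 'e) gfield \<times> ('a, 'e) gfield" where
  "courant_bracket_complex A a b =
     (courant_bracket A (fst a) (fst b) - courant_bracket A (snd a) (snd b),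
      courant_bracket A (fst a) (snd b) + courant_bracket A (snd a) (fst b))"

text \<open>$J(a_0 + i a_1) = i(a_0 + i a_1)$ splits into $J a_0 = -a_1$ and $J a_1 = a_0$.\<close>

definition eigenbundle_section ::
  "('a, 'e::euclidean_space) chart set \<Rightarrow>
   ('a \<Rightarrow> ('a, 'e) tvector \<times> (('a, 'e) tvector \<Rightarrow> real) \<Rightarrow>
         ('a, 'e) tvector \<times> (('a, 'e) tvector \<Rightarrow> real)) \<Rightarrow>
   'a set \<Rightarrow> ('a, 'e) gfield \<times> ('a, 'e) gfield \<Rightarrow> bool" where
  "eigenbundle_section A J U a \<longleftrightarrow>
     smooth_section A (double_bundle (tangent_bundle A)) U (fst a) \<and>
     smooth_section A (double_bundle (tangent_bundle A)) U (snd a) \<and>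
     (\<forall>x\<in>U. J x (fst a x) = - snd a x \<and> J x (snd a x) = fst a x)"

definition integrable_gcs ::
  "('a, 'e::euclidean_space) chart set \<Rightarrow>
   ('a \<Rightarrow> ('a, 'e) tvector \<times> (('a, 'e) tvector \<Rightarrow> real) \<Rightarrow>
         ('a, 'e) tvector \<times> (('a, 'e) tvector \<Rightarrow> real)) \<Rightarrow> bool" where
  "integrable_gcs A J \<longleftrightarrow>
     (\<forall>U a b. openin (mtop A) U \<longrightarrow> eigenbundle_section A J U a \<longrightarrow> eigenbundle_section A J U b \<longrightarrow>
        eigenbundle_section A J U (courant_bracket_complex A a b))"


section \<open>Torus bundles\<close>

definition int_vecs :: "(real ^ 'n) set" where
  "int_vecs = {y. \<forall>i. y $ i \<in> \<int>}"

definition GLZ :: "(real ^ 'n ^ 'n) set" where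
  "GLZ = {G. (\<forall>i j. G $ i $ j \<in> \<int>) \<and> (det G = 1 \<or> det G = -1)}"

text \<open>
  Let \<open>\<Phi>\<close> consist of local parametrizations \<open>(U, \<psi>)\<close> of a space over the manifold \<open>A\<close>, with \<open>\<psi> x\<close>
  mapping the model fibre onto the fibre over \<open>x \<in> U\<close>. The adapted charts are the local
  inverses of \<open>(\<xi>, y) \<mapsto> \<psi> (c\<^sup>-\<^sup>1 \<xi>) y\<close>, for charts \<open>c\<close> of \<open>A\<close>. All of them are charts of a
  given maximal atlas iff the maps \<open>(x, y) \<mapsto> \<psi> x y\<close> are local diffeomorphisms.
\<close>

definition adapted_charts ::
  "('m, 'd::euclidean_space) chart set \<Rightarrow> ('m set \<times> ('m \<Rightarrow> 'e::euclidean_space \<Rightarrow> 'z)) set \<Rightarrow>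
   ('z, 'd \<times> 'e) chart set" where
  "adapted_charts A \<Phi> =
     {(P ` W, inv_into W P) | P W c U \<psi>.
        c \<in> A \<and> (U, \<psi>) \<in> \<Phi> \<and> P = (\<lambda>(\<xi>, y). \<psi> (chart_inv c \<xi>) y) \<and>
        open W \<and> W \<subseteq> snd c ` (fst c \<inter> U) \<times> UNIV \<and> inj_on P W}"

text \<open>
  A torus bundle with structure group $GL(n,\mathbb{Z})$ and its zero section. A local trivialization
  over \<open>U\<close> is a diffeomorphism from $U \times \mathbb{R}^n/\mathbb{Z}^n$ onto the part of the total
  space over \<open>U\<close>; it is encoded by its lift \<open>\<psi>\<close> to $U \times \mathbb{R}^n$. That the
  adapted charts belong to the maximal atlas of the total space says that it is a diffeomorphism, and
  implies smoothness of the projection and of the zero section.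
\<close>

record ('m, 'z, 'n) torus_bundle_data =
  tb_base :: "('m, real ^ 'n) chart set"
  tb_total :: "('z, (real ^ 'n) \<times> (real ^ 'n)) chart set"
  tb_proj :: "'z \<Rightarrow> 'm"
  tb_zero :: "'m \<Rightarrow> 'z"
  tb_trivs :: "('m set \<times> ('m \<Rightarrow> real ^ 'n \<Rightarrow> 'z)) set"

definition torus_bundle :: "('m, 'z, 'n::finite) torus_bundle_data \<Rightarrow> bool" where
  "torus_bundle Z \<longleftrightarrow>
     smooth_manifold (tb_base Z) \<and> smooth_manifold (tb_total Z) \<and>
     (\<forall>z\<in>carrier_of (tb_total Z). tb_proj Z z \<in> carrier_of (tb_base Z)) \<and>
     (\<forall>x\<in>carrier_of (tb_base Z). \<exists>(U, \<psi>)\<in>tb_trivs Z. x \<in> U) \<and>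
     (\<forall>(U, \<psi>)\<in>tb_trivs Z.
        openin (mtop (tb_base Z)) U \<and>
        (\<forall>x\<in>U. range (\<psi> x) = {z \<in> carrier_of (tb_total Z). tb_proj Z z = x} \<and>
               (\<forall>y y'. \<psi> x y = \<psi> x y' \<longleftrightarrow> y - y' \<in> int_vecs) \<and>
               \<psi> x 0 = tb_zero Z x)) \<and>
     adapted_charts (tb_base Z) (tb_trivs Z) \<subseteq> tb_total Z \<and>
     (\<forall>(U, \<psi>)\<in>tb_trivs Z. \<forall>(U', \<psi>')\<in>tb_trivs Z. \<forall>x\<in>U \<inter> U'.
        \<exists>G\<in>GLZ. \<forall>y. \<psi>' x y = \<psi> x (G *v y))"

text \<open>
  The bundle $V = s^* T_{Z/M}$: its fibre over \<open>x\<close> consists of the vertical tangent vectors at the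
  zero point over \<open>x\<close>. The local trivialization of the torus bundle sends \<open>y\<close> to the velocity of
  \<open>\<tau> \<mapsto> \<psi> x (\<tau> y)\<close>.
\<close>

definition vertical_bundle ::
  "('m, 'z, 'n::finite) torus_bundle_data \<Rightarrow>
   ('m, ('z, (real ^ 'n) \<times> (real ^ 'n)) tvector, real ^ 'n) vbundle" where
  "vertical_bundle Z =
     \<lparr> fib = (\<lambda>x. {v \<in> tangent_space (tb_total Z) (tb_zero Z x).
                    tangent_map (tb_total Z) (tb_base Z) (tb_proj Z) (tb_zero Z x) v = 0}),
       vtrivs = (\<lambda>(U, \<psi>). (U, \<lambda>x. inv (\<lambda>y. velocity (tb_total Z) (\<lambda>\<tau>. \<psi> x (\<tau> *\<^sub>R y)) 0)))
                ` tb_trivs Z \<rparr>"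

text \<open>The fibrewise exponential map of the bundle of Lie groups.\<close>

definition fibre_exp ::
  "('m, 'z, 'n::finite) torus_bundle_data \<Rightarrow>
   'm \<times> ('z, (real ^ 'n) \<times> (real ^ 'n)) tvector \<Rightarrow> 'z" where
  "fibre_exp Z = (\<lambda>(x, v). THE z. \<exists>(U, \<psi>)\<in>tb_trivs Z. \<exists>y. x \<in> U \<and>
     v = velocity (tb_total Z) (\<lambda>\<tau>. \<psi> x (\<tau> *\<^sub>R y)) 0 \<and> z = \<psi> x y)"

definition lattice_of ::
  "('m, 'z, 'n::finite) torus_bundle_data \<Rightarrow>
   'm \<Rightarrow> ('z, (real ^ 'n) \<times> (real ^ 'n)) tvector set" where
  "lattice_of Z x = {v \<in> fib (vertical_bundle Z) x. fibre_exp Z (x, v) = tb_zero Z x}"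


section \<open>Quotients of vector bundles by lattice bundles\<close>

text \<open>
  A bundle over \<open>lq_base\<close> presented as the quotient of the total space of a vector bundle by a
  bundle of lattices, with quotient map \<open>lq_map\<close>.
\<close>

record ('m, 'v, 'z, 'n) lattice_quotient =
  lq_base :: "('m, real ^ 'n) chart set"
  lq_bundle :: "('m, 'v, real ^ 'n) vbundle"
  lq_lattice :: "'m \<Rightarrow> 'v set"
  lq_total :: "('z, (real ^ 'n) \<times> (real ^ 'n)) chart set"
  lq_proj :: "'z \<Rightarrow> 'm"
  lq_map :: "'m \<times> 'v \<Rightarrow> 'z"

text \<open>
  Points of the total space are pairs of a base point and a vector of the fibre over it. The smooth
  structure is the product structure in local trivializations.
\<close>

definition total_space ::
  "('m, real ^ 'n) chart set \<Rightarrow> ('m, 'v, real ^ 'n) vbundle \<Rightarrow>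
   ('m \<times> 'v, (real ^ 'n) \<times> (real ^ 'n::finite)) chart set" where
  "total_space A V =
     max_atlas (adapted_charts A ((\<lambda>(U, t). (U, \<lambda>x y. (x, inv_into (fib V x) (t x) y))) ` vtrivs V))"

text \<open>
  Trivializations taking the lattices to the integer vectors. Local sections of the lattice bundle
  have locally constant components in them, so the flat connection for which they are flat is the
  componentwise derivative.
\<close>

definition flat_trivs ::
  "('m, 'v, real ^ 'n) vbundle \<Rightarrow> ('m \<Rightarrow> 'v set) \<Rightarrow> ('m set \<times> ('m \<Rightarrow> 'v \<Rightarrow> real ^ 'n)) set" where
  "flat_trivs V \<Lambda> = {(U, t) \<in> vtrivs V. \<forall>x\<in>U. t x ` \<Lambda> x = int_vecs}"

text \<open>
  The covariant derivative $(f^*\nabla)_w S$ at \<open>y\<close> of a section \<open>S\<close> of $f^*V$, where \<open>f\<close> maps a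
  manifold \<open>N\<close> to the base of \<open>V\<close> and $\nabla$ is the flat connection defined by the lattices.
\<close>

definition pullback_connection ::
  "('y, 'e::euclidean_space) chart set \<Rightarrow> ('y \<Rightarrow> 'm) \<Rightarrow> ('m, 'v, real ^ 'n) vbundle \<Rightarrow>
   ('m \<Rightarrow> 'v set) \<Rightarrow> ('y \<Rightarrow> 'v) \<Rightarrow> 'y \<Rightarrow> ('y, 'e) tvector \<Rightarrow> 'v" where
  "pullback_connection N f V \<Lambda> S y w =
     (let (U, t) = (SOME (U, t). (U, t) \<in> flat_trivs V \<Lambda> \<and> f y \<in> U) in
      inv_into (fib V (f y)) (t (f y)) (differential N (\<lambda>y'. t (f y') (S y')) y w))"

text \<open>
  On $X = \mathrm{tot}(V)$ with projection \<open>fst\<close> and tautological section \<open>snd\<close>, the map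
  $(\pi^*\nabla)(S)$; below, its descent along the quotient map.
\<close>

definition total_splitting ::
  "('m, 'v, 'z, 'n::finite) lattice_quotient \<Rightarrow>
   'm \<times> 'v \<Rightarrow> ('m \<times> 'v, (real ^ 'n) \<times> (real ^ 'n)) tvector \<Rightarrow> 'v" where
  "total_splitting Q =
     pullback_connection (total_space (lq_base Q) (lq_bundle Q)) fst (lq_bundle Q) (lq_lattice Q) snd"

definition lq_D ::
  "('m, 'v, 'z, 'n::finite) lattice_quotient \<Rightarrow>
   'z \<Rightarrow> ('z, (real ^ 'n) \<times> (real ^ 'n)) tvector \<Rightarrow> 'v" where
  "lq_D Q z w =
     (let X = total_space (lq_base Q) (lq_bundle Q) in
      THE e. \<exists>a\<in>carrier_of X. \<exists>u\<in>tangent_space X a.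
        lq_map Q a = z \<and> tangent_map X (lq_total Q) (lq_map Q) a u = w \<and> e = total_splitting Q a u)"

text \<open>
  The inclusion $j: p^*V \to T_Z$ onto the vertical tangent vectors, by translation along the fibres:
  if \<open>z\<close> is the image of \<open>e\<^sub>0\<close>, then $j_z(e)$ is the velocity of the image of \<open>e\<^sub>0 + \<tau> e\<close>.
\<close>

definition lq_j ::
  "('m, 'v::real_vector, 'z, 'n::finite) lattice_quotient \<Rightarrow>
   'z \<Rightarrow> 'v \<Rightarrow> ('z, (real ^ 'n) \<times> (real ^ 'n)) tvector" where
  "lq_j Q z e =
     (let x = lq_proj Q z; e\<^sub>0 = (SOME e\<^sub>0. e\<^sub>0 \<in> fib (lq_bundle Q) x \<and> lq_map Q (x, e\<^sub>0) = z) in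
      velocity (lq_total Q) (\<lambda>\<tau>. lq_map Q (x, e\<^sub>0 + \<tau> *\<^sub>R e)) 0)"

definition lq_dp ::
  "('m, 'v, 'z, 'n::finite) lattice_quotient \<Rightarrow>
   'z \<Rightarrow> ('z, (real ^ 'n) \<times> (real ^ 'n)) tvector \<Rightarrow> ('m, real ^ 'n) tvector" where
  "lq_dp Q = tangent_map (lq_total Q) (lq_base Q) (lq_proj Q)"

definition lq_alpha ::
  "('m, 'v::real_vector, 'z, 'n::finite) lattice_quotient \<Rightarrow>
   'z \<Rightarrow> ('m, real ^ 'n) tvector \<Rightarrow> ('z, (real ^ 'n) \<times> (real ^ 'n)) tvector" where
  "lq_alpha Q z a = (THE w. w \<in> tangent_space (lq_total Q) z \<and> lq_dp Q z w = a \<and> lq_D Q z w = 0)"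

text \<open>The transpose of a linear map out of the subspace \<open>S\<close>.\<close>

definition transpose_on :: "'v set \<Rightarrow> ('v \<Rightarrow> 'w) \<Rightarrow> ('w \<Rightarrow> real) \<Rightarrow> 'v \<Rightarrow> real" where
  "transpose_on S f \<xi> = (\<lambda>v. if v \<in> S then \<xi> (f v) else 0)"

text \<open>Elements of the fibres of $V \oplus T_M \oplus V^\vee \oplus T_M^\vee$.\<close>

type_synonym ('v, 't) quad = "'v \<times> 't \<times> ('v \<Rightarrow> real) \<times> ('t \<Rightarrow> real)"

definition lq_F ::
  "('m, 'v::real_vector, 'z, 'n::finite) lattice_quotient \<Rightarrow>
   'z \<Rightarrow> ('z, (real ^ 'n) \<times> (real ^ 'n)) tvector \<times> (('z, (real ^ 'n) \<times> (real ^ 'n)) tvector \<Rightarrow> real) \<Rightarrow>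
   ('v, ('m, real ^ 'n) tvector) quad" where
  "lq_F Q z = (\<lambda>(w, \<xi>).
     (lq_D Q z w,
      lq_dp Q z w,
      transpose_on (fib (lq_bundle Q) (lq_proj Q z)) (lq_j Q z) \<xi>,
      transpose_on (tangent_space (lq_base Q) (lq_proj Q z)) (lq_alpha Q z) \<xi>))"

definition lq_structure ::
  "('m, 'v::real_vector, 'z, 'n::finite) lattice_quotient \<Rightarrow>
   ('m \<Rightarrow> ('v, ('m, real ^ 'n) tvector) quad \<Rightarrow> ('v, ('m, real ^ 'n) tvector) quad) \<Rightarrow>
   'z \<Rightarrow> ('z, (real ^ 'n) \<times> (real ^ 'n)) tvector \<times> (('z, (real ^ 'n) \<times> (real ^ 'n)) tvector \<Rightarrow> real) \<Rightarrow>
   ('z, (real ^ 'n) \<times> (real ^ 'n)) tvector \<times> (('z, (real ^ 'n) \<times> (real ^ 'n)) tvector \<Rightarrow> real)" where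
  "lq_structure Q K z u =
     inv_into (fib (double_bundle (tangent_bundle (lq_total Q))) z) (lq_F Q z)
       (K (lq_proj Q z) (lq_F Q z u))"


section \<open>The dual torus bundle\<close>

text \<open>$Z \cong \mathrm{tot}(V)/\Lambda$ by the fibrewise exponential map.\<close>

definition torus_quotient ::
  "('m, 'z, 'n::finite) torus_bundle_data \<Rightarrow>
   ('m, ('z, (real ^ 'n) \<times> (real ^ 'n)) tvector, 'z, 'n) lattice_quotient" where
  "torus_quotient Z =
     \<lparr> lq_base = tb_base Z, lq_bundle = vertical_bundle Z, lq_lattice = lattice_of Z,
       lq_total = tb_total Z, lq_proj = tb_proj Z, lq_map = fibre_exp Z \<rparr>"

text \<open>
  For a subset \<open>L\<close> of a subspace \<open>S\<close>: the functionals on \<open>S\<close> with integer values on \<open>L\<close>. For a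
  lattice \<open>L\<close> spanning \<open>S\<close>, restriction to \<open>L\<close> identifies them with the homomorphisms from \<open>L\<close>
  to the integers.
\<close>

definition dual_lattice :: "'v::real_vector set \<Rightarrow> 'v set \<Rightarrow> ('v \<Rightarrow> real) set" where
  "dual_lattice S L = {f \<in> dual_space S. \<forall>v\<in>L. f v \<in> \<int>}"

text \<open>
  The points of $\mathrm{tot}(V)/\Lambda$ are pairs of a base point and a coset of the lattice
  over it; its smooth structure is the one for which the quotient map is a local diffeomorphism.
\<close>

definition coset_map ::
  "('m, 'v::real_vector, 'e) vbundle \<Rightarrow> ('m \<Rightarrow> 'v set) \<Rightarrow> 'm \<times> 'v \<Rightarrow> 'm \<times> 'v set" where
  "coset_map V \<Lambda> = (\<lambda>(x, v). (x, {w \<in> fib V x. w - v \<in> \<Lambda> x}))"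

definition quotient_by_lattice ::
  "('m, real ^ 'n) chart set \<Rightarrow> ('m, 'v::real_vector, real ^ 'n) vbundle \<Rightarrow> ('m \<Rightarrow> 'v set) \<Rightarrow>
   ('m, 'v, 'm \<times> 'v set, 'n::finite) lattice_quotient" where
  "quotient_by_lattice A V \<Lambda> =
     \<lparr> lq_base = A, lq_bundle = V, lq_lattice = \<Lambda>,
       lq_total = max_atlas (adapted_charts A
         ((\<lambda>(U, t). (U, \<lambda>x y. coset_map V \<Lambda> (x, inv_into (fib V x) (t x) y))) ` vtrivs V)),
       lq_proj = fst, lq_map = coset_map V \<Lambda> \<rparr>"

definition dual_torus_quotient ::
  "('m, 'z, 'n::finite) torus_bundle_data \<Rightarrow>
   ('m, ('z, (real ^ 'n) \<times> (real ^ 'n)) tvector \<Rightarrow> real,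
    'm \<times> (('z, (real ^ 'n) \<times> (real ^ 'n)) tvector \<Rightarrow> real) set, 'n) lattice_quotient" where
  "dual_torus_quotient Z =
     quotient_by_lattice (tb_base Z) (dual_bundle (vertical_bundle Z))
       (\<lambda>x. dual_lattice (fib (vertical_bundle Z) x) (lattice_of Z x))"

definition dual_torus ::
  "('m, 'z, 'n::finite) torus_bundle_data \<Rightarrow>
   ('m \<times> (('z, (real ^ 'n) \<times> (real ^ 'n)) tvector \<Rightarrow> real) set, (real ^ 'n) \<times> (real ^ 'n)) chart set"
  where
  "dual_torus Z = lq_total (dual_torus_quotient Z)"


section \<open>Semi-flat structures and mirrors\<close>

definition quad_fib ::
  "('m, 'v::real_vector, 'e) vbundle \<Rightarrow> ('m, 't::real_vector, 'f) vbundle \<Rightarrow> 'm \<Rightarrow> ('v, 't) quad set" where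
  "quad_fib V T x = fib V x \<times> fib T x \<times> dual_space (fib V x) \<times> dual_space (fib T x)"

text \<open>
  The canonical isomorphism from $(V \oplus T) \oplus (V \oplus T)^\vee$ to
  $V \oplus T \oplus V^\vee \oplus T^\vee$ and the transport of an endomorphism along it.
\<close>

definition to_quad :: "('v \<times> 't) \<times> ('v \<times> 't \<Rightarrow> real) \<Rightarrow> ('v::zero, 't::zero) quad" where
  "to_quad = (\<lambda>((v, a), h). (v, a, \<lambda>v'. h (v', 0), \<lambda>a'. h (0, a')))"

definition quad_endo ::
  "('m, 'v::real_vector, 'e::euclidean_space) vbundle \<Rightarrow>
   ('m, 't::real_vector, 'f::euclidean_space) vbundle \<Rightarrow>
   ('m \<Rightarrow> ('v \<times> 't) \<times> ('v \<times> 't \<Rightarrow> real) \<Rightarrow> ('v \<times> 't) \<times> ('v \<times> 't \<Rightarrow> real)) \<Rightarrow>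
   'm \<Rightarrow> ('v, 't) quad \<Rightarrow> ('v, 't) quad" where
  "quad_endo V T J x =
     to_quad \<circ> J x \<circ> inv_into (fib (double_bundle (sum_bundle V T)) x) to_quad"

definition adapted ::
  "('m, 'd::euclidean_space) chart set \<Rightarrow> ('m, 'v::real_vector, 'e::euclidean_space) vbundle \<Rightarrow>
   ('m, 't::real_vector, 'f::euclidean_space) vbundle \<Rightarrow>
   ('m \<Rightarrow> ('v \<times> 't) \<times> ('v \<times> 't \<Rightarrow> real) \<Rightarrow> ('v \<times> 't) \<times> ('v \<times> 't \<Rightarrow> real)) \<Rightarrow> bool" where
  "adapted A V T J \<longleftrightarrow>
     (\<forall>x\<in>carrier_of A.
        quad_endo V T J x ` (fib V x \<times> {0} \<times> dual_space (fib V x) \<times> {0}) =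
        {0} \<times> fib T x \<times> {0} \<times> dual_space (fib T x))"

text \<open>
  \<open>J\<close> is the semi-flat generalized almost complex structure on the total space of \<open>Z\<close> which comes
  from \<open>Jb\<close> on $V \oplus T_M$.
\<close>

definition semi_flat ::
  "('m, 'z, 'n::finite) torus_bundle_data \<Rightarrow>
   ('m \<Rightarrow> (('z, (real ^ 'n) \<times> (real ^ 'n)) tvector \<times> ('m, real ^ 'n) tvector) \<times>
          (('z, (real ^ 'n) \<times> (real ^ 'n)) tvector \<times> ('m, real ^ 'n) tvector \<Rightarrow> real) \<Rightarrow>
          (('z, (real ^ 'n) \<times> (real ^ 'n)) tvector \<times> ('m, real ^ 'n) tvector) \<times>
          (('z, (real ^ 'n) \<times> (real ^ 'n)) tvector \<times> ('m, real ^ 'n) tvector \<Rightarrow> real)) \<Rightarrow>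
   ('z \<Rightarrow> ('z, (real ^ 'n) \<times> (real ^ 'n)) tvector \<times> (('z, (real ^ 'n) \<times> (real ^ 'n)) tvector \<Rightarrow> real) \<Rightarrow>
          ('z, (real ^ 'n) \<times> (real ^ 'n)) tvector \<times> (('z, (real ^ 'n) \<times> (real ^ 'n)) tvector \<Rightarrow> real)) \<Rightarrow>
   bool" where
  "semi_flat Z Jb J \<longleftrightarrow>
     (let M = tb_base Z; V = vertical_bundle Z; T = tangent_bundle M in
      generalized_almost_complex M (sum_bundle V T) Jb \<and> adapted M V T Jb \<and>
      generalized_almost_complex (tb_total Z) (tangent_bundle (tb_total Z)) J \<and>
      (\<forall>z\<in>carrier_of (tb_total Z). \<forall>u\<in>fib (double_bundle (tangent_bundle (tb_total Z))) z.
         J z u = lq_structure (torus_quotient Z) (quad_endo V T Jb) z u))"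

text \<open>
  The permutation $\tau$ interchanging $V$ and $V^\vee$; the third component takes values in
  $(V^\vee)^\vee$, which is identified with \<open>V\<close> by evaluation.
\<close>

definition tau :: "'v::real_vector set \<Rightarrow> ('v, 't) quad \<Rightarrow> ('v \<Rightarrow> real, 't) quad" where
  "tau S = (\<lambda>(v, a, f, g). (f, a, (\<lambda>h. if h \<in> dual_space S then h v else 0), g))"

definition mirror_endo ::
  "('m, 'v::real_vector, 'e) vbundle \<Rightarrow> ('m, 't::real_vector, 'f) vbundle \<Rightarrow>
   ('m \<Rightarrow> ('v, 't) quad \<Rightarrow> ('v, 't) quad) \<Rightarrow>
   'm \<Rightarrow> ('v \<Rightarrow> real, 't) quad \<Rightarrow> ('v \<Rightarrow> real, 't) quad" where
  "mirror_endo V T K x = tau (fib V x) \<circ> K x \<circ> inv_into (quad_fib V T x) (tau (fib V x))"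

text \<open>$\widehat F^{-1} (\hat p^* (\tau \underline{J} \tau^{-1})) \widehat F$ on the dual torus bundle.\<close>

definition mirror_structure where
  "mirror_structure Z Jb =
     (let V = vertical_bundle Z; T = tangent_bundle (tb_base Z) in
      lq_structure (dual_torus_quotient Z) (mirror_endo V T (quad_endo V T Jb)))"

end

theory Submission
  imports Defs
begin

text \<open>
  Sections of the \<open>+i\<close>-eigenbundle are \<open>J a + i a\<close> with \<open>a\<close> real, so \<open>J\<close> is integrable iff
  \<open>N(a, b) = J ([a, b] - [J a, J b]) - [a, J b] - [J a, b]\<close> vanishes for all sections; by
  orthogonality \<open>N\<close> is tensorial, i.e. it is a pointwise expression in \<open>J\<close> and its first derivatives.
  Flat coordinates \<open>x\<close> on the base and \<open>y\<close> on the fibres identify both torus bundles locally with open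
  subsets of the same vector space. There \<open>F\<close> is a permutation of coordinates, the matrix of \<open>J\<close> depends
  on \<open>x\<close> only, and the matrix of the mirror arises by conjugation with the permutation \<open>R\<close> that exchanges
  the directions of \<open>y\<close> with their duals. As no derivative along \<open>y\<close> occurs and \<open>R\<close> preserves the
  pairing, \<open>R\<close> carries \<open>N\<close> to the Nijenhuis expression of the mirror.
\<close>

section \<open>Functions of class $C^k$\<close>

text \<open>Flat coordinates are not part of the data: the structure group condition supplies an
  integral matrix at each base point separately. That these matrices are locally constant is derived
  from continuity of coordinate changes and discreteness of the integer vectors
  (\<open>torus_change\<close>); this makes the transition functions of the vertical bundle and of
  its dual locally constant. The two torus bundles arise differently, one with a given atlas and one
  as a set of cosets, so the computation is carried out once for an abstract quotient
  (\<open>flat_lattice_bundle\<close>, \<open>flat_quotient\<close>) of which both are instances.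
  The maps \<open>lq_D\<close> and \<open>lq_j\<close>, the connection and the covector part of the
  bracket are defined through arbitrary choices of lifts, trivializations or charts. Each coordinate
  formula therefore includes a proof of independence, which rests on lattice translations having
  identity derivative and on the invariance of Lie brackets and Lie derivatives under coordinate
  changes. The resulting criterion refers to charts of the base and all fibre coordinates at once,
  so both structures can be compared over one base point.\<close>

lemma Ck_on_cong:
  assumes "open S" "\<And>x. x \<in> S \<Longrightarrow> f x = g x"
  shows "Ck_on k S f \<longleftrightarrow> Ck_on k S g"
  using assms(2)
proof (induction k arbitrary: f g)
  case 0
  then show ?case by (simp cong: continuous_on_cong)
next
  case (Suc k)
  have diff: "f differentiable (at x) \<longleftrightarrow> g differentiable (at x)" if "x \<in> S" for x
    unfolding differentiable_def
    using has_derivative_transform_within_open[OF _ \<open>open S\<close> that] Suc.prems by metis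
  have eq: "frechet_derivative f (at x) v = frechet_derivative g (at x) v" if "x \<in> S" for x v
  proof -
    have "(f has_derivative D) (at x) \<longleftrightarrow> (g has_derivative D) (at x)" for D
      using has_derivative_transform_within_open[OF _ \<open>open S\<close> that] Suc.prems by metis
    then show ?thesis by (simp add: frechet_derivative_def)
  qed
  then show ?case
    using diff Suc.IH[of "\<lambda>x. frechet_derivative f (at x) v" "\<lambda>x. frechet_derivative g (at x) v" for v]
    by simp
qed

lemma Ck_on_subset: "Ck_on k S f \<Longrightarrow> T \<subseteq> S \<Longrightarrow> Ck_on k T f"
  by (induction k arbitrary: f) (auto intro: continuous_on_subset)

lemma Ck_on_local:
  assumes "\<And>x. x \<in> S \<Longrightarrow> \<exists>T. open T \<and> x \<in> T \<and> Ck_on k T f"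
  shows "Ck_on k S f"
  using assms
proof (induction k arbitrary: f)
  case 0
  have "isCont f x" if "x \<in> S" for x
    using 0[OF that] by (auto simp: continuous_on_eq_continuous_at)
  then show ?case by (simp add: continuous_at_imp_continuous_on)
next
  case (Suc k)
  have "Ck_on k S (\<lambda>x. frechet_derivative f (at x) v)" for v
    by (rule Suc.IH) (use Suc.prems in force)
  then show ?case using Suc.prems by force
qed

lemma Ck_on_SucD: "Ck_on (Suc k) S f \<Longrightarrow> Ck_on k S f"
proof (induction k arbitrary: f)
  case 0
  then show ?case
    by (auto intro!: continuous_at_imp_continuous_on differentiable_imp_continuous_within)
next
  case (Suc k)
  have "Ck_on (Suc k) S (\<lambda>x. frechet_derivative f (at x) v)" for v
    using Suc.prems by (simp only: Ck_on.simps(2)[of "Suc k"])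
  then show ?case using Suc.IH Suc.prems by (simp only: Ck_on.simps(2)) blast
qed

lemma Ck_on_const: "Ck_on k S (\<lambda>x. c)"
  by (induction k arbitrary: c) auto

lemma frechet_derivative_eqI: "(f has_derivative f') (at x) \<Longrightarrow> frechet_derivative f (at x) v = f' v"
  by (metis frechet_derivative_at)

lemma Ck_on_bounded_linear:
  assumes "bounded_linear L"
  shows "Ck_on k S L"
proof (cases k)
  case 0
  then show ?thesis using assms by (simp add: linear_continuous_on)
next
  case (Suc k')
  have D: "(L has_derivative L) (at x)" for x
    using assms by (simp add: bounded_linear_imp_has_derivative)
  then show ?thesis
    by (auto simp: Suc Ck_on_const frechet_derivative_eqI[OF D] intro: differentiableI)
qed

lemma Ck_on_add:
  assumes "open S" "Ck_on k S f" "Ck_on k S g"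
  shows "Ck_on k S (\<lambda>x. f x + g x)"
  using assms(2,3)
proof (induction k arbitrary: f g)
  case 0
  then show ?case by (simp add: continuous_on_add)
next
  case (Suc k)
  have D: "((\<lambda>x. f x + g x) has_derivative
      (\<lambda>v. frechet_derivative f (at x) v + frechet_derivative g (at x) v)) (at x)" if "x \<in> S" for x
    using Suc.prems that by (intro has_derivative_add) (auto simp: frechet_derivative_works)
  have "Ck_on k S (\<lambda>x. frechet_derivative (\<lambda>x. f x + g x) (at x) v)" for v
    using Suc by (subst Ck_on_cong[OF \<open>open S\<close> frechet_derivative_eqI[OF D]]) auto
  then show ?case using D by (auto intro: differentiableI)
qed

lemma Ck_on_bilinear:
  assumes "open S" "bounded_bilinear B" "Ck_on k S f" "Ck_on k S g"
  shows "Ck_on k S (\<lambda>x. B (f x) (g x))"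
  using assms(3,4)
proof (induction k arbitrary: f g)
  case 0
  then show ?case using assms(2) by (simp add: bounded_bilinear.continuous_on)
next
  case (Suc k)
  have D: "((\<lambda>x. B (f x) (g x)) has_derivative
      (\<lambda>v. B (f x) (frechet_derivative g (at x) v) + B (frechet_derivative f (at x) v) (g x))) (at x)"
    if "x \<in> S" for x
    using Suc.prems that
    by (intro bounded_bilinear.FDERIV[OF assms(2)]) (auto simp: frechet_derivative_works)
  have "Ck_on k S (\<lambda>x. frechet_derivative (\<lambda>x. B (f x) (g x)) (at x) v)" for v
  proof (subst Ck_on_cong[OF \<open>open S\<close> frechet_derivative_eqI[OF D]])
    show "Ck_on k S (\<lambda>x. B (f x) (frechet_derivative g (at x) v)
        + B (frechet_derivative f (at x) v) (g x))"
      using Suc.prems Ck_on_SucD[OF Suc.prems(1)] Ck_on_SucD[OF Suc.prems(2)]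
      by (intro Ck_on_add[OF \<open>open S\<close>] Suc.IH) simp_all
  qed
  then show ?case using D by (auto intro: differentiableI)
qed

lemma Ck_on_sum:
  assumes "open S" "\<And>i. i \<in> I \<Longrightarrow> Ck_on k S (f i)"
  shows "Ck_on k S (\<lambda>x. \<Sum>i\<in>I. f i x)"
proof (cases "finite I")
  case True
  then show ?thesis using assms(2)
    by (induction I) (auto simp: Ck_on_const intro!: Ck_on_add[OF assms(1)])
qed (simp add: Ck_on_const)

lemma linear_eq_sum_Basis:
  fixes L :: "'a::euclidean_space \<Rightarrow> 'b::real_vector"
  assumes "linear L"
  shows "L v = (\<Sum>b\<in>Basis. (v \<bullet> b) *\<^sub>R L b)"
proof -
  have "L v = L (\<Sum>b\<in>Basis. (v \<bullet> b) *\<^sub>R b)"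
    by (simp add: euclidean_representation)
  then show ?thesis using assms by (simp add: linear_sum linear_scale)
qed

text \<open>\<open>Ck_on\<close> speaks of derivatives in a fixed direction, but the chain rule
  applies the derivative of \<open>f\<close> to a vector that moves with \<open>x\<close>. Expanding
  that vector in \<open>Basis\<close> leaves products of scalar functions with derivatives in fixed
  directions, to which the induction applies; hence the intermediate space is Euclidean.\<close>

lemma Ck_on_compose:
  fixes f :: "'b::euclidean_space \<Rightarrow> 'c::real_normed_vector" and g :: "'a::real_normed_vector \<Rightarrow> 'b"
  assumes "open S" "g ` S \<subseteq> T" "Ck_on k T f" "Ck_on k S g"
  shows "Ck_on k S (\<lambda>x. f (g x))"
  using assms(3,4)
proof (induction k arbitrary: f)
  case 0
  then show ?case using continuous_on_compose2[of T f S g] assms(2) by simp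
next
  case (Suc k)
  have D: "((\<lambda>x. f (g x)) has_derivative
      (\<lambda>v. frechet_derivative f (at (g x)) (frechet_derivative g (at x) v))) (at x)"
    if "x \<in> S" for x
  proof -
    have "f differentiable (at (g x))" "g differentiable (at x)"
      using Suc.prems that assms(2) by auto
    then show ?thesis
      unfolding frechet_derivative_works by (blast intro: has_derivative_compose)
  qed
  have E: "frechet_derivative (\<lambda>x. f (g x)) (at x) v =
      (\<Sum>b\<in>Basis. (frechet_derivative g (at x) v \<bullet> b) *\<^sub>R frechet_derivative f (at (g x)) b)"
    if "x \<in> S" for x v
  proof -
    have "linear (frechet_derivative f (at (g x)))"
      using Suc.prems that assms(2) by (intro linear_frechet_derivative) auto
    then show ?thesis
      unfolding frechet_derivative_eqI[OF D[OF that]] by (rule linear_eq_sum_Basis)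
  qed
  have "Ck_on k S (\<lambda>x. frechet_derivative (\<lambda>x. f (g x)) (at x) v)" for v
  proof (subst Ck_on_cong[OF \<open>open S\<close> E])
    show "Ck_on k S (\<lambda>x. \<Sum>b\<in>Basis.
        (frechet_derivative g (at x) v \<bullet> b) *\<^sub>R frechet_derivative f (at (g x)) b)"
    proof (intro Ck_on_sum[OF \<open>open S\<close>] Ck_on_bilinear[OF \<open>open S\<close> bounded_bilinear_scaleR])
      fix b :: 'b assume "b \<in> Basis"
      show "Ck_on k S (\<lambda>x. frechet_derivative g (at x) v \<bullet> b)"
        using Suc.prems by (intro Ck_on_bilinear[OF \<open>open S\<close> bounded_bilinear_inner] Ck_on_const) auto
      show "Ck_on k S (\<lambda>x. frechet_derivative f (at (g x)) b)"
        using Suc.prems Ck_on_SucD[OF Suc.prems(2)] by (intro Suc.IH) simp_all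
    qed
  qed
  then show ?case using D by (auto intro: differentiableI)
qed

lemma smooth_on_cong: "open S \<Longrightarrow> (\<And>x. x \<in> S \<Longrightarrow> f x = g x) \<Longrightarrow> smooth_on S f \<longleftrightarrow> smooth_on S g"
  unfolding smooth_on_def using Ck_on_cong by blast

lemma smooth_on_eq:
  "open S \<Longrightarrow> smooth_on S g \<Longrightarrow> (\<And>x. x \<in> S \<Longrightarrow> f x = g x) \<Longrightarrow> smooth_on S f"
  by (simp cong: smooth_on_cong)

lemma smooth_on_subset: "smooth_on S f \<Longrightarrow> T \<subseteq> S \<Longrightarrow> smooth_on T f"
  unfolding smooth_on_def using Ck_on_subset by blast

lemma smooth_on_local:
  assumes "\<And>x. x \<in> S \<Longrightarrow> \<exists>T. open T \<and> x \<in> T \<and> smooth_on T f"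
  shows "smooth_on S f"
  using assms unfolding smooth_on_def by (intro allI Ck_on_local) blast

lemma smooth_on_const: "smooth_on S (\<lambda>x. c)"
  by (simp add: smooth_on_def Ck_on_const)

lemma smooth_on_bounded_linear: "bounded_linear L \<Longrightarrow> smooth_on S L"
  by (simp add: smooth_on_def Ck_on_bounded_linear)

lemma smooth_on_ident: "smooth_on S (\<lambda>x. x)"
  by (rule smooth_on_bounded_linear) (rule bounded_linear_ident)

lemma smooth_on_add:
  "open S \<Longrightarrow> smooth_on S f \<Longrightarrow> smooth_on S g \<Longrightarrow> smooth_on S (\<lambda>x. f x + g x)"
  by (simp add: smooth_on_def Ck_on_add)

lemma smooth_on_bilinear:
  "open S \<Longrightarrow> bounded_bilinear B \<Longrightarrow> smooth_on S f \<Longrightarrow> smooth_on S g \<Longrightarrow> smooth_on S (\<lambda>x. B (f x) (g x))"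
  by (simp add: smooth_on_def Ck_on_bilinear)

lemma smooth_on_sum:
  "open S \<Longrightarrow> (\<And>i. i \<in> I \<Longrightarrow> smooth_on S (f i)) \<Longrightarrow> smooth_on S (\<lambda>x. \<Sum>i\<in>I. f i x)"
  by (simp add: smooth_on_def Ck_on_sum)

lemma smooth_on_scaleR:
  "open S \<Longrightarrow> smooth_on S f \<Longrightarrow> smooth_on S g \<Longrightarrow> smooth_on S (\<lambda>x. f x *\<^sub>R g x)"
  by (rule smooth_on_bilinear[OF _ bounded_bilinear_scaleR])

lemma smooth_on_inner:
  "open S \<Longrightarrow> smooth_on S f \<Longrightarrow> smooth_on S g \<Longrightarrow> smooth_on S (\<lambda>x. f x \<bullet> g x)"
  by (rule smooth_on_bilinear[OF _ bounded_bilinear_inner])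

lemma smooth_on_compose:
  fixes f :: "'b::euclidean_space \<Rightarrow> 'c::real_normed_vector"
  assumes "open S" "smooth_on T f" "smooth_on S g" "g ` S \<subseteq> T"
  shows "smooth_on S (\<lambda>x. f (g x))"
  using assms by (simp add: smooth_on_def Ck_on_compose)

lemma smooth_on_linear:
  fixes f :: "'a::euclidean_space \<Rightarrow> 'b::real_normed_vector"
  assumes "open S" "linear f" "smooth_on S g"
  shows "smooth_on S (\<lambda>x. f (g x))"
  by (rule smooth_on_compose[OF assms(1) smooth_on_bounded_linear assms(3)])
     (use assms(2) linear_conv_bounded_linear in auto)

lemma smooth_on_minus:
  fixes f :: "'a::real_normed_vector \<Rightarrow> 'b::euclidean_space"
  shows "open S \<Longrightarrow> smooth_on S f \<Longrightarrow> smooth_on S (\<lambda>x. - f x)"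
  by (rule smooth_on_linear[of _ uminus]) (auto intro: linearI)

lemma smooth_on_diff:
  fixes f g :: "'a::real_normed_vector \<Rightarrow> 'b::euclidean_space"
  shows "open S \<Longrightarrow> smooth_on S f \<Longrightarrow> smooth_on S g \<Longrightarrow> smooth_on S (\<lambda>x. f x - g x)"
  using smooth_on_add[of S f "\<lambda>x. - g x"] smooth_on_minus[of S g] by simp

lemma smooth_on_Pair:
  fixes f :: "'a::real_normed_vector \<Rightarrow> 'b::euclidean_space" and g :: "'a \<Rightarrow> 'c::euclidean_space"
  assumes "open S" "smooth_on S f" "smooth_on S g"
  shows "smooth_on S (\<lambda>x. (f x, g x))"
proof -
  have 1: "linear (\<lambda>v::'b. (v, 0::'c))" and 2: "linear (\<lambda>v::'c. (0::'b, v))"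
    by (auto intro: linearI)
  have "smooth_on S (\<lambda>x. (f x, 0) + (0, g x))"
    by (intro smooth_on_add assms smooth_on_linear[OF _ 1] smooth_on_linear[OF _ 2])
  then show ?thesis by simp
qed

lemma smooth_on_fst:
  fixes f :: "'a::real_normed_vector \<Rightarrow> 'b::euclidean_space \<times> 'c::euclidean_space"
  shows "open S \<Longrightarrow> smooth_on S f \<Longrightarrow> smooth_on S (\<lambda>x. fst (f x))"
  by (rule smooth_on_linear) (auto intro: linear_fst)

lemma smooth_on_snd:
  fixes f :: "'a::real_normed_vector \<Rightarrow> 'b::euclidean_space \<times> 'c::euclidean_space"
  shows "open S \<Longrightarrow> smooth_on S f \<Longrightarrow> smooth_on S (\<lambda>x. snd (f x))"
  by (rule smooth_on_linear) (auto intro: linear_snd)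

lemma smooth_on_differentiable: "smooth_on S f \<Longrightarrow> x \<in> S \<Longrightarrow> f differentiable (at x)"
  unfolding smooth_on_def by (drule spec[of _ "Suc 0"]) simp

lemma smooth_on_has_derivative:
  "smooth_on S f \<Longrightarrow> x \<in> S \<Longrightarrow> (f has_derivative frechet_derivative f (at x)) (at x)"
  using smooth_on_differentiable frechet_derivative_works by blast

lemma smooth_on_linear_derivative:
  "smooth_on S f \<Longrightarrow> x \<in> S \<Longrightarrow> linear (frechet_derivative f (at x))"
  using smooth_on_differentiable linear_frechet_derivative by blast

lemma smooth_on_continuous_on: "smooth_on S f \<Longrightarrow> continuous_on S f"
  unfolding smooth_on_def by (drule spec[of _ 0]) simp

lemma smooth_on_derivative: "smooth_on S f \<Longrightarrow> smooth_on S (\<lambda>x. frechet_derivative f (at x) v)"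
  unfolding smooth_on_def by (intro allI, rename_tac k, drule_tac x = "Suc k" in spec) simp

lemma smooth_on_derivative_along:
  fixes f :: "'a::euclidean_space \<Rightarrow> 'b::real_normed_vector"
  assumes "open S" "smooth_on S f" "smooth_on S w"
  shows "smooth_on S (\<lambda>x. frechet_derivative f (at x) (w x))"
proof -
  have "smooth_on S (\<lambda>x. \<Sum>b\<in>Basis. (w x \<bullet> b) *\<^sub>R frechet_derivative f (at x) b)"
    using assms
    by (intro smooth_on_sum smooth_on_scaleR smooth_on_inner smooth_on_derivative smooth_on_const)
  moreover have "smooth_on S (\<lambda>x. frechet_derivative f (at x) (w x)) \<longleftrightarrow>
      smooth_on S (\<lambda>x. \<Sum>b\<in>Basis. (w x \<bullet> b) *\<^sub>R frechet_derivative f (at x) b)"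
    by (intro smooth_on_cong assms linear_eq_sum_Basis smooth_on_linear_derivative[OF assms(2)])
  ultimately show ?thesis by blast
qed

lemma frechet_derivative_cong_open:
  assumes "open S" "x \<in> S" "\<And>y. y \<in> S \<Longrightarrow> f y = g y"
  shows "frechet_derivative f (at x) = frechet_derivative g (at x)"
proof -
  have "(f has_derivative D) (at x) \<longleftrightarrow> (g has_derivative D) (at x)" for D
    using has_derivative_transform_within_open[OF _ assms(1,2)] assms(3) by metis
  then show ?thesis by (simp add: frechet_derivative_def)
qed

section \<open>Symmetry of second derivatives\<close>

lemma has_real_derivative_along_line:
  fixes f :: "'a::real_normed_vector \<Rightarrow> real"
  assumes "smooth_on S f" "a + t *\<^sub>R v \<in> S"
  shows "((\<lambda>t. f (a + t *\<^sub>R v)) has_real_derivative frechet_derivative f (at (a + t *\<^sub>R v)) v) (at t)"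
proof -
  let ?D = "frechet_derivative f (at (a + t *\<^sub>R v))"
  have "((\<lambda>t. f (a + t *\<^sub>R v)) has_derivative (\<lambda>h. ?D (h *\<^sub>R v))) (at t)"
    by (rule has_derivative_compose[where f = "\<lambda>t. a + t *\<^sub>R v" and g = f])
       (auto intro!: derivative_eq_intros smooth_on_has_derivative[OF assms])
  moreover have "(\<lambda>h. ?D (h *\<^sub>R v)) = (*) (?D v)"
    using linear_scale[OF smooth_on_linear_derivative[OF assms]] by (auto simp: mult.commute)
  ultimately show ?thesis by (simp add: has_field_derivative_def)
qed

text \<open>The second difference is the increment over \<open>[0, s]\<close> of
  \<open>t \<mapsto> f (x + s w + t v) - f (x + t v)\<close>. One mean value theorem extracts a
  factor \<open>s\<close> and the derivative along \<open>v\<close>, a second one, applied to that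
  derivative along \<open>w\<close>, extracts the other. The left side is symmetric in
  \<open>v\<close> and \<open>w\<close> although the right side does not look so; this is the source
  of the symmetry.\<close>

lemma second_difference_mean_value:
  fixes f :: "'a::real_normed_vector \<Rightarrow> real"
  assumes f: "smooth_on S f" and S: "ball x \<delta> \<subseteq> S" and s: "0 < s" "s * (norm v + norm w) < \<delta>"
  shows "\<exists>p\<in>ball x \<delta>. f (x + s *\<^sub>R v + s *\<^sub>R w) - f (x + s *\<^sub>R v) - f (x + s *\<^sub>R w) + f x
           = s * s * frechet_derivative (\<lambda>z. frechet_derivative f (at z) v) (at p) w"
proof -
  have in_ball: "x + t *\<^sub>R v + r *\<^sub>R w \<in> ball x \<delta>" if "0 \<le> t" "t \<le> s" "0 \<le> r" "r \<le> s" for t r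
  proof -
    have "norm (t *\<^sub>R v + r *\<^sub>R w) \<le> t * norm v + r * norm w"
      using norm_triangle_ineq[of "t *\<^sub>R v" "r *\<^sub>R w"] that by simp
    also have "\<dots> \<le> s * norm v + s * norm w"
      using that by (intro add_mono mult_right_mono) auto
    finally have "norm (t *\<^sub>R v + r *\<^sub>R w) < \<delta>" using s by (simp add: algebra_simps)
    then show ?thesis
      using norm_minus_cancel[of "t *\<^sub>R v + r *\<^sub>R w"] by (simp add: dist_norm algebra_simps)
  qed
  define g where "g = (\<lambda>t. f ((x + s *\<^sub>R w) + t *\<^sub>R v) - f (x + t *\<^sub>R v))"
  define g' where "g' = (\<lambda>t. frechet_derivative f (at ((x + s *\<^sub>R w) + t *\<^sub>R v)) v
     - frechet_derivative f (at (x + t *\<^sub>R v)) v)"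
  have "(g has_real_derivative g' t) (at t)" if "0 \<le> t" "t \<le> s" for t
    unfolding g_def g'_def
    using in_ball[OF that, of s] in_ball[OF that, of 0] s S
    by (intro DERIV_diff has_real_derivative_along_line[OF f]) (auto simp: algebra_simps)
  from MVT2[of 0 s g g', OF s(1) this]
  obtain t where t: "0 < t" "t < s" "g s - g 0 = s * g' t" by auto
  let ?h = "\<lambda>z. frechet_derivative f (at z) v"
  have "((\<lambda>r. ?h ((x + t *\<^sub>R v) + r *\<^sub>R w)) has_real_derivative
      frechet_derivative ?h (at ((x + t *\<^sub>R v) + r *\<^sub>R w)) w) (at r)" if "0 \<le> r" "r \<le> s" for r
    using in_ball[of t r] t that S
    by (intro has_real_derivative_along_line[OF smooth_on_derivative[OF f]]) auto
  from MVT2[of 0 s, OF s(1) this] obtain r where r: "0 < r" "r < s"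
    "?h ((x + t *\<^sub>R v) + s *\<^sub>R w) - ?h ((x + t *\<^sub>R v) + 0 *\<^sub>R w)
      = s * frechet_derivative ?h (at ((x + t *\<^sub>R v) + r *\<^sub>R w)) w" by auto
  have "f (x + s *\<^sub>R v + s *\<^sub>R w) - f (x + s *\<^sub>R v) - f (x + s *\<^sub>R w) + f x = g s - g 0"
    by (simp add: g_def algebra_simps)
  also have "\<dots> = s * s * frechet_derivative ?h (at ((x + t *\<^sub>R v) + r *\<^sub>R w)) w"
    using t(3) r(3) by (simp add: g'_def algebra_simps)
  finally show ?thesis
    using in_ball[of t r] t r by (intro bexI[of _ "(x + t *\<^sub>R v) + r *\<^sub>R w"]) auto
qed

lemma frechet_derivative_commute_real:
  fixes f :: "'a::real_normed_vector \<Rightarrow> real"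
  assumes "open S" and f: "smooth_on S f" and x: "x \<in> S"
  shows "frechet_derivative (\<lambda>z. frechet_derivative f (at z) v) (at x) w
       = frechet_derivative (\<lambda>z. frechet_derivative f (at z) w) (at x) v"
proof -
  let ?A = "\<lambda>p. frechet_derivative (\<lambda>z. frechet_derivative f (at z) v) (at p) w"
  let ?B = "\<lambda>p. frechet_derivative (\<lambda>z. frechet_derivative f (at z) w) (at p) v"
  have cont: "isCont ?A x" "isCont ?B x"
    using smooth_on_continuous_on[OF smooth_on_derivative[OF smooth_on_derivative[OF f]]] assms
    by (auto simp: continuous_on_eq_continuous_at)
  have "\<bar>?A x - ?B x\<bar> \<le> e" if "e > 0" for e
  proof -
    have e2: "e / 2 > 0" using that by simp
    obtain d0 where d0: "d0 > 0" "ball x d0 \<subseteq> S" using \<open>open S\<close> x by (meson open_contains_ball)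
    obtain d1 where d1: "d1 > 0" "\<And>p. dist p x < d1 \<Longrightarrow> dist (?A p) (?A x) < e / 2"
      using cont(1) e2 unfolding continuous_at_eps_delta by blast
    obtain d2 where d2: "d2 > 0" "\<And>p. dist p x < d2 \<Longrightarrow> dist (?B p) (?B x) < e / 2"
      using cont(2) e2 unfolding continuous_at_eps_delta by blast
    define d where "d = min d0 (min d1 d2)"
    \<comment> \<open>The summand \<open>1\<close> keeps the denominator positive when
      \<open>v\<close> and \<open>w\<close> both vanish and makes
      \<open>s * (norm v + norm w) < d\<close> strict.\<close>
    define s where "s = d / (norm v + norm w + 1)"
    have d: "d > 0" "ball x d \<subseteq> S" using d0 d1 d2 by (auto simp: d_def)
    have n: "norm v + norm w + 1 > 0" by (smt (verit) norm_ge_zero)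
    then have s: "s > 0" using d by (simp add: s_def)
    have "s * (norm v + norm w) < s * (norm v + norm w + 1)" using s by simp
    also have "\<dots> = d" using n by (simp add: s_def)
    finally have sd: "s * (norm v + norm w) < d" .
    from second_difference_mean_value[OF f d(2) s sd] obtain p where p: "p \<in> ball x d"
      "f (x + s *\<^sub>R v + s *\<^sub>R w) - f (x + s *\<^sub>R v) - f (x + s *\<^sub>R w) + f x = s * s * ?A p" by blast
    from second_difference_mean_value[OF f d(2) s, of w v] sd obtain q where q: "q \<in> ball x d"
      "f (x + s *\<^sub>R w + s *\<^sub>R v) - f (x + s *\<^sub>R w) - f (x + s *\<^sub>R v) + f x = s * s * ?B q"
      by (auto simp: add.commute)
    have "s * s * ?A p = s * s * ?B q"
      unfolding p(2)[symmetric] q(2)[symmetric] by (simp add: algebra_simps)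
    then have "?A p = ?B q" using s by simp
    moreover have "dist (?A p) (?A x) < e / 2"
      by (rule d1) (use p(1) in \<open>simp add: d_def dist_commute\<close>)
    moreover have "dist (?B q) (?B x) < e / 2"
      by (rule d2) (use q(1) in \<open>simp add: d_def dist_commute\<close>)
    ultimately show ?thesis unfolding dist_real_def by linarith
  qed
  \<comment> \<open>A positive gap would be bounded by half of itself.\<close>
  from this[of "\<bar>?A x - ?B x\<bar> / 2"] show ?thesis by force
qed

lemma frechet_derivative_linear_comp:
  assumes "bounded_linear L" "f differentiable (at x)"
  shows "frechet_derivative (\<lambda>z. L (f z)) (at x) v = L (frechet_derivative f (at x) v)"
  by (rule frechet_derivative_eqI[OF bounded_linear.has_derivative[OF assms(1)]])
     (use assms(2) frechet_derivative_works in blast)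

lemma frechet_derivative_commute:
  fixes f :: "'a::real_normed_vector \<Rightarrow> 'b::euclidean_space"
  assumes "open S" and f: "smooth_on S f" and x: "x \<in> S"
  shows "frechet_derivative (\<lambda>z. frechet_derivative f (at z) v) (at x) w
       = frechet_derivative (\<lambda>z. frechet_derivative f (at z) w) (at x) v"
proof (rule euclidean_eqI)
  fix b :: 'b assume "b \<in> Basis"
  have bl: "bounded_linear (\<lambda>y. y \<bullet> b)" by (rule bounded_linear_inner_left)
  have eq: "frechet_derivative (\<lambda>z. frechet_derivative f (at z) v) (at x) w \<bullet> b
    = frechet_derivative (\<lambda>z. frechet_derivative (\<lambda>z. f z \<bullet> b) (at z) v) (at x) w" for v w
  proof -
    have "frechet_derivative (\<lambda>z. frechet_derivative (\<lambda>z. f z \<bullet> b) (at z) v) (at x)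
      = frechet_derivative (\<lambda>z. frechet_derivative f (at z) v \<bullet> b) (at x)"
      by (rule frechet_derivative_cong_open[OF \<open>open S\<close> x])
         (rule frechet_derivative_linear_comp[OF bl smooth_on_differentiable[OF f]])
    then show ?thesis
      using frechet_derivative_linear_comp[OF bl
          smooth_on_differentiable[OF smooth_on_derivative[OF f] x]] by simp
  qed
  have "smooth_on S (\<lambda>z. f z \<bullet> b)"
    by (intro smooth_on_inner assms smooth_on_const)
  from frechet_derivative_commute_real[OF \<open>open S\<close> this x]
  show "frechet_derivative (\<lambda>z. frechet_derivative f (at z) v) (at x) w \<bullet> b
     = frechet_derivative (\<lambda>z. frechet_derivative f (at z) w) (at x) v \<bullet> b"
    by (simp only: eq)
qed

section \<open>Charts and tangent vectors\<close>

lemma has_derivative_cong_open: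
  assumes "open S" "x \<in> S" "\<And>y. y \<in> S \<Longrightarrow> f y = g y" "(g has_derivative D) (at x)"
  shows "(f has_derivative D) (at x)"
  using has_derivative_transform_within_open[OF assms(4,1,2)] assms(3) by simp

abbreviation transition :: "('a, 'e) chart \<Rightarrow> ('a, 'e) chart \<Rightarrow> 'e \<Rightarrow> 'e" where
  "transition c c' \<equiv> snd c' \<circ> chart_inv c"

abbreviation dtransition ::
  "('a, 'e::euclidean_space) chart \<Rightarrow> ('a, 'e) chart \<Rightarrow> 'a \<Rightarrow> 'e \<Rightarrow> 'e" where
  "dtransition c c' x \<equiv> frechet_derivative (transition c c') (at (snd c x))"

lemma is_chart_inv_left: "is_chart c \<Longrightarrow> x \<in> fst c \<Longrightarrow> chart_inv c (snd c x) = x"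
  by (simp add: is_chart_def chart_inv_def)

lemma compatible_sym: "compatible c c' \<Longrightarrow> compatible c' c"
  by (auto simp: compatible_def Int_commute)

lemma continuous_open_preimage_image:
  assumes "open S" "continuous_on S f" "open T"
  shows "open (S \<inter> f -` T)"
  using assms continuous_open_preimage by blast

text \<open>Overlaps of two charts are covered by the domains of an atlas, through which the
  coordinate change factors.\<close>

lemma max_atlas_compatible:
  assumes A: "smooth_atlas A" and c: "c \<in> max_atlas A" and c': "c' \<in> max_atlas A"
  shows "open (snd c ` (fst c \<inter> fst c'))" "smooth_on (snd c ` (fst c \<inter> fst c')) (transition c c')"
proof -
  have ch: "is_chart c" "is_chart c'" and sub: "fst c \<subseteq> carrier_of A"
    and cc: "\<And>a. a \<in> A \<Longrightarrow> compatible c a" "\<And>a. a \<in> A \<Longrightarrow> compatible a c'"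
    using c c' by (auto simp: max_atlas_def compatible_sym)
  \<comment> \<open>\<open>?W a\<close> is the part of the overlap inside the domain of
    \<open>a\<close>, written as a preimage so that its openness follows from continuity of the
    coordinate change to \<open>a\<close>.\<close>
  let ?W = "\<lambda>a. snd c ` (fst c \<inter> fst a) \<inter> transition c a -` (snd a ` (fst a \<inter> fst c'))"
  have opW: "open (?W a)" if "a \<in> A" for a
    using cc[OF that] smooth_on_continuous_on[of _ "transition c a"]
    by (intro continuous_open_preimage_image) (simp_all only: compatible_def)
  have W: "?W a = snd c ` (fst c \<inter> fst c' \<inter> fst a)" if "a \<in> A" for a
  proof -
    have a: "is_chart a" using A that by (auto simp: smooth_atlas_def)
    show ?thesis
    proof (intro equalityI subsetI)
      fix p assume "p \<in> ?W a"
      then obtain x y where xy: "x \<in> fst c" "x \<in> fst a" "p = snd c x"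
        "y \<in> fst a" "y \<in> fst c'" "snd a (chart_inv c p) = snd a y" by auto
      then have "snd a x = snd a y" using is_chart_inv_left[OF ch(1)] by simp
      then have "x = y" using a xy by (auto simp: is_chart_def inj_on_def)
      then show "p \<in> snd c ` (fst c \<inter> fst c' \<inter> fst a)" using xy by auto
    qed (use is_chart_inv_left[OF ch(1)] in auto)
  qed
  have cover: "\<exists>a\<in>A. x \<in> fst a" if "x \<in> fst c" for x
    using sub that by (auto simp: carrier_of_def)
  have "snd c ` (fst c \<inter> fst c') = (\<Union>a\<in>A. ?W a)"
    using cover by (simp add: W) blast
  then show "open (snd c ` (fst c \<inter> fst c'))" using opW by auto
  show "smooth_on (snd c ` (fst c \<inter> fst c')) (transition c c')"
  proof (rule smooth_on_local)
    fix p assume "p \<in> snd c ` (fst c \<inter> fst c')"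
    then obtain x where x: "x \<in> fst c" "x \<in> fst c'" "p = snd c x" by auto
    with cover obtain a where a: "a \<in> A" "x \<in> fst a" by blast
    have ach: "is_chart a" using A a by (auto simp: smooth_atlas_def)
    have "smooth_on (?W a) (\<lambda>p. transition a c' (transition c a p))"
    proof (rule smooth_on_compose[where f = "transition a c'" and g = "transition c a"
          and T = "snd a ` (fst a \<inter> fst c')", OF opW[OF a(1)]])
      show "smooth_on (snd a ` (fst a \<inter> fst c')) (transition a c')"
        using cc(2)[OF a(1)] by (simp only: compatible_def)
      have "smooth_on (snd c ` (fst c \<inter> fst a)) (transition c a)"
        using cc(1)[OF a(1)] by (simp only: compatible_def)
      then show "smooth_on (?W a) (transition c a)" by (rule smooth_on_subset) blast
    qed blast
    moreover have "transition a c' (transition c a p) = transition c c' p" if "p \<in> ?W a" for p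
      using that is_chart_inv_left[OF ach] is_chart_inv_left[OF ch(1)] by auto metis
    ultimately have "smooth_on (?W a) (transition c c')"
      using smooth_on_cong[OF opW[OF a(1)]] by metis
    moreover have "p \<in> ?W a" using x a by (simp add: W)
    ultimately show "\<exists>T. open T \<and> p \<in> T \<and> smooth_on T (transition c c')"
      using opW[OF a(1)] by blast
  qed
qed

lemma smooth_atlas_max_atlas: "smooth_atlas A \<Longrightarrow> smooth_atlas (max_atlas A)"
  unfolding smooth_atlas_def[of "max_atlas A"] compatible_def
proof (intro conjI ballI)
  fix c c' assume A: "smooth_atlas A" and c: "c \<in> max_atlas A" and c': "c' \<in> max_atlas A"
  show "is_chart c" using c by (simp add: max_atlas_def)
  show "open (snd c ` (fst c \<inter> fst c'))" "open (snd c' ` (fst c \<inter> fst c'))"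
    "smooth_on (snd c ` (fst c \<inter> fst c')) (transition c c')"
    "smooth_on (snd c' ` (fst c \<inter> fst c')) (transition c' c)"
    using max_atlas_compatible[OF A c c'] max_atlas_compatible[OF A c' c]
    by (simp_all only: Int_commute[of "fst c'"])
qed

lemma subset_max_atlas: "smooth_atlas A \<Longrightarrow> A \<subseteq> max_atlas A"
  by (auto simp: smooth_atlas_def max_atlas_def carrier_of_def)

lemma carrier_of_max_atlas: "smooth_atlas A \<Longrightarrow> carrier_of (max_atlas A) = carrier_of A"
  using subset_max_atlas[of A] by (auto simp: max_atlas_def carrier_of_def)

locale atlas =
  fixes A :: "('a, 'e::euclidean_space) chart set"
  assumes smooth_atlas: "smooth_atlas A"
begin

lemma is_chart: "c \<in> A \<Longrightarrow> is_chart c"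
  using smooth_atlas by (auto simp: smooth_atlas_def)

lemma inv_left [simp]: "c \<in> A \<Longrightarrow> x \<in> fst c \<Longrightarrow> chart_inv c (snd c x) = x"
  by (rule is_chart_inv_left[OF is_chart])

lemma open_chart: "c \<in> A \<Longrightarrow> open (snd c ` fst c)"
  using is_chart by (auto simp: is_chart_def)

lemma open_overlap: "c \<in> A \<Longrightarrow> c' \<in> A \<Longrightarrow> open (snd c ` (fst c \<inter> fst c'))"
  using smooth_atlas by (auto simp: smooth_atlas_def compatible_def)

lemma transition_smooth:
  "c \<in> A \<Longrightarrow> c' \<in> A \<Longrightarrow> smooth_on (snd c ` (fst c \<inter> fst c')) (transition c c')"
  using smooth_atlas by (auto simp: smooth_atlas_def compatible_def)

lemma transition_has_derivative:
  assumes "c \<in> A" "c' \<in> A" "x \<in> fst c" "x \<in> fst c'"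
  shows "(transition c c' has_derivative dtransition c c' x) (at (snd c x))"
  using smooth_on_has_derivative[OF transition_smooth[OF assms(1,2)]] assms by blast

lemma linear_dtransition:
  assumes "c \<in> A" "c' \<in> A" "x \<in> fst c" "x \<in> fst c'"
  shows "linear (dtransition c c' x)"
  using has_derivative_linear[OF transition_has_derivative[OF assms]] .

lemma chart_change_eq:
  assumes "c \<in> A" "c' \<in> A" "p \<in> snd c' ` (fst c' \<inter> fst c)"
  shows "(F \<circ> chart_inv c') p = (F \<circ> chart_inv c) (transition c' c p)"
  using assms by auto

lemma has_derivative_chart_change:
  assumes "c \<in> A" "c' \<in> A" "x \<in> fst c" "x \<in> fst c'"
    and "((F \<circ> chart_inv c) has_derivative D) (at (snd c x))"
  shows "((F \<circ> chart_inv c') has_derivative (\<lambda>v. D (dtransition c' c x v))) (at (snd c' x))"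
proof (rule has_derivative_cong_open[OF open_overlap[OF assms(2,1)]])
  show "snd c' x \<in> snd c' ` (fst c' \<inter> fst c)" using assms by blast
  show "(F \<circ> chart_inv c') p = (F \<circ> chart_inv c) (transition c' c p)"
    if "p \<in> snd c' ` (fst c' \<inter> fst c)" for p
    using chart_change_eq[OF assms(1,2) that] .
  show "((\<lambda>p. (F \<circ> chart_inv c) (transition c' c p)) has_derivative
      (\<lambda>v. D (dtransition c' c x v))) (at (snd c' x))"
  proof (rule has_derivative_compose[where f = "transition c' c"])
    show "(transition c' c has_derivative dtransition c' c x) (at (snd c' x))"
      using transition_has_derivative assms by blast
    show "((F \<circ> chart_inv c) has_derivative D) (at (transition c' c (snd c' x)))"
      using assms by (simp only: o_apply inv_left)
  qed
qed

lemma smooth_on_chart_change: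
  assumes "c \<in> A" "c' \<in> A" "S \<subseteq> fst c \<inter> fst c'" "open (snd c' ` S)"
    "smooth_on (snd c ` S) (F \<circ> chart_inv c)"
  shows "smooth_on (snd c' ` S) (F \<circ> chart_inv c')"
proof -
  have "smooth_on (snd c' ` S) (\<lambda>p. (F \<circ> chart_inv c) (transition c' c p))"
    using assms
    by (intro smooth_on_compose[OF _ assms(5)] smooth_on_subset[OF transition_smooth]) auto
  then show ?thesis
    using smooth_on_cong[OF assms(4), of "F \<circ> chart_inv c'"] chart_change_eq[OF assms(1,2), of _ F]
      assms(3) by (metis (no_types, lifting) image_mono inf_commute subsetD)
qed

text \<open>The chain rule for a coordinate change that factors through \<open>c'\<close>; it makes
  the family \<open>tvec\<close> consistent and thus a tangent vector.\<close>

lemma dtransition_cocycle: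
  assumes "c \<in> A" "c' \<in> A" "c'' \<in> A" "x \<in> fst c" "x \<in> fst c'" "x \<in> fst c''"
  shows "dtransition c' c'' x (dtransition c c' x v) = dtransition c c'' x v"
  by (rule frechet_derivative_eqI[symmetric])
     (use has_derivative_chart_change[of c' c x "snd c''"] transition_has_derivative assms in blast)

lemma dtransition_self:
  assumes "c \<in> A" "x \<in> fst c"
  shows "dtransition c c x v = v"
  by (rule frechet_derivative_eqI,
      rule has_derivative_cong_open[OF open_chart[OF assms(1)] _ _ has_derivative_ident])
     (use assms in auto)

lemma openin_subset_carrier: "openin (mtop A) U \<Longrightarrow> U \<subseteq> carrier_of A"
  by (simp add: openin_mtop[OF smooth_atlas])

lemma open_image_chart: "openin (mtop A) U \<Longrightarrow> c \<in> A \<Longrightarrow> open (snd c ` (U \<inter> fst c))"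
  by (simp add: openin_mtop[OF smooth_atlas])

lemma openin_chart: "c \<in> A \<Longrightarrow> openin (mtop A) (fst c)"
  using open_overlap by (auto simp: openin_mtop[OF smooth_atlas] carrier_of_def Int_commute)

lemma openin_chart_preimage:
  assumes c: "c \<in> A" and T: "open T"
  shows "openin (mtop A) {x \<in> fst c. snd c x \<in> T}"
  unfolding openin_mtop[OF smooth_atlas]
proof (intro conjI ballI)
  fix c' assume c': "c' \<in> A"
  have "snd c' ` ({x \<in> fst c. snd c x \<in> T} \<inter> fst c')
      = snd c' ` (fst c' \<inter> fst c) \<inter> transition c' c -` T"
    using c c' by auto
  then show "open (snd c' ` ({x \<in> fst c. snd c x \<in> T} \<inter> fst c'))"
    using continuous_open_preimage_image[OF open_overlap[OF c' c]
        smooth_on_continuous_on[OF transition_smooth[OF c' c]] T] by simp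
qed (use c in \<open>auto simp: carrier_of_def\<close>)

lemma chart_at:
  assumes "x \<in> carrier_of A"
  shows "chart_at A x \<in> A" "x \<in> fst (chart_at A x)"
proof -
  have "\<exists>c. c \<in> A \<and> x \<in> fst c" using assms by (auto simp: carrier_of_def)
  from someI_ex[OF this] show "chart_at A x \<in> A" "x \<in> fst (chart_at A x)"
    by (simp_all add: chart_at_def)
qed

lemma mem_carrier: "c \<in> A \<Longrightarrow> x \<in> fst c \<Longrightarrow> x \<in> carrier_of A"
  by (auto simp: carrier_of_def)

lemma tvec_apply: "c' \<in> A \<Longrightarrow> x \<in> fst c' \<Longrightarrow> tvec A c x b c' = dtransition c c' x b"
  by (simp add: tvec_def)

lemma tvec_self [simp]: "c \<in> A \<Longrightarrow> x \<in> fst c \<Longrightarrow> tvec A c x b c = b"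
  using dtransition_self tvec_apply by metis

lemma tvec_mem: "c \<in> A \<Longrightarrow> x \<in> fst c \<Longrightarrow> tvec A c x b \<in> tangent_space A x"
  by (auto simp: tangent_space_def tvec_def dtransition_cocycle)

lemma tangent_change:
  assumes "v \<in> tangent_space A x" "c \<in> A" "c' \<in> A" "x \<in> fst c" "x \<in> fst c'"
  shows "v c' = dtransition c c' x (v c)"
  using assms unfolding tangent_space_def by blast

lemma tvec_tangent:
  assumes "v \<in> tangent_space A x" "c \<in> A" "x \<in> fst c"
  shows "tvec A c x (v c) = v"
proof
  fix c'
  have "v c' = 0" if "\<not> (c' \<in> A \<and> x \<in> fst c')"
    using assms(1) that unfolding tangent_space_def by blast
  then show "tvec A c x (v c) c' = v c'"
    using tangent_change[OF assms(1,2) _ assms(3), of c'] by (simp add: tvec_def)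
qed

lemma tangent_eqI:
  assumes "v \<in> tangent_space A x" "w \<in> tangent_space A x" "c \<in> A" "x \<in> fst c" "v c = w c"
  shows "v = w"
proof -
  have "v = tvec A c x (v c)" by (rule tvec_tangent[OF assms(1,3,4), symmetric])
  also have "\<dots> = tvec A c x (w c)" by (simp only: assms(5))
  also have "\<dots> = w" by (rule tvec_tangent[OF assms(2,3,4)])
  finally show ?thesis .
qed

text \<open>By the cocycle rule, comparison with one reference chart implies compatibility between
  all pairs of charts.\<close>

lemma tangent_spaceI:
  assumes "c \<in> A" "x \<in> fst c"
    "\<And>c'. c' \<in> A \<Longrightarrow> x \<in> fst c' \<Longrightarrow> v c' = dtransition c c' x (v c)"
    "\<And>c'. \<not> (c' \<in> A \<and> x \<in> fst c') \<Longrightarrow> v c' = 0"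
  shows "v \<in> tangent_space A x"
proof -
  have "v c' = tvec A c x (v c) c'" for c'
  proof (cases "c' \<in> A \<and> x \<in> fst c'")
    case True
    then show ?thesis using assms(3)[of c'] by (simp only: tvec_def if_True simp_thms)
  next
    case False
    then have "v c' = 0" by (rule assms(4))
    then show ?thesis using False by (simp only: tvec_def if_False)
  qed
  then have "v = tvec A c x (v c)" by blast
  then show ?thesis using tvec_mem[OF assms(1,2)] by metis
qed

lemma tvec_change:
  assumes "c \<in> A" "c' \<in> A" "x \<in> fst c" "x \<in> fst c'"
  shows "tvec A c x b = tvec A c' x (dtransition c c' x b)"
  using tvec_tangent[OF tvec_mem[OF assms(1,3)] assms(2,4)] tvec_apply[OF assms(2,4)] by metis

lemma subspace_tangent_space:
  assumes "x \<in> carrier_of A"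
  shows "subspace (tangent_space A x)"
proof -
  let ?c = "chart_at A x"
  have c: "?c \<in> A" "x \<in> fst ?c" using chart_at assms by auto
  have lin: "linear (dtransition ?c c' x)" if "c' \<in> A" "x \<in> fst c'" for c'
    using linear_dtransition c that by blast
  have out: "v c' = 0" if "v \<in> tangent_space A x" "\<not> (c' \<in> A \<and> x \<in> fst c')" for v c'
    using that unfolding tangent_space_def by blast
  show ?thesis
    unfolding subspace_def
  proof (intro conjI ballI allI)
    show "0 \<in> tangent_space A x"
      by (rule tangent_spaceI[OF c]) (simp_all add: linear_0[OF lin])
  next
    fix v w assume v: "v \<in> tangent_space A x" and w: "w \<in> tangent_space A x"
    show "v + w \<in> tangent_space A x"
    proof (rule tangent_spaceI[OF c])
      fix c' assume c': "c' \<in> A" "x \<in> fst c'"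
      show "(v + w) c' = dtransition ?c c' x ((v + w) ?c)"
        unfolding plus_fun_def linear_add[OF lin[OF c']]
        using tangent_change[OF v c(1) c'(1) c(2) c'(2)] tangent_change[OF w c(1) c'(1) c(2) c'(2)]
        by (simp only:)
    qed (simp add: plus_fun_def out[OF v] out[OF w])
  next
    fix r v assume v: "v \<in> tangent_space A x"
    show "r *\<^sub>R v \<in> tangent_space A x"
    proof (rule tangent_spaceI[OF c])
      fix c' assume c': "c' \<in> A" "x \<in> fst c'"
      show "(r *\<^sub>R v) c' = dtransition ?c c' x ((r *\<^sub>R v) ?c)"
        unfolding scaleR_fun_def linear_scale[OF lin[OF c']]
        using tangent_change[OF v c(1) c'(1) c(2) c'(2)] by (simp only:)
    qed (simp add: scaleR_fun_def out[OF v])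
  qed
qed

text \<open>\<open>differential\<close> is computed in the arbitrary chart \<open>chart_at\<close>;
  the chain rule cancels the change of coordinates of \<open>v\<close> against that of
  \<open>f\<close>, so any chart gives the same value.\<close>

lemma differential_eq:
  assumes "c \<in> A" "x \<in> fst c" "v \<in> tangent_space A x"
    and "((f \<circ> chart_inv c) has_derivative D) (at (snd c x))"
  shows "differential A f x v = D (v c)"
proof -
  let ?c = "chart_at A x"
  have c0: "?c \<in> A" "x \<in> fst ?c" using chart_at mem_carrier[OF assms(1,2)] by auto
  have "frechet_derivative (f \<circ> chart_inv ?c) (at (snd ?c x)) (v ?c) = D (dtransition ?c c x (v ?c))"
    by (rule frechet_derivative_eqI, rule has_derivative_chart_change[OF assms(1) c0(1) assms(2) c0(2) assms(4)])
  then show ?thesis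
    using tangent_change[OF assms(3) c0(1) assms(1) c0(2) assms(2)]
    by (simp add: differential_def Let_def)
qed

text \<open>A line in a torus fibre need not stay in one chart, so containment is asked only on a
  neighbourhood \<open>O'\<close> of \<open>t\<close>.\<close>

lemma velocity_eq:
  assumes c: "c \<in> A" and O: "open O'" "t \<in> O'" "\<And>s. s \<in> O' \<Longrightarrow> \<gamma> s \<in> fst c"
    and D: "((snd c \<circ> \<gamma>) has_vector_derivative d) (at t)"
  shows "velocity A \<gamma> t = tvec A c (\<gamma> t) d"
proof
  fix c'
  show "velocity A \<gamma> t c' = tvec A c (\<gamma> t) d c'"
  proof (cases "c' \<in> A \<and> \<gamma> t \<in> fst c'")
    case True
    have mem: "\<gamma> t \<in> fst c" using O by blast
    have 1: "((\<lambda>s. transition c c' ((snd c \<circ> \<gamma>) s)) has_derivative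
        (\<lambda>r. dtransition c c' (\<gamma> t) (r *\<^sub>R d))) (at t)"
    proof (rule has_derivative_compose[OF D[unfolded has_vector_derivative_def]])
      show "(transition c c' has_derivative dtransition c c' (\<gamma> t)) (at ((snd c \<circ> \<gamma>) t))"
        unfolding o_apply[of "snd c"] using transition_has_derivative[OF c _ mem] True by blast
    qed
    have 2: "((snd c' \<circ> \<gamma>) has_derivative (\<lambda>r. dtransition c c' (\<gamma> t) (r *\<^sub>R d))) (at t)"
      by (rule has_derivative_cong_open[OF O(1,2) _ 1]) (use O(3) c in auto)
    have "linear (dtransition c c' (\<gamma> t))" using linear_dtransition[OF c _ mem] True by blast
    with 2 have "((snd c' \<circ> \<gamma>) has_vector_derivative dtransition c c' (\<gamma> t) d) (at t)"
      by (simp add: has_vector_derivative_def linear_scale)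
    then show ?thesis using True by (simp add: velocity_def tvec_def vector_derivative_at)
  qed (auto simp: velocity_def tvec_def)
qed

end

lemma tangent_map_eq:
  assumes "atlas A" "atlas B" and c: "c \<in> A" "x \<in> fst c" and c': "c' \<in> B"
    and v: "v \<in> tangent_space A x"
    and O: "open O'" "snd c x \<in> O'" "\<And>p. p \<in> O' \<Longrightarrow> f (chart_inv c p) \<in> fst c'"
    and D: "((snd c' \<circ> f \<circ> chart_inv c) has_derivative D) (at (snd c x))"
  shows "tangent_map A B f x v = tvec B c' (f x) (D (v c))"
proof
  interpret A: atlas A by fact
  interpret B: atlas B by fact
  have mem: "f x \<in> fst c'" using O(3)[OF O(2)] c by simp
  fix c''
  show "tangent_map A B f x v c'' = tvec B c' (f x) (D (v c)) c''"
  proof (cases "c'' \<in> B \<and> f x \<in> fst c''")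
    case True
    have 1: "((\<lambda>p. transition c' c'' ((snd c' \<circ> f \<circ> chart_inv c) p)) has_derivative
        (\<lambda>w. dtransition c' c'' (f x) (D w))) (at (snd c x))"
    proof (rule has_derivative_compose[OF D])
      have "(snd c' \<circ> f \<circ> chart_inv c) (snd c x) = snd c' (f x)" using c by simp
      then show "(transition c' c'' has_derivative dtransition c' c'' (f x))
          (at ((snd c' \<circ> f \<circ> chart_inv c) (snd c x)))"
        using B.transition_has_derivative[OF c' _ mem] True by (simp only:)
    qed
    have "((snd c'' \<circ> f \<circ> chart_inv c) has_derivative
        (\<lambda>w. dtransition c' c'' (f x) (D w))) (at (snd c x))"
      by (rule has_derivative_cong_open[OF O(1,2) _ 1]) (use O(3) c' in auto)
    from A.differential_eq[OF c v this]
    show ?thesis using True by (simp add: tangent_map_def tvec_def)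
  qed (auto simp: tangent_map_def tvec_def)
qed

section \<open>Smooth vector bundles\<close>

text \<open>Fibre coordinates are functions on the whole ambient type and are linear on the fibre
  only, so linearity is stated relative to \<open>S\<close>.\<close>

definition linear_iso_on :: "'v::real_vector set \<Rightarrow> ('v \<Rightarrow> 'e::real_vector) \<Rightarrow> bool" where
  "linear_iso_on S f \<longleftrightarrow> subspace S \<and> (\<forall>v\<in>S. \<forall>w\<in>S. f (v + w) = f v + f w) \<and>
     (\<forall>r. \<forall>v\<in>S. f (r *\<^sub>R v) = r *\<^sub>R f v) \<and> bij_betw f S UNIV"

text \<open>Dual trivializations, total spaces and connections are defined through
  \<open>inv_into\<close>; exhibiting a two-sided inverse \<open>g\<close> yields the isomorphism
  and at the same time replaces \<open>inv_into\<close> by a formula.\<close>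

lemma linear_iso_onI:
  assumes "subspace S" "\<And>v w. v \<in> S \<Longrightarrow> w \<in> S \<Longrightarrow> f (v + w) = f v + f w"
    "\<And>r v. v \<in> S \<Longrightarrow> f (r *\<^sub>R v) = r *\<^sub>R f v"
    "\<And>e. g e \<in> S" "\<And>e. f (g e) = e" "\<And>v. v \<in> S \<Longrightarrow> g (f v) = v"
  shows "linear_iso_on S f" "inv_into S f = g"
proof -
  have bij: "bij_betw f S UNIV"
    by (rule bij_betw_byWitness[where f' = g]) (use assms in auto)
  then show "linear_iso_on S f" using assms by (simp add: linear_iso_on_def)
  show "inv_into S f = g"
  proof
    fix e show "inv_into S f e = g e"
      using inv_into_f_f[OF bij_betw_imp_inj_on[OF bij] assms(4)[of e]] assms(5) by simp
  qed
qed

context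
  fixes S :: "'v::real_vector set" and f :: "'v \<Rightarrow> 'e::real_vector"
  assumes iso: "linear_iso_on S f"
begin

lemma linear_iso_on_subspace: "subspace S"
  and linear_iso_on_add: "v \<in> S \<Longrightarrow> w \<in> S \<Longrightarrow> f (v + w) = f v + f w"
  and linear_iso_on_scale: "v \<in> S \<Longrightarrow> f (r *\<^sub>R v) = r *\<^sub>R f v"
  and linear_iso_on_bij: "bij_betw f S UNIV"
  using iso by (auto simp: linear_iso_on_def)

lemma linear_iso_on_inv_mem: "inv_into S f e \<in> S"
  using linear_iso_on_bij by (simp add: bij_betw_def inv_into_into)

lemma linear_iso_on_right: "f (inv_into S f e) = e"
  using linear_iso_on_bij by (simp add: bij_betw_def f_inv_into_f)

lemma linear_iso_on_left: "v \<in> S \<Longrightarrow> inv_into S f (f v) = v"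
  using linear_iso_on_bij by (simp add: bij_betw_def)

lemma linear_iso_on_eqI: "v \<in> S \<Longrightarrow> w \<in> S \<Longrightarrow> f v = f w \<Longrightarrow> v = w"
  using linear_iso_on_bij by (auto simp: bij_betw_def inj_on_def)

lemma linear_iso_on_inv_eqI: "v \<in> S \<Longrightarrow> f v = e \<Longrightarrow> inv_into S f e = v"
  using linear_iso_on_left by blast

lemma linear_iso_on_linear_inv: "linear (inv_into S f)"
proof (rule linearI)
  note S = linear_iso_on_subspace
  show "inv_into S f (b1 + b2) = inv_into S f b1 + inv_into S f b2" for b1 b2
    by (rule linear_iso_on_inv_eqI)
      (simp_all add: subspace_add[OF S] linear_iso_on_add linear_iso_on_right linear_iso_on_inv_mem)
  show "inv_into S f (r *\<^sub>R b) = r *\<^sub>R inv_into S f b" for r b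
    by (rule linear_iso_on_inv_eqI)
      (simp_all add: subspace_scale[OF S] linear_iso_on_scale linear_iso_on_right linear_iso_on_inv_mem)
qed

end

lemma dual_spaceD:
  assumes "h \<in> dual_space S"
  shows "v \<in> S \<Longrightarrow> w \<in> S \<Longrightarrow> h (v + w) = h v + h w" "v \<in> S \<Longrightarrow> h (r *\<^sub>R v) = r * h v"
    "v \<notin> S \<Longrightarrow> h v = 0"
  using assms by (auto simp: dual_space_def)

lemma dual_space_eqI:
  assumes "h \<in> dual_space S" "k \<in> dual_space S" "\<And>v. v \<in> S \<Longrightarrow> h v = k v"
  shows "h = k"
proof
  fix v show "h v = k v"
    using assms(3) dual_spaceD(3)[OF assms(1)] dual_spaceD(3)[OF assms(2)] by (cases "v \<in> S") auto
qed

lemma subspace_dual_space: "subspace S \<Longrightarrow> subspace (dual_space S)"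
  unfolding subspace_def dual_space_def
  by (auto simp: plus_fun_def scaleR_fun_def zero_fun_def algebra_simps)

text \<open>The contragredient coordinates of \<open>h\<close> are its values on the basis of
  \<open>S\<close> that corresponds to \<open>Basis\<close>. The inverse turns a coordinate vector
  into the inner product with \<open>f\<close>, cut off outside \<open>S\<close> to respect the
  convention of \<open>dual_space\<close>.\<close>

lemma linear_iso_on_dual:
  fixes f :: "'v::real_vector \<Rightarrow> 'e::euclidean_space"
  assumes iso: "linear_iso_on S f"
  shows "linear_iso_on (dual_space S) (\<lambda>h. \<Sum>b\<in>Basis. h (inv_into S f b) *\<^sub>R b)"
    and "inv_into (dual_space S) (\<lambda>h. \<Sum>b\<in>Basis. h (inv_into S f b) *\<^sub>R b)
       = (\<lambda>e v. if v \<in> S then e \<bullet> f v else 0)"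
proof -
  let ?g = "inv_into S f" and ?F = "\<lambda>h::'v \<Rightarrow> real. \<Sum>b\<in>Basis. h (inv_into S f b) *\<^sub>R b"
  let ?G = "\<lambda>e v. if v \<in> S then e \<bullet> f v else 0"
  note S = linear_iso_on_subspace[OF iso] and mem = linear_iso_on_inv_mem[OF iso]
  have 1: "?F (h + k) = ?F h + ?F k" for h k
    by (simp add: plus_fun_def scaleR_add_left sum.distrib)
  have 2: "?F (r *\<^sub>R h) = r *\<^sub>R ?F h" for r h
    by (simp add: scaleR_fun_def scaleR_sum_right)
  have 3: "?G e \<in> dual_space S" for e
    using S by (auto simp: dual_space_def subspace_add subspace_scale linear_iso_on_add[OF iso]
        linear_iso_on_scale[OF iso] inner_add_right)
  have 4: "?F (?G e) = e" for e
    by (simp add: mem linear_iso_on_right[OF iso] euclidean_representation)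
  have 5: "?G (?F h) = h" if h: "h \<in> dual_space S" for h
  proof (rule dual_space_eqI[OF 3 h])
    fix v assume v: "v \<in> S"
    have "linear (\<lambda>e. h (?g e))"
      using linear_iso_on_linear_inv[OF iso] dual_spaceD(1,2)[OF h] mem
      by (auto intro!: linearI simp: linear_add linear_scale)
    from linear_eq_sum_Basis[OF this, of "f v"] v
    have "h v = (\<Sum>b\<in>Basis. (f v \<bullet> b) * h (?g b))" by (simp add: linear_iso_on_left[OF iso])
    then show "?G (?F h) v = h v"
      using v by (simp add: inner_sum_right inner_commute[of _ "f v"] mult.commute)
  qed
  note lin = linear_iso_onI[where f = ?F and g = ?G, OF subspace_dual_space[OF S] 1 2 3 4 5]
  show "linear_iso_on (dual_space S) ?F" by (rule lin(1))
  show "inv_into (dual_space S) ?F = ?G" by (rule lin(2))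
qed

lemma linear_iso_on_Times:
  fixes f :: "'v::real_vector \<Rightarrow> 'e::real_vector" and f' :: "'w::real_vector \<Rightarrow> 'd::real_vector"
  assumes f: "linear_iso_on S f" and f': "linear_iso_on S' f'"
  shows "linear_iso_on (S \<times> S') (\<lambda>(v, w). (f v, f' w))"
    and "inv_into (S \<times> S') (\<lambda>(v, w). (f v, f' w)) = (\<lambda>(a, b). (inv_into S f a, inv_into S' f' b))"
proof -
  let ?F = "\<lambda>(v, w). (f v, f' w)" and ?G = "\<lambda>(a, b). (inv_into S f a, inv_into S' f' b)"
  have 0: "subspace (S \<times> S')"
    using linear_iso_on_subspace[OF f] linear_iso_on_subspace[OF f'] by (rule subspace_Times)
  have 1: "?F (v + w) = ?F v + ?F w" if "v \<in> S \<times> S'" "w \<in> S \<times> S'" for v w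
    using that linear_iso_on_add[OF f] linear_iso_on_add[OF f'] by auto
  have 2: "?F (r *\<^sub>R v) = r *\<^sub>R ?F v" if "v \<in> S \<times> S'" for r v
    using that linear_iso_on_scale[OF f] linear_iso_on_scale[OF f'] by auto
  have 3: "?G e \<in> S \<times> S'" for e
    using linear_iso_on_inv_mem[OF f] linear_iso_on_inv_mem[OF f'] by (auto split: prod.split)
  have 4: "?F (?G e) = e" for e
    by (simp add: linear_iso_on_right[OF f] linear_iso_on_right[OF f'] split: prod.split)
  have 5: "?G (?F v) = v" if "v \<in> S \<times> S'" for v
    using that linear_iso_on_left[OF f] linear_iso_on_left[OF f'] by auto
  note lin = linear_iso_onI[where f = ?F and g = ?G, OF 0 1 2 3 4 5]
  show "linear_iso_on (S \<times> S') ?F" by (rule lin(1))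
  show "inv_into (S \<times> S') ?F = ?G" by (rule lin(2))
qed

text \<open>Transition maps are fibrewise linear, so smoothness of their matrices can be tested on
  constant model vectors \<open>e\<close>.\<close>

definition smooth_bundle ::
  "('a, 'd::euclidean_space) chart set \<Rightarrow> ('a, 'v::real_vector, 'e::euclidean_space) vbundle \<Rightarrow> bool" where
  "smooth_bundle A W \<longleftrightarrow>
     (\<forall>(U, t)\<in>vtrivs W. openin (mtop A) U \<and> (\<forall>x\<in>U. linear_iso_on (fib W x) (t x))) \<and>
     (\<forall>(U, t)\<in>vtrivs W. \<forall>(U', t')\<in>vtrivs W. \<forall>c\<in>A. \<forall>e.
        smooth_on (snd c ` (U \<inter> U' \<inter> fst c))
          ((\<lambda>x. t' x (inv_into (fib W x) (t x) e)) \<circ> chart_inv c))"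

lemma smooth_bundleD:
  assumes "smooth_bundle A W" "(U, t) \<in> vtrivs W"
  shows "openin (mtop A) U" "x \<in> U \<Longrightarrow> linear_iso_on (fib W x) (t x)"
    "(U', t') \<in> vtrivs W \<Longrightarrow> c \<in> A \<Longrightarrow> smooth_on (snd c ` (U \<inter> U' \<inter> fst c))
       ((\<lambda>x. t' x (inv_into (fib W x) (t x) e)) \<circ> chart_inv c)"
  using assms unfolding smooth_bundle_def by fast+

lemma (in atlas) smooth_bundle_tangent: "smooth_bundle A (tangent_bundle A)"
  and linear_iso_on_tangent: "c \<in> A \<Longrightarrow> x \<in> fst c \<Longrightarrow> linear_iso_on (tangent_space A x) (\<lambda>v. v c)"
  and inv_into_tangent: "c \<in> A \<Longrightarrow> x \<in> fst c \<Longrightarrow> inv_into (tangent_space A x) (\<lambda>v. v c) = tvec A c x"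
proof -
  have *: "linear_iso_on (tangent_space A x) (\<lambda>v. v c)"
    "inv_into (tangent_space A x) (\<lambda>v. v c) = tvec A c x" if c: "c \<in> A" "x \<in> fst c" for c x
  proof -
    note lin = linear_iso_onI[where f = "\<lambda>v. v c" and g = "tvec A c x" and S = "tangent_space A x",
        OF subspace_tangent_space[OF mem_carrier[OF c]] _ _ tvec_mem[OF c] tvec_self[OF c]
          tvec_tangent[OF _ c]]
    show "linear_iso_on (tangent_space A x) (\<lambda>v. v c)"
      by (rule lin(1)) (simp_all add: plus_fun_def scaleR_fun_def)
    show "inv_into (tangent_space A x) (\<lambda>v. v c) = tvec A c x"
      by (rule lin(2)) (simp_all add: plus_fun_def scaleR_fun_def)
  qed
  show "c \<in> A \<Longrightarrow> x \<in> fst c \<Longrightarrow> linear_iso_on (tangent_space A x) (\<lambda>v. v c)"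
    "c \<in> A \<Longrightarrow> x \<in> fst c \<Longrightarrow> inv_into (tangent_space A x) (\<lambda>v. v c) = tvec A c x"
    using * by blast+
  have "smooth_on (snd c ` (fst c1 \<inter> fst c2 \<inter> fst c))
      ((\<lambda>x. inv_into (tangent_space A x) (\<lambda>v. v c1) e c2) \<circ> chart_inv c)"
    if c: "c1 \<in> A" "c2 \<in> A" "c \<in> A" for c1 c2 c e
  proof -
    let ?S = "fst c1 \<inter> fst c2 \<inter> fst c"
    have op: "open (snd c ` ?S)"
      by (intro open_image_chart openin_Int openin_chart c)
    \<comment> \<open>The transition matrix of the tangent bundle is the derivative of the
      coordinate change, here read in a third chart \<open>c\<close>.\<close>
    have "smooth_on (snd c ` ?S)
        (\<lambda>p. frechet_derivative (transition c1 c2) (at (transition c c1 p)) e)"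
    proof (rule smooth_on_compose[where f = "\<lambda>q. frechet_derivative (transition c1 c2) (at q) e"
          and g = "transition c c1" and T = "snd c1 ` (fst c1 \<inter> fst c2)", OF op])
      show "smooth_on (snd c1 ` (fst c1 \<inter> fst c2))
          (\<lambda>q. frechet_derivative (transition c1 c2) (at q) e)"
        by (intro smooth_on_derivative transition_smooth c)
      show "smooth_on (snd c ` ?S) (transition c c1)"
        by (rule smooth_on_subset[OF transition_smooth[OF c(3,1)]]) blast
      show "transition c c1 ` snd c ` ?S \<subseteq> snd c1 ` (fst c1 \<inter> fst c2)"
        using c by auto
    qed
    moreover have "((\<lambda>x. inv_into (tangent_space A x) (\<lambda>v. v c1) e c2) \<circ> chart_inv c) p =
        frechet_derivative (transition c1 c2) (at (transition c c1 p)) e"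
      if "p \<in> snd c ` ?S" for p
      using that c by (auto simp: *(2) tvec_apply)
    ultimately show ?thesis by (rule smooth_on_eq[OF op])
  qed
  with * openin_chart show "smooth_bundle A (tangent_bundle A)"
    unfolding smooth_bundle_def tangent_bundle_def by simp
qed


lemma (in atlas) smooth_bundle_dual:
  assumes W: "smooth_bundle A W"
  shows "smooth_bundle A (dual_bundle W)"
proof -
  have iso: "linear_iso_on (dual_space (fib W x)) (\<lambda>h. \<Sum>b\<in>Basis. h (inv_into (fib W x) (t x) b) *\<^sub>R b)"
    if "(U, t) \<in> vtrivs W" "x \<in> U" for U t x
    by (rule linear_iso_on_dual(1)[OF smooth_bundleD(2)[OF W that]])
  have smooth: "smooth_on (snd c ` (U \<inter> U' \<inter> fst c))
      ((\<lambda>x. \<Sum>b\<in>Basis. inv_into (dual_space (fib W x))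
        (\<lambda>h. \<Sum>b\<in>Basis. h (inv_into (fib W x) (t x) b) *\<^sub>R b) e
        (inv_into (fib W x) (t' x) b) *\<^sub>R b) \<circ> chart_inv c)" (is "smooth_on ?S ?F")
    if t: "(U, t) \<in> vtrivs W" "(U', t') \<in> vtrivs W" and c: "c \<in> A" for U t U' t' c e
  proof -
    have op: "open ?S"
      by (intro open_image_chart openin_Int smooth_bundleD(1)[OF W t(1)] smooth_bundleD(1)[OF W t(2)] c)
    \<comment> \<open>The dual transition matrix is the transpose of the transition in the opposite
      direction, hence the exchanged order of \<open>t\<close> and \<open>t'\<close>.\<close>
    have "smooth_on ?S (\<lambda>p. \<Sum>b\<in>Basis. (e \<bullet> ((\<lambda>x. t x (inv_into (fib W x) (t' x) b)) \<circ> chart_inv c) p) *\<^sub>R b)"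
      using smooth_bundleD(3)[OF W t(2,1) c]
      by (intro smooth_on_sum smooth_on_scaleR smooth_on_inner smooth_on_const op)
        (simp_all only: Int_commute[of U'])
    then show ?thesis
    proof (rule smooth_on_eq[OF op], goal_cases)
      case (1 p)
      then obtain x where x: "x \<in> U" "x \<in> U'" "x \<in> fst c" "p = snd c x" by blast
      show ?case
        using x c linear_iso_on_dual(2)[OF smooth_bundleD(2)[OF W t(1) x(1)]]
          linear_iso_on_inv_mem[OF smooth_bundleD(2)[OF W t(2) x(2)]] by simp
    qed
  qed
  show ?thesis
    unfolding smooth_bundle_def dual_bundle_def
    using iso smooth smooth_bundleD(1)[OF W] by (auto simp del: o_apply)
qed

lemma (in atlas) smooth_bundle_sum:
  assumes V: "smooth_bundle A V" and W: "smooth_bundle A W"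
  shows "smooth_bundle A (sum_bundle V W)"
proof -
  have iso: "linear_iso_on (fib V x \<times> fib W x) (\<lambda>(v, w). (t x v, s x w))"
    if "(U, t) \<in> vtrivs V" "x \<in> U" "(Q, s) \<in> vtrivs W" "x \<in> Q" for U t x Q s
    by (rule linear_iso_on_Times(1)[OF smooth_bundleD(2)[OF V that(1,2)] smooth_bundleD(2)[OF W that(3,4)]])
  have smooth: "smooth_on (snd c ` ((U \<inter> Q) \<inter> (U' \<inter> Q') \<inter> fst c))
      ((\<lambda>x. (\<lambda>(v, w). (t' x v, s' x w))
        (inv_into (fib V x \<times> fib W x) (\<lambda>(v, w). (t x v, s x w)) e)) \<circ> chart_inv c)" (is "smooth_on ?S ?F")
    if t: "(U, t) \<in> vtrivs V" "(U', t') \<in> vtrivs V" and s: "(Q, s) \<in> vtrivs W" "(Q', s') \<in> vtrivs W"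
      and c: "c \<in> A" for U t U' t' Q s Q' s' c e
  proof -
    have op: "open ?S"
      by (intro open_image_chart openin_Int smooth_bundleD(1)[OF W s(1)] smooth_bundleD(1)[OF W s(2)]
          smooth_bundleD(1)[OF V t(1)] smooth_bundleD(1)[OF V t(2)] c)
    have "smooth_on ?S (\<lambda>p. (((\<lambda>x. t' x (inv_into (fib V x) (t x) (fst e))) \<circ> chart_inv c) p,
        ((\<lambda>x. s' x (inv_into (fib W x) (s x) (snd e))) \<circ> chart_inv c) p))"
    proof (rule smooth_on_Pair[OF op])
      show "smooth_on ?S ((\<lambda>x. t' x (inv_into (fib V x) (t x) (fst e))) \<circ> chart_inv c)"
        by (rule smooth_on_subset[OF smooth_bundleD(3)[OF V t c]]) blast
      show "smooth_on ?S ((\<lambda>x. s' x (inv_into (fib W x) (s x) (snd e))) \<circ> chart_inv c)"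
        by (rule smooth_on_subset[OF smooth_bundleD(3)[OF W s c]]) blast
    qed
    then show ?thesis
    proof (rule smooth_on_eq[OF op], goal_cases)
      case (1 p)
      then obtain x where x: "x \<in> U" "x \<in> Q" "x \<in> fst c" "p = snd c x" by blast
      have "inv_into (fib V x \<times> fib W x) (\<lambda>(v, w). (t x v, s x w)) e
          = (inv_into (fib V x) (t x) (fst e), inv_into (fib W x) (s x) (snd e))"
        by (cases e) (simp only: linear_iso_on_Times(2)[OF smooth_bundleD(2)[OF V t(1) x(1)]
            smooth_bundleD(2)[OF W s(1) x(2)]] prod.case fst_conv snd_conv)
      then show ?case
        unfolding x(4) o_apply inv_left[OF c x(3)] by (simp only: prod.case)
    qed
  qed
  show ?thesis
    unfolding smooth_bundle_def sum_bundle_def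
  proof (intro conjI; clarsimp simp del: o_apply)
    fix U t Q s assume t: "(U, t) \<in> vtrivs V" and s: "(Q, s) \<in> vtrivs W"
    show "openin (mtop A) (U \<inter> Q) \<and>
      (\<forall>x\<in>U \<inter> Q. linear_iso_on (fib V x \<times> fib W x) (\<lambda>(v, w). (t x v, s x w)))"
      using iso[OF t _ s] smooth_bundleD(1)[OF V t] smooth_bundleD(1)[OF W s] by auto
  next
    fix U t Q s U' t' Q' s' c c' e f
    assume "(U, t) \<in> vtrivs V" "(Q, s) \<in> vtrivs W" "(U', t') \<in> vtrivs V" "(Q', s') \<in> vtrivs W" "(c, c') \<in> A"
    from smooth[OF this(1,3,2,4,5)]
    show "smooth_on (c' ` (U \<inter> Q \<inter> (U' \<inter> Q') \<inter> c))
      ((\<lambda>x. case inv_into (fib V x \<times> fib W x) (\<lambda>(v, w). (t x v, s x w)) (e, f) of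
        (v, w) \<Rightarrow> (t' x v, s' x w)) \<circ> chart_inv (c, c'))" by simp
  qed
qed

text \<open>\<open>smooth_section\<close> tests every chart and every trivialization. Near a given
  point one of each suffices, because the others differ from them by a coordinate change and a
  smooth matrix.\<close>

lemma (in atlas) smooth_sectionI:
  assumes W: "smooth_bundle A W" and fib: "\<And>x. x \<in> U \<Longrightarrow> \<sigma> x \<in> fib W x"
    and loc: "\<And>x. x \<in> U \<Longrightarrow> \<exists>c\<in>A. \<exists>(U1, t)\<in>vtrivs W. \<exists>N. openin (mtop A) N \<and> x \<in> N \<and>
      N \<subseteq> U \<inter> U1 \<inter> fst c \<and> smooth_on (snd c ` N) ((\<lambda>x. t x (\<sigma> x)) \<circ> chart_inv c)"
  shows "smooth_section A W U \<sigma>"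
  unfolding smooth_section_def
proof (intro conjI ballI, goal_cases)
  case (2 c' T)
  obtain U' t' where T: "T = (U', t')" by force
  have t': "(U', t') \<in> vtrivs W" and c': "c' \<in> A" using 2 T by auto
  have "smooth_on (snd c' ` (U \<inter> U' \<inter> fst c')) ((\<lambda>x. t' x (\<sigma> x)) \<circ> chart_inv c')"
  proof (rule smooth_on_local)
    fix p assume "p \<in> snd c' ` (U \<inter> U' \<inter> fst c')"
    then obtain x where x: "x \<in> U" "x \<in> U'" "x \<in> fst c'" "p = snd c' x" by blast
    from loc[OF x(1)] obtain c U1 t N where c: "c \<in> A" and t: "(U1, t) \<in> vtrivs W"
      and N: "openin (mtop A) N" "x \<in> N" "N \<subseteq> U \<inter> U1 \<inter> fst c"
        "smooth_on (snd c ` N) ((\<lambda>x. t x (\<sigma> x)) \<circ> chart_inv c)" by blast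
    let ?N = "N \<inter> U' \<inter> fst c'"
    have opN: "openin (mtop A) ?N"
      by (intro openin_Int N smooth_bundleD(1)[OF W t'] openin_chart c')
    have op: "open (snd c' ` ?N)"
      using open_image_chart[OF opN c'] by (simp add: Int_assoc)
    have "?N \<subseteq> fst c \<inter> fst c'" using N(3) by blast
    then have 1: "smooth_on (snd c' ` ?N) ((\<lambda>x. t x (\<sigma> x)) \<circ> chart_inv c')"
      by (rule smooth_on_chart_change[OF c c' _ op]) (rule smooth_on_subset[OF N(4)], blast)
    have 2: "smooth_on (snd c' ` ?N) ((\<lambda>x. t' x (inv_into (fib W x) (t x) b)) \<circ> chart_inv c')" for b
      by (rule smooth_on_subset[OF smooth_bundleD(3)[OF W t t' c']]) (use N(3) in blast)
    have "smooth_on (snd c' ` ?N) (\<lambda>p. \<Sum>b\<in>Basis. (((\<lambda>x. t x (\<sigma> x)) \<circ> chart_inv c') p \<bullet> b) *\<^sub>R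
        ((\<lambda>x. t' x (inv_into (fib W x) (t x) b)) \<circ> chart_inv c') p)"
      by (intro smooth_on_sum smooth_on_scaleR smooth_on_inner smooth_on_const op 1 2)
    then have "smooth_on (snd c' ` ?N) ((\<lambda>x. t' x (\<sigma> x)) \<circ> chart_inv c')"
    proof (rule smooth_on_eq[OF op], goal_cases)
      case (1 q)
      then obtain y where y: "y \<in> U" "y \<in> U1" "y \<in> U'" "y \<in> fst c'" "q = snd c' y" using N(3) by blast
      have iso: "linear_iso_on (fib W y) (t y)" "linear_iso_on (fib W y) (t' y)"
        using smooth_bundleD(2)[OF W] t t' y by auto
      have "linear (\<lambda>e. t' y (inv_into (fib W y) (t y) e))"
        using linear_iso_on_linear_inv[OF iso(1)]
        by (intro linearI) (simp_all add: linear_add linear_scale linear_iso_on_add[OF iso(2)]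
            linear_iso_on_scale[OF iso(2)] linear_iso_on_inv_mem[OF iso(1)])
      from linear_eq_sum_Basis[OF this, of "t y (\<sigma> y)"]
      show ?case
        using y c' fib[OF y(1)] by (simp add: linear_iso_on_left[OF iso(1)])
    qed
    moreover have "p \<in> snd c' ` ?N" using x N(2) by blast
    ultimately show "\<exists>T. open T \<and> p \<in> T \<and> smooth_on T ((\<lambda>x. t' x (\<sigma> x)) \<circ> chart_inv c')"
      using op by blast
  qed
  then show ?case unfolding T by simp
qed (use fib in blast)

section \<open>Chart coordinates on the double of the tangent bundle\<close>

definition double_coord ::
  "('a, 'e::euclidean_space) chart set \<Rightarrow> ('a, 'e) chart \<Rightarrow> 'a \<Rightarrow>
   ('a, 'e) tvector \<times> (('a, 'e) tvector \<Rightarrow> real) \<Rightarrow> 'e \<times> 'e" where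
  "double_coord A c x u = (fst u c, \<Sum>b\<in>Basis. snd u (tvec A c x b) *\<^sub>R b)"

definition double_vec ::
  "('a, 'e::euclidean_space) chart set \<Rightarrow> ('a, 'e) chart \<Rightarrow> 'a \<Rightarrow> 'e \<times> 'e \<Rightarrow>
   ('a, 'e) tvector \<times> (('a, 'e) tvector \<Rightarrow> real)" where
  "double_vec A c x a =
     (tvec A c x (fst a), \<lambda>v. if v \<in> tangent_space A x then snd a \<bullet> v c else 0)"

abbreviation double_tangent where "double_tangent A \<equiv> double_bundle (tangent_bundle A)"

lemma fib_double: "fib (double_bundle W) x = fib W x \<times> dual_space (fib W x)"
  by (simp add: double_bundle_def sum_bundle_def dual_bundle_def)

lemma fib_tangent: "fib (tangent_bundle A) = tangent_space A"
  by (simp add: tangent_bundle_def)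

context atlas
begin

lemma smooth_bundle_double: "smooth_bundle A W \<Longrightarrow> smooth_bundle A (double_bundle W)"
  unfolding double_bundle_def by (intro smooth_bundle_sum smooth_bundle_dual)

lemma
  assumes c: "c \<in> A" "x \<in> fst c"
  shows linear_iso_on_double: "linear_iso_on (fib (double_tangent A) x) (double_coord A c x)"
    and inv_into_double: "inv_into (fib (double_tangent A) x) (double_coord A c x) = double_vec A c x"
proof -
  note iso = linear_iso_on_tangent[OF c]
  have eq: "double_coord A c x = (\<lambda>(v, w). (v c, \<Sum>b\<in>Basis. w (inv_into (tangent_space A x) (\<lambda>v. v c) b) *\<^sub>R b))"
    by (auto simp: double_coord_def inv_into_tangent[OF c])
  show "linear_iso_on (fib (double_tangent A) x) (double_coord A c x)"
    unfolding fib_double fib_tangent eq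
    by (rule linear_iso_on_Times(1)[OF iso linear_iso_on_dual(1)[OF iso]])
  show "inv_into (fib (double_tangent A) x) (double_coord A c x) = double_vec A c x"
    unfolding fib_double fib_tangent eq
    unfolding linear_iso_on_Times(2)[OF iso linear_iso_on_dual(1)[OF iso]] linear_iso_on_dual(2)[OF iso]
    unfolding inv_into_tangent[OF c]
    by (rule ext) (simp add: double_vec_def split_beta)
qed

lemma
  assumes c: "c \<in> A" "x \<in> fst c"
  shows double_vec_mem: "double_vec A c x a \<in> fib (double_tangent A) x"
    and double_coord_vec: "double_coord A c x (double_vec A c x a) = a"
    and double_vec_coord: "u \<in> fib (double_tangent A) x \<Longrightarrow> double_vec A c x (double_coord A c x u) = u"
  using linear_iso_on_inv_mem[OF linear_iso_on_double[OF c]]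
    linear_iso_on_right[OF linear_iso_on_double[OF c]]
    linear_iso_on_left[OF linear_iso_on_double[OF c]] by (simp_all only: inv_into_double[OF c])

lemma smooth_section_coord:
  assumes \<sigma>: "smooth_section A (double_tangent A) U \<sigma>" and U: "openin (mtop A) U" and c: "c \<in> A"
  shows "smooth_on (snd c ` (U \<inter> fst c)) ((\<lambda>x. double_coord A c x (\<sigma> x)) \<circ> chart_inv c)"
proof -
  let ?t = "\<lambda>x (v, w). (v c, \<Sum>b\<in>Basis. w (inv_into (tangent_space A x) (\<lambda>v. v c) b) *\<^sub>R b)"
  \<comment> \<open>\<open>sum_bundle\<close> intersects the domains of its two summands, which here
    are both the domain of \<open>c\<close>.\<close>
  have "(fst c \<inter> fst c, ?t) \<in> vtrivs (double_tangent A)"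
    using c by (force simp: double_bundle_def sum_bundle_def dual_bundle_def tangent_bundle_def)
  with \<sigma> c have "smooth_on (snd c ` (U \<inter> fst c \<inter> fst c)) ((\<lambda>x. ?t x (\<sigma> x)) \<circ> chart_inv c)"
    unfolding smooth_section_def by fastforce
  then have "smooth_on (snd c ` (U \<inter> fst c)) ((\<lambda>x. ?t x (\<sigma> x)) \<circ> chart_inv c)"
    by (simp only: Int_assoc Int_absorb)
  then show ?thesis
    by (rule smooth_on_eq[OF open_image_chart[OF U c]])
      (use c in \<open>auto simp: double_coord_def inv_into_tangent split: prod.split\<close>)
qed

lemma smooth_section_doubleI:
  assumes fib: "\<And>x. x \<in> U \<Longrightarrow> \<sigma> x \<in> fib (double_tangent A) x" and U: "openin (mtop A) U"
    and loc: "\<And>x. x \<in> U \<Longrightarrow> \<exists>c\<in>A. x \<in> fst c \<and>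
      smooth_on (snd c ` (U \<inter> fst c)) ((\<lambda>x. double_coord A c x (\<sigma> x)) \<circ> chart_inv c)"
  shows "smooth_section A (double_tangent A) U \<sigma>"
proof (rule smooth_sectionI[OF smooth_bundle_double[OF smooth_bundle_tangent] fib])
  fix x assume x: "x \<in> U"
  from loc[OF x] obtain c where c: "c \<in> A" "x \<in> fst c"
    "smooth_on (snd c ` (U \<inter> fst c)) ((\<lambda>x. double_coord A c x (\<sigma> x)) \<circ> chart_inv c)" by blast
  let ?t = "\<lambda>x (v, w). (v c, \<Sum>b\<in>Basis. w (inv_into (tangent_space A x) (\<lambda>v. v c) b) *\<^sub>R b)"
  have t: "(fst c \<inter> fst c, ?t) \<in> vtrivs (double_tangent A)"
    using c by (force simp: double_bundle_def sum_bundle_def dual_bundle_def tangent_bundle_def)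
  have "smooth_on (snd c ` (U \<inter> fst c)) ((\<lambda>x. ?t x (\<sigma> x)) \<circ> chart_inv c)"
    by (rule smooth_on_eq[OF open_image_chart[OF U c(1)] c(3)])
      (use c in \<open>auto simp: double_coord_def inv_into_tangent split: prod.split\<close>)
  then show "\<exists>c\<in>A. \<exists>(U1, t)\<in>vtrivs (double_tangent A). \<exists>N. openin (mtop A) N \<and> x \<in> N \<and>
      N \<subseteq> U \<inter> U1 \<inter> fst c \<and> smooth_on (snd c ` N) ((\<lambda>x. t x (\<sigma> x)) \<circ> chart_inv c)"
    using openin_Int[OF U openin_chart[OF c(1)]] x c(1,2)
    by (intro bexI[OF _ c(1)] bexI[OF _ t]) (auto intro!: exI[of _ "U \<inter> fst c"])
qed

end

section \<open>The Courant bracket in coordinates\<close>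

lemma frechet_derivative_sum_Basis:
  fixes \<phi> :: "'a::euclidean_space \<Rightarrow> 'b::real_normed_vector"
  assumes S: "open S" "p \<in> S" and \<phi>: "smooth_on S \<phi>"
  shows "frechet_derivative (\<lambda>z. frechet_derivative \<phi> (at z) a) (at p) w
    = (\<Sum>b\<in>Basis. (a \<bullet> b) *\<^sub>R frechet_derivative (\<lambda>z. frechet_derivative \<phi> (at z) b) (at p) w)"
proof (rule frechet_derivative_eqI)
  have D: "((\<lambda>z. frechet_derivative \<phi> (at z) b) has_derivative
      frechet_derivative (\<lambda>z. frechet_derivative \<phi> (at z) b) (at p)) (at p)" for b
    by (rule smooth_on_has_derivative[OF smooth_on_derivative[OF \<phi>] S(2)])
  show "((\<lambda>z. frechet_derivative \<phi> (at z) a) has_derivative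
    (\<lambda>w. \<Sum>b\<in>Basis. (a \<bullet> b) *\<^sub>R frechet_derivative (\<lambda>z. frechet_derivative \<phi> (at z) b) (at p) w)) (at p)"
    by (rule has_derivative_cong_open[OF S linear_eq_sum_Basis[OF smooth_on_linear_derivative[OF \<phi>]]])
      (auto intro!: has_derivative_sum has_derivative_scaleR_right D)
qed

text \<open>A product rule: the first term differentiates the derivative of \<open>\<phi>\<close>
  with the vector frozen at \<open>X p\<close>, the second differentiates \<open>X\<close>.
  Expansion in \<open>Basis\<close> reduces it to derivatives in fixed directions.\<close>

lemma frechet_derivative_along:
  fixes \<phi> :: "'a::euclidean_space \<Rightarrow> 'b::real_normed_vector"
  assumes S: "open S" "p \<in> S" and \<phi>: "smooth_on S \<phi>" and X: "smooth_on S X"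
  shows "frechet_derivative (\<lambda>z. frechet_derivative \<phi> (at z) (X z)) (at p) w
    = frechet_derivative (\<lambda>z. frechet_derivative \<phi> (at z) (X p)) (at p) w
      + frechet_derivative \<phi> (at p) (frechet_derivative X (at p) w)"
proof -
  let ?D = "\<lambda>b. frechet_derivative (\<lambda>z. frechet_derivative \<phi> (at z) b) (at p)"
  let ?X = "frechet_derivative X (at p)"
  have D: "((\<lambda>z. frechet_derivative \<phi> (at z) b) has_derivative ?D b) (at p)" for b
    by (rule smooth_on_has_derivative[OF smooth_on_derivative[OF \<phi>] S(2)])
  have "((\<lambda>z. X z \<bullet> b) has_derivative (\<lambda>w. ?X w \<bullet> b)) (at p)" for b
    by (intro has_derivative_inner_left smooth_on_has_derivative[OF X S(2)])
  then have d: "((\<lambda>z. \<Sum>b\<in>Basis. (X z \<bullet> b) *\<^sub>R frechet_derivative \<phi> (at z) b) has_derivative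
      (\<lambda>w. \<Sum>b\<in>Basis. (X p \<bullet> b) *\<^sub>R ?D b w + (?X w \<bullet> b) *\<^sub>R frechet_derivative \<phi> (at p) b)) (at p)"
    by (intro has_derivative_sum has_derivative_scaleR D)
  have "((\<lambda>z. frechet_derivative \<phi> (at z) (X z)) has_derivative
      (\<lambda>w. \<Sum>b\<in>Basis. (X p \<bullet> b) *\<^sub>R ?D b w + (?X w \<bullet> b) *\<^sub>R frechet_derivative \<phi> (at p) b)) (at p)"
    by (rule has_derivative_cong_open[OF S _ d])
      (rule linear_eq_sum_Basis[OF smooth_on_linear_derivative[OF \<phi>]])
  from frechet_derivative_eqI[OF this] show ?thesis
    unfolding frechet_derivative_sum_Basis[OF S \<phi>, of "X p"]
      linear_eq_sum_Basis[OF smooth_on_linear_derivative[OF \<phi> S(2)], of "?X w"]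
    by (simp add: sum.distrib)
qed

lemma frechet_derivative_chain:
  assumes "smooth_on T f" "smooth_on S g" "x \<in> S" "g x \<in> T"
  shows "frechet_derivative (\<lambda>z. f (g z)) (at x) v
    = frechet_derivative f (at (g x)) (frechet_derivative g (at x) v)"
  by (rule frechet_derivative_eqI,
      rule has_derivative_compose[OF smooth_on_has_derivative smooth_on_has_derivative]) (rule assms)+

text \<open>The second derivatives of the coordinate change \<open>\<phi>\<close> cancel by symmetry.\<close>

context
  fixes S T :: "'e::euclidean_space set" and \<phi> X X' :: "'e \<Rightarrow> 'e" and p :: 'e
  assumes S: "open S" and p: "p \<in> S" and \<phi>: "smooth_on S \<phi>" "\<phi> ` S \<subseteq> T"
    and X: "smooth_on S X" "smooth_on T X'"
    and X': "\<And>q. q \<in> S \<Longrightarrow> X' (\<phi> q) = frechet_derivative \<phi> (at q) (X q)"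
begin

text \<open>The transformation rule of \<open>X\<close> is differentiated along \<open>v\<close>, by
  the chain rule on one side and the product rule on the other. The Hessian of \<open>\<phi>\<close>
  obstructs tensoriality; in the Lie bracket and the Lie derivative it occurs twice, with opposite
  signs.\<close>

lemma vector_field_change:
  "frechet_derivative X' (at (\<phi> p)) (frechet_derivative \<phi> (at p) v)
    = frechet_derivative (\<lambda>z. frechet_derivative \<phi> (at z) (X p)) (at p) v
      + frechet_derivative \<phi> (at p) (frechet_derivative X (at p) v)"
proof -
  have "frechet_derivative X' (at (\<phi> p)) (frechet_derivative \<phi> (at p) v)
      = frechet_derivative (\<lambda>z. X' (\<phi> z)) (at p) v"
    using frechet_derivative_chain[OF X(2) \<phi>(1) p] \<phi>(2) p by auto
  also have "\<dots> = frechet_derivative (\<lambda>z. frechet_derivative \<phi> (at z) (X z)) (at p) v"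
    using frechet_derivative_cong_open[OF S p, of "\<lambda>z. X' (\<phi> z)"] X' by simp
  finally show ?thesis unfolding frechet_derivative_along[OF S p \<phi>(1) X(1)] .
qed

lemma lie_derivative_change:
  assumes \<eta>: "smooth_on S \<eta>" "smooth_on T \<eta>'"
    and \<eta>': "\<And>q w. q \<in> S \<Longrightarrow> \<eta> q \<bullet> w = \<eta>' (\<phi> q) \<bullet> frechet_derivative \<phi> (at q) w"
  shows "frechet_derivative \<eta>' (at (\<phi> p)) (X' (\<phi> p)) \<bullet> frechet_derivative \<phi> (at p) w
        + \<eta>' (\<phi> p) \<bullet> frechet_derivative X' (at (\<phi> p)) (frechet_derivative \<phi> (at p) w)
      = frechet_derivative \<eta> (at p) (X p) \<bullet> w + \<eta> p \<bullet> frechet_derivative X (at p) w"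
proof -
  let ?v = "X p" and ?D = "\<lambda>a. frechet_derivative (\<lambda>z. frechet_derivative \<phi> (at z) a) (at p)"
  have \<phi>p: "\<phi> p \<in> T" using \<phi>(2) p by auto
  have "((\<lambda>q. \<eta> q \<bullet> w) has_derivative (\<lambda>v. frechet_derivative \<eta> (at p) v \<bullet> w)) (at p)"
    by (intro has_derivative_inner_left smooth_on_has_derivative[OF \<eta>(1) p])
  then have "frechet_derivative \<eta> (at p) ?v \<bullet> w = frechet_derivative (\<lambda>q. \<eta> q \<bullet> w) (at p) ?v"
    by (rule frechet_derivative_eqI[symmetric])
  also have "\<dots> = frechet_derivative (\<lambda>q. \<eta>' (\<phi> q) \<bullet> frechet_derivative \<phi> (at q) w) (at p) ?v"
    using frechet_derivative_cong_open[OF S p, of "\<lambda>q. \<eta> q \<bullet> w"] \<eta>' by simp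
  also have "\<dots> = \<eta>' (\<phi> p) \<bullet> ?D w ?v
      + frechet_derivative \<eta>' (at (\<phi> p)) (frechet_derivative \<phi> (at p) ?v) \<bullet> frechet_derivative \<phi> (at p) w"
    by (rule frechet_derivative_eqI, rule has_derivative_inner)
      (rule has_derivative_compose[OF smooth_on_has_derivative[OF \<phi>(1) p] smooth_on_has_derivative[OF \<eta>(2) \<phi>p]],
       rule smooth_on_has_derivative[OF smooth_on_derivative[OF \<phi>(1)] p])
  finally have 1: "frechet_derivative \<eta> (at p) ?v \<bullet> w = \<eta>' (\<phi> p) \<bullet> ?D w ?v
      + frechet_derivative \<eta>' (at (\<phi> p)) (X' (\<phi> p)) \<bullet> frechet_derivative \<phi> (at p) w"
    by (simp only: X'[OF p])
  have 2: "\<eta>' (\<phi> p) \<bullet> frechet_derivative X' (at (\<phi> p)) (frechet_derivative \<phi> (at p) w)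
      = \<eta>' (\<phi> p) \<bullet> ?D ?v w + \<eta> p \<bullet> frechet_derivative X (at p) w"
    by (simp add: vector_field_change inner_add_right \<eta>'[OF p])
  show ?thesis
    unfolding 1 2 frechet_derivative_commute[OF S \<phi>(1) p, of w] by simp
qed

end

lemma lie_bracket_change:
  fixes S T :: "'e::euclidean_space set" and \<phi> :: "'e \<Rightarrow> 'e"
  assumes S: "open S" and p: "p \<in> S" and \<phi>: "smooth_on S \<phi>" "\<phi> ` S \<subseteq> T"
    and X: "smooth_on S X" "smooth_on T X'"
    and X': "\<And>q. q \<in> S \<Longrightarrow> X' (\<phi> q) = frechet_derivative \<phi> (at q) (X q)"
    and Y: "smooth_on S Y" "smooth_on T Y'"
    and Y': "\<And>q. q \<in> S \<Longrightarrow> Y' (\<phi> q) = frechet_derivative \<phi> (at q) (Y q)"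
  shows "frechet_derivative Y' (at (\<phi> p)) (X' (\<phi> p)) - frechet_derivative X' (at (\<phi> p)) (Y' (\<phi> p))
      = frechet_derivative \<phi> (at p)
          (frechet_derivative Y (at p) (X p) - frechet_derivative X (at p) (Y p))"
  using vector_field_change[OF S p \<phi> X X', of "Y p"] vector_field_change[OF S p \<phi> Y Y', of "X p"]
    frechet_derivative_commute[OF S \<phi>(1) p, of "X p" "Y p"]
    linear_diff[OF smooth_on_linear_derivative[OF \<phi>(1) p]] X'[OF p] Y'[OF p]
  by simp

text \<open>The coordinate form of \<open>dual_pairing\<close> without its factor
  \<open>- 1/2\<close>; orthogonality for the two is the same condition.\<close>

definition pairing :: "'e::euclidean_space \<times> 'e \<Rightarrow> 'e \<times> 'e \<Rightarrow> real" where
  "pairing a b = snd a \<bullet> fst b + snd b \<bullet> fst a"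

text \<open>Here \<open>v'\<close> stands for the derivative of a section. In the covector
  \<open>w \<mapsto> pairing u (v' w)\<close>, the part that pairs the covector of \<open>u\<close>
  with the derivative of a vector field gets \<open>- 1\<close> from the Lie derivative and
  \<open>+ 1/2\<close> from the exterior derivative; the other part gets \<open>- 1/2\<close> from
  the exterior derivative alone.\<close>

definition half_bracket :: "'e::euclidean_space \<times> 'e \<Rightarrow> ('e \<Rightarrow> 'e \<times> 'e) \<Rightarrow> 'e \<times> 'e" where
  "half_bracket u v' = v' (fst u) - (1/2) *\<^sub>R (0, \<Sum>b\<in>Basis. pairing u (v' b) *\<^sub>R b)"

text \<open>The Courant bracket in coordinates is the antisymmetrization of a pairing between the values of
  one section and the first derivatives of the other.\<close>

definition coord_bracket ::
  "('e::euclidean_space \<Rightarrow> 'e \<times> 'e) \<Rightarrow> ('e \<Rightarrow> 'e \<times> 'e) \<Rightarrow> 'e \<Rightarrow> 'e \<times> 'e" where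
  "coord_bracket f g p =
     half_bracket (f p) (frechet_derivative g (at p)) - half_bracket (g p) (frechet_derivative f (at p))"

lemma smooth_on_coord_bracket:
  assumes S: "open S" and f: "smooth_on S f" and g: "smooth_on S g"
  shows "smooth_on S (coord_bracket f g)"
proof -
  have "smooth_on S (\<lambda>p. half_bracket (f p) (frechet_derivative g (at p)))"
    if f: "smooth_on S f" and g: "smooth_on S g" for f g :: "'a \<Rightarrow> 'a \<times> 'a"
    unfolding half_bracket_def pairing_def
    by (intro smooth_on_diff smooth_on_scaleR smooth_on_Pair smooth_on_const smooth_on_sum
        smooth_on_add smooth_on_inner smooth_on_fst smooth_on_snd smooth_on_derivative
        smooth_on_derivative_along f g S)
  from smooth_on_diff[OF S this[OF f g] this[OF g f]] show ?thesis
    unfolding coord_bracket_def[abs_def] .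
qed

lemma frechet_derivative_fst_snd:
  fixes f :: "'a::real_normed_vector \<Rightarrow> 'b::euclidean_space \<times> 'c::euclidean_space"
  assumes "smooth_on S f" "x \<in> S"
  shows "frechet_derivative (\<lambda>z. fst (f z)) (at x) v = fst (frechet_derivative f (at x) v)"
    "frechet_derivative (\<lambda>z. snd (f z)) (at x) v = snd (frechet_derivative f (at x) v)"
  using frechet_derivative_linear_comp[OF bounded_linear_fst smooth_on_differentiable[OF assms]]
    frechet_derivative_linear_comp[OF bounded_linear_snd smooth_on_differentiable[OF assms]] by auto


section \<open>The Courant bracket of sections in a chart\<close>

definition coord_rep ::
  "('a, 'e::euclidean_space) chart set \<Rightarrow> ('a, 'e) chart \<Rightarrow> ('a, 'e) gfield \<Rightarrow> 'e \<Rightarrow> 'e \<times> 'e" where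
  "coord_rep A c \<sigma> = (\<lambda>x. double_coord A c x (\<sigma> x)) \<circ> chart_inv c"

context atlas
begin

lemma coord_rep_apply: "c \<in> A \<Longrightarrow> x \<in> fst c \<Longrightarrow> coord_rep A c \<sigma> (snd c x) = double_coord A c x (\<sigma> x)"
  by (simp add: coord_rep_def)

lemma one_form_coord:
  assumes c: "c \<in> A" "x \<in> fst c" and u: "u \<in> fib (double_tangent A) x" and v: "v \<in> tangent_space A x"
  shows "snd u v = snd (double_coord A c x u) \<bullet> v c"
  using arg_cong[OF double_vec_coord[OF c u], of "\<lambda>u. snd u v"] v by (simp add: double_vec_def)

lemma double_coord_change:
  assumes c: "c \<in> A" "x \<in> fst c" and c': "c' \<in> A" "x \<in> fst c'" and u: "u \<in> fib (double_tangent A) x"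
  shows "fst (double_coord A c' x u) = dtransition c c' x (fst (double_coord A c x u))"
    and "snd (double_coord A c x u) \<bullet> w = snd (double_coord A c' x u) \<bullet> dtransition c c' x w"
proof -
  have "fst u \<in> tangent_space A x" using u by (auto simp: fib_double fib_tangent)
  from tangent_change[OF this c(1) c'(1) c(2) c'(2)]
  show "fst (double_coord A c' x u) = dtransition c c' x (fst (double_coord A c x u))"
    by (simp add: double_coord_def)
  show "snd (double_coord A c x u) \<bullet> w = snd (double_coord A c' x u) \<bullet> dtransition c c' x w"
    using one_form_coord[OF c u tvec_mem[OF c]] one_form_coord[OF c' u tvec_mem[OF c]] c c'
    by (simp add: tvec_apply)
qed

context
  fixes U :: "'a set"
  assumes U: "openin (mtop A) U"
begin

lemma smooth_on_coord_rep:
  "smooth_section A (double_tangent A) U \<sigma> \<Longrightarrow> c \<in> A \<Longrightarrow> smooth_on (snd c ` (U \<inter> fst c)) (coord_rep A c \<sigma>)"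
  unfolding coord_rep_def by (rule smooth_section_coord[OF _ U])

lemma section_mem: "smooth_section A (double_tangent A) U \<sigma> \<Longrightarrow> x \<in> U \<Longrightarrow> \<sigma> x \<in> fib (double_tangent A) x"
  by (simp add: smooth_section_def)

text \<open>\<open>lie_derivative\<close> is evaluated in the chart picked by
  \<open>chart_at\<close>. The formula is first read off there and then carried over to
  \<open>c\<close> by \<open>lie_derivative_change\<close>.\<close>

lemma lie_derivative_coord:
  assumes \<sigma>: "smooth_section A (double_tangent A) U \<sigma>" and \<tau>: "smooth_section A (double_tangent A) U \<tau>"
    and c: "c \<in> A" and x: "x \<in> U" "x \<in> fst c" and v: "v \<in> tangent_space A x"
  shows "lie_derivative A (fst \<circ> \<sigma>) (snd \<circ> \<tau>) x v
    = snd (frechet_derivative (coord_rep A c \<tau>) (at (snd c x)) (fst (coord_rep A c \<sigma> (snd c x)))) \<bullet> v c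
      + snd (coord_rep A c \<tau> (snd c x)) \<bullet> fst (frechet_derivative (coord_rep A c \<sigma>) (at (snd c x)) (v c))"
    (is "_ = ?L c")
proof -
  let ?c = "chart_at A x"
  have c0: "?c \<in> A" "x \<in> fst ?c" using chart_at[OF mem_carrier[OF c x(2)]] by auto
  let ?w = "v ?c"
  define S where "S = snd ?c ` (U \<inter> fst ?c)"
  have S: "open S" "snd ?c x \<in> S" using open_image_chart[OF U c0(1)] x c0 by (auto simp: S_def)
  have sm: "smooth_on S (coord_rep A ?c \<sigma>)" "smooth_on S (coord_rep A ?c \<tau>)"
    unfolding S_def using smooth_on_coord_rep \<sigma> \<tau> c0 by auto
  have X: "(\<lambda>z. (fst \<circ> \<sigma>) z ?c) \<circ> chart_inv ?c = (\<lambda>q. fst (coord_rep A ?c \<sigma> q))"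
    by (auto simp: coord_rep_def double_coord_def)
  have "((\<lambda>q. snd (coord_rep A ?c \<tau> q) \<bullet> ?w) has_derivative
      (\<lambda>d. snd (frechet_derivative (coord_rep A ?c \<tau>) (at (snd ?c x)) d) \<bullet> ?w)) (at (snd ?c x))"
    by (intro has_derivative_inner_left has_derivative_snd smooth_on_has_derivative[OF sm(2) S(2)])
  then have \<eta>: "((\<lambda>z. (snd \<circ> \<tau>) z (tvec A ?c z ?w)) \<circ> chart_inv ?c has_derivative
      (\<lambda>d. snd (frechet_derivative (coord_rep A ?c \<tau>) (at (snd ?c x)) d) \<bullet> ?w)) (at (snd ?c x))"
  proof (rule has_derivative_cong_open[OF S, rotated])
    fix q assume "q \<in> S"
    then obtain y where y: "y \<in> U" "y \<in> fst ?c" "q = snd ?c y" by (auto simp: S_def)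
    show "((\<lambda>z. (snd \<circ> \<tau>) z (tvec A ?c z ?w)) \<circ> chart_inv ?c) q = snd (coord_rep A ?c \<tau> q) \<bullet> ?w"
      using y c0 one_form_coord[OF c0(1) y(2) section_mem[OF \<tau> y(1)] tvec_mem[OF c0(1) y(2)]]
      by (simp add: coord_rep_def)
  qed
  have e: "(snd \<circ> \<tau>) x (tvec A ?c x b) = snd (coord_rep A ?c \<tau> (snd ?c x)) \<bullet> b" for b
    using one_form_coord[OF c0 section_mem[OF \<tau> x(1)] tvec_mem[OF c0]] c0 by (simp add: coord_rep_def)
  have Xc: "(fst \<circ> \<sigma>) x ?c = fst (coord_rep A ?c \<sigma> (snd ?c x))"
    using coord_rep_apply[OF c0, of \<sigma>] by (simp only: double_coord_def o_apply fst_conv)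
  have 1: "lie_derivative A (fst \<circ> \<sigma>) (snd \<circ> \<tau>) x v = ?L ?c"
    unfolding lie_derivative_def Let_def frechet_derivative_eqI[OF \<eta>] X
      frechet_derivative_fst_snd[OF sm(1) S(2)]
    by (simp only: if_P[OF v] e Xc)
  define R where "R = snd ?c ` (U \<inter> (fst ?c \<inter> fst c))"
  have R: "open R" "snd ?c x \<in> R" "R \<subseteq> S" "transition ?c c ` R \<subseteq> snd c ` (U \<inter> fst c)"
    using open_image_chart[OF openin_Int[OF U openin_chart[OF c]] c0(1)] x c0
    by (auto simp: R_def S_def Int_ac)
  have \<phi>: "smooth_on R (transition ?c c)"
    by (rule smooth_on_subset[OF transition_smooth[OF c0(1) c]]) (auto simp: R_def)
  note sub = smooth_on_subset[OF _ R(3)]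
  have change: "fst (coord_rep A c \<sigma>' (transition ?c c q))
        = frechet_derivative (transition ?c c) (at q) (fst (coord_rep A ?c \<sigma>' q))"
      "snd (coord_rep A ?c \<sigma>' q) \<bullet> w
        = snd (coord_rep A c \<sigma>' (transition ?c c q)) \<bullet> frechet_derivative (transition ?c c) (at q) w"
    if "q \<in> R" and \<sigma>': "smooth_section A (double_tangent A) U \<sigma>'" for q \<sigma>' w
  proof -
    from that obtain y where y: "y \<in> U" "y \<in> fst ?c" "y \<in> fst c" "q = snd ?c y" by (auto simp: R_def)
    note ch = double_coord_change[OF c0(1) y(2) c y(3) section_mem[OF \<sigma>' y(1)]]
    show "fst (coord_rep A c \<sigma>' (transition ?c c q))
        = frechet_derivative (transition ?c c) (at q) (fst (coord_rep A ?c \<sigma>' q))"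
      using ch(1) y c c0 by (simp add: coord_rep_def)
    show "snd (coord_rep A ?c \<sigma>' q) \<bullet> w
        = snd (coord_rep A c \<sigma>' (transition ?c c q)) \<bullet> frechet_derivative (transition ?c c) (at q) w"
      using ch(2)[of w] y c c0 by (simp add: coord_rep_def)
  qed
  define T where "T = snd c ` (U \<inter> fst c)"
  have T: "open T" "snd c x \<in> T" using open_image_chart[OF U c] x by (auto simp: T_def)
  have smc: "smooth_on T (coord_rep A c \<sigma>)" "smooth_on T (coord_rep A c \<tau>)"
    unfolding T_def using smooth_on_coord_rep \<sigma> \<tau> c by auto
  have tr: "transition ?c c (snd ?c x) = snd c x" using c0 by simp
  have "?L c = ?L ?c"
    using lie_derivative_change[OF R(1,2) \<phi> R(4)[folded T_def]
        smooth_on_fst[OF R(1) sub[OF sm(1)]] smooth_on_fst[OF T(1) smc(1)] change(1)[OF _ \<sigma>]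
        smooth_on_snd[OF R(1) sub[OF sm(2)]] smooth_on_snd[OF T(1) smc(2)] change(2)[OF _ \<tau>], of ?w]
    unfolding tr frechet_derivative_fst_snd[OF sm(1) S(2)] frechet_derivative_fst_snd[OF sm(2) S(2)]
      frechet_derivative_fst_snd[OF smc(1) T(2)] frechet_derivative_fst_snd[OF smc(2) T(2)]
    unfolding tangent_change[OF v c0(1) c c0(2) x(2)] .
  then show ?thesis using 1 by simp
qed

lemma exterior_derivative_coord:
  assumes a: "smooth_section A (double_tangent A) U a" and b: "smooth_section A (double_tangent A) U b"
    and c: "c \<in> A" and x: "x \<in> U" "x \<in> fst c" and v: "v \<in> tangent_space A x"
  shows "exterior_derivative A (\<lambda>z. (snd \<circ> a) z ((fst \<circ> b) z) - (snd \<circ> b) z ((fst \<circ> a) z)) x v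
    = (let f = coord_rep A c a; g = coord_rep A c b; p = snd c x;
           f' = frechet_derivative f (at p) (v c); g' = frechet_derivative g (at p) (v c)
       in (snd (f p) \<bullet> fst g' + snd f' \<bullet> fst (g p)) - (snd (g p) \<bullet> fst f' + snd g' \<bullet> fst (f p)))"
proof -
  let ?f = "coord_rep A c a" and ?g = "coord_rep A c b" and ?p = "snd c x"
  define S where "S = snd c ` (U \<inter> fst c)"
  have S: "open S" "?p \<in> S" using open_image_chart[OF U c] x by (auto simp: S_def)
  have sm: "smooth_on S ?f" "smooth_on S ?g"
    unfolding S_def using smooth_on_coord_rep a b c by auto
  have "((\<lambda>q. snd (?f q) \<bullet> fst (?g q) - snd (?g q) \<bullet> fst (?f q)) has_derivative
     (\<lambda>w. (snd (?f ?p) \<bullet> fst (frechet_derivative ?g (at ?p) w) + snd (frechet_derivative ?f (at ?p) w) \<bullet> fst (?g ?p))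
       - (snd (?g ?p) \<bullet> fst (frechet_derivative ?f (at ?p) w) + snd (frechet_derivative ?g (at ?p) w) \<bullet> fst (?f ?p))))
     (at ?p)"
    by (intro has_derivative_diff has_derivative_inner has_derivative_fst has_derivative_snd
        smooth_on_has_derivative[OF sm(1) S(2)] smooth_on_has_derivative[OF sm(2) S(2)])
  then have "((\<lambda>z. (snd \<circ> a) z ((fst \<circ> b) z) - (snd \<circ> b) z ((fst \<circ> a) z)) \<circ> chart_inv c has_derivative
     (\<lambda>w. (snd (?f ?p) \<bullet> fst (frechet_derivative ?g (at ?p) w) + snd (frechet_derivative ?f (at ?p) w) \<bullet> fst (?g ?p))
       - (snd (?g ?p) \<bullet> fst (frechet_derivative ?f (at ?p) w) + snd (frechet_derivative ?g (at ?p) w) \<bullet> fst (?f ?p))))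
     (at ?p)"
  proof (rule has_derivative_cong_open[OF S, rotated])
    fix q assume "q \<in> S"
    then obtain y where y: "y \<in> U" "y \<in> fst c" "q = snd c y" by (auto simp: S_def)
    have mem: "a y \<in> fib (double_tangent A) y" "b y \<in> fib (double_tangent A) y"
      using section_mem a b y(1) by auto
    then have "fst (a y) \<in> tangent_space A y" "fst (b y) \<in> tangent_space A y"
      by (auto simp: fib_double fib_tangent)
    then show "((\<lambda>z. (snd \<circ> a) z ((fst \<circ> b) z) - (snd \<circ> b) z ((fst \<circ> a) z)) \<circ> chart_inv c) q
        = snd (?f q) \<bullet> fst (?g q) - snd (?g q) \<bullet> fst (?f q)"
      using y c one_form_coord[OF c y(2) mem(1)] one_form_coord[OF c y(2) mem(2)]
      by (simp add: coord_rep_def double_coord_def)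
  qed
  from differential_eq[OF c x(2) v this] show ?thesis
    using v by (simp add: exterior_derivative_def Let_def)
qed

text \<open>The vector part is defined in every chart separately: its coordinates are immediate, and
  that they form a tangent vector is the invariance of the Lie bracket. The covector part is defined
  through one chosen chart: its formula in an arbitrary chart needs
  \<open>lie_derivative_coord\<close>, and membership in the dual space is then read off.\<close>

lemma courant_bracket_coord:
  assumes a: "smooth_section A (double_tangent A) U a" and b: "smooth_section A (double_tangent A) U b"
    and x: "x \<in> U"
  shows "courant_bracket A a b x \<in> fib (double_tangent A) x"
    and "c \<in> A \<Longrightarrow> x \<in> fst c \<Longrightarrow> double_coord A c x (courant_bracket A a b x)
      = coord_bracket (coord_rep A c a) (coord_rep A c b) (snd c x)"
proof -
  let ?z = "courant_bracket A a b x"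
  let ?B = "\<lambda>c. coord_bracket (coord_rep A c a) (coord_rep A c b) (snd c x)"
  have fst: "fst ?z c = fst (?B c)" if c: "c \<in> A" "x \<in> fst c" for c
  proof -
    define S where "S = snd c ` (U \<inter> fst c)"
    have S: "open S" "snd c x \<in> S" using open_image_chart[OF U c(1)] x c by (auto simp: S_def)
    have sm: "smooth_on S (coord_rep A c a)" "smooth_on S (coord_rep A c b)"
      unfolding S_def using smooth_on_coord_rep a b c by auto
    have X: "(\<lambda>z. (fst \<circ> \<sigma>) z c) \<circ> chart_inv c = (\<lambda>q. fst (coord_rep A c \<sigma> q))" for \<sigma>
      by (auto simp: coord_rep_def double_coord_def)
    show ?thesis
      unfolding courant_bracket_def Let_def fst_conv lie_bracket_def X
        frechet_derivative_fst_snd[OF sm(1) S(2)] frechet_derivative_fst_snd[OF sm(2) S(2)]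
      using c by (simp add: coord_bracket_def half_bracket_def coord_rep_def double_coord_def)
  qed
  have snd: "snd ?z v = snd (?B c) \<bullet> v c" if c: "c \<in> A" "x \<in> fst c" and v: "v \<in> tangent_space A x" for c v
  proof -
    define S where "S = snd c ` (U \<inter> fst c)"
    have S: "open S" "snd c x \<in> S" using open_image_chart[OF U c(1)] x c by (auto simp: S_def)
    let ?f = "coord_rep A c a" and ?g = "coord_rep A c b" and ?p = "snd c x"
    let ?f' = "frechet_derivative ?f (at ?p)" and ?g' = "frechet_derivative ?g (at ?p)"
    have sm: "smooth_on S ?f" "smooth_on S ?g"
      unfolding S_def using smooth_on_coord_rep a b c by auto
    note lin = smooth_on_linear_derivative[OF sm(1) S(2)] smooth_on_linear_derivative[OF sm(2) S(2)]
    \<comment> \<open>The sum is the vector that represents the functional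
      \<open>w \<mapsto> pairing u (L w)\<close>.\<close>
    have *: "(\<Sum>b\<in>Basis. pairing u (L b) *\<^sub>R b) \<bullet> v c = pairing u (L (v c))"
      if "linear L" for L :: "'e \<Rightarrow> 'e \<times> 'e" and u
    proof -
      have "linear (\<lambda>w. pairing u (L w))"
        using that by (intro linearI)
          (simp_all add: linear_add linear_scale pairing_def inner_add_right inner_add_left algebra_simps)
      from linear_eq_sum_Basis[OF this, of "v c"] show ?thesis
        by (simp add: inner_sum_right inner_commute[of _ "v c"] mult.commute)
    qed
    have "snd ?z v = (snd (?g' (fst (?f ?p))) \<bullet> v c + snd (?g ?p) \<bullet> fst (?f' (v c)))
        - (snd (?f' (fst (?g ?p))) \<bullet> v c + snd (?f ?p) \<bullet> fst (?g' (v c)))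
        + (1/2) * ((snd (?f ?p) \<bullet> fst (?g' (v c)) + snd (?f' (v c)) \<bullet> fst (?g ?p))
           - (snd (?g ?p) \<bullet> fst (?f' (v c)) + snd (?g' (v c)) \<bullet> fst (?f ?p)))"
      unfolding courant_bracket_def Let_def snd_conv
      using lie_derivative_coord[OF a b c(1) x c(2) v] lie_derivative_coord[OF b a c(1) x c(2) v]
        exterior_derivative_coord[OF a b c(1) x c(2) v]
      by (simp only: plus_fun_def minus_apply scaleR_fun_def Let_def real_scaleR_def)
    also have "\<dots> = snd (?B c) \<bullet> v c"
      using *[OF lin(1)] *[OF lin(2)]
      by (simp add: coord_bracket_def half_bracket_def inner_diff_left pairing_def algebra_simps)
    finally show ?thesis .
  qed
  let ?c = "chart_at A x"
  have c0: "?c \<in> A" "x \<in> fst ?c" using chart_at openin_subset_carrier[OF U] x by auto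
  have "fst ?z \<in> tangent_space A x"
  proof (rule tangent_spaceI[OF c0])
    fix c assume c: "c \<in> A" "x \<in> fst c"
    define R where "R = snd ?c ` (U \<inter> (fst ?c \<inter> fst c))"
    define T where "T = snd c ` (U \<inter> fst c)"
    have R: "open R" "snd ?c x \<in> R" "R \<subseteq> snd ?c ` (U \<inter> fst ?c)" "transition ?c c ` R \<subseteq> T"
      using open_image_chart[OF openin_Int[OF U openin_chart[OF c(1)]] c0(1)] x c0 c
      by (auto simp: R_def T_def Int_ac)
    have T: "open T" "snd c x \<in> T" using open_image_chart[OF U c(1)] x c by (auto simp: T_def)
    have \<phi>: "smooth_on R (transition ?c c)"
      by (rule smooth_on_subset[OF transition_smooth[OF c0(1) c(1)]]) (auto simp: R_def)
    have sm: "smooth_on R (coord_rep A ?c \<sigma>)" "smooth_on T (coord_rep A c \<sigma>)"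
      if "smooth_section A (double_tangent A) U \<sigma>" for \<sigma>
      using smooth_on_subset[OF smooth_on_coord_rep[OF that c0(1)] R(3)] smooth_on_coord_rep[OF that c(1)]
      by (simp_all add: T_def)
    have change: "fst (coord_rep A c \<sigma> (transition ?c c q))
        = frechet_derivative (transition ?c c) (at q) (fst (coord_rep A ?c \<sigma> q))"
      if "q \<in> R" and \<sigma>: "smooth_section A (double_tangent A) U \<sigma>" for q \<sigma>
    proof -
      from that obtain y where y: "y \<in> U" "y \<in> fst ?c" "y \<in> fst c" "q = snd ?c y" by (auto simp: R_def)
      show ?thesis
        using double_coord_change(1)[OF c0(1) y(2) c(1) y(3) section_mem[OF \<sigma> y(1)]] y c c0
        by (simp add: coord_rep_def)
    qed
    have tr: "transition ?c c (snd ?c x) = snd c x" using c0 by simp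
    note ab = lie_bracket_change[OF R(1,2) \<phi> R(4)
        smooth_on_fst[OF R(1) sm(1)[OF a]] smooth_on_fst[OF T(1) sm(2)[OF a]] change[OF _ a]
        smooth_on_fst[OF R(1) sm(1)[OF b]] smooth_on_fst[OF T(1) sm(2)[OF b]] change[OF _ b]]
    show "fst ?z c = dtransition ?c c x (fst ?z ?c)"
      using ab unfolding tr
        frechet_derivative_fst_snd[OF sm(1)[OF a] R(2)] frechet_derivative_fst_snd[OF sm(1)[OF b] R(2)]
        frechet_derivative_fst_snd[OF sm(2)[OF a] T(2)] frechet_derivative_fst_snd[OF sm(2)[OF b] T(2)]
      by (simp add: fst[OF c] fst[OF c0] coord_bracket_def half_bracket_def del: o_apply)
  next
    fix c assume "\<not> (c \<in> A \<and> x \<in> fst c)"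
    then show "fst ?z c = 0"
      by (simp only: courant_bracket_def Let_def fst_conv lie_bracket_def if_False)
  qed
  moreover have "snd ?z \<in> dual_space (tangent_space A x)"
  proof -
    have "snd ?z v = 0" if "v \<notin> tangent_space A x" for v
      using that by (simp add: courant_bracket_def Let_def lie_derivative_def exterior_derivative_def
          plus_fun_def scaleR_fun_def)
    moreover have "(v + w) c = v c + w c" "(r *\<^sub>R v) c = r *\<^sub>R v c"
      for v w :: "('a, 'e) tvector" and r c
      by (simp_all add: plus_fun_def scaleR_fun_def)
    ultimately show ?thesis
      using snd[OF c0] subspace_tangent_space[OF mem_carrier[OF c0]]
      by (auto simp: dual_space_def subspace_add subspace_scale inner_add_right)
  qed
  ultimately show "?z \<in> fib (double_tangent A) x"
    by (simp add: fib_double fib_tangent mem_Times_iff)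
  show "double_coord A c x ?z = ?B c" if c: "c \<in> A" "x \<in> fst c"
    using c by (simp add: double_coord_def fst snd[OF c tvec_mem[OF c]] euclidean_representation)
qed

lemma smooth_section_courant_bracket:
  assumes a: "smooth_section A (double_tangent A) U a" and b: "smooth_section A (double_tangent A) U b"
  shows "smooth_section A (double_tangent A) U (courant_bracket A a b)"
proof (rule smooth_section_doubleI[OF courant_bracket_coord(1)[OF a b] U])
  fix x assume x: "x \<in> U"
  let ?c = "chart_at A x"
  have c: "?c \<in> A" "x \<in> fst ?c" using chart_at openin_subset_carrier[OF U] x by auto
  have op: "open (snd ?c ` (U \<inter> fst ?c))" by (rule open_image_chart[OF U c(1)])
  have "smooth_on (snd ?c ` (U \<inter> fst ?c)) (coord_bracket (coord_rep A ?c a) (coord_rep A ?c b))"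
    by (intro smooth_on_coord_bracket op smooth_on_coord_rep a b c)
  then have "smooth_on (snd ?c ` (U \<inter> fst ?c))
      ((\<lambda>x. double_coord A ?c x (courant_bracket A a b x)) \<circ> chart_inv ?c)"
    by (rule smooth_on_eq[OF op]) (use courant_bracket_coord(2)[OF a b _ c(1)] c in auto)
  then show "\<exists>c\<in>A. x \<in> fst c \<and> smooth_on (snd c ` (U \<inter> fst c))
      ((\<lambda>x. double_coord A c x (courant_bracket A a b x)) \<circ> chart_inv c)"
    using c by blast
qed

end

end

section \<open>Integrability and the Nijenhuis expression\<close>

lemma pairing_sum_add:
  "(0, \<Sum>b\<in>Basis. pairing u (v' b + v'' b) *\<^sub>R b)
   = (0::'e::euclidean_space, \<Sum>b\<in>Basis. pairing u (v' b) *\<^sub>R b) + (0, \<Sum>b\<in>Basis. pairing u (v'' b) *\<^sub>R b)"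
  by (simp add: pairing_def inner_add_left inner_add_right scaleR_add_left sum.distrib)

lemma half_bracket_add: "half_bracket u (\<lambda>w. v' w + v'' w) = half_bracket u v' + half_bracket u v''"
  unfolding half_bracket_def pairing_sum_add by (simp add: algebra_simps)

definition pairing_complex :: "('e::euclidean_space \<times> 'e \<Rightarrow> 'e \<times> 'e) \<Rightarrow> bool" where
  "pairing_complex K \<longleftrightarrow>
     linear K \<and> (\<forall>a b. pairing (K a) (K b) = pairing a b) \<and> (\<forall>a. K (K a) = - a)"

lemma pairing_complexD:
  assumes "pairing_complex K"
  shows "linear K" "pairing (K a) (K b) = pairing a b" "K (K a) = - a"
  using assms unfolding pairing_complex_def by blast+

text \<open>\<open>- K\<close> is the inverse of \<open>K\<close>, so orthogonality amounts to
  skewness.\<close>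

lemma pairing_complex_skew:
  assumes "pairing_complex K"
  shows "pairing u (K w) = - pairing (K u) w"
proof -
  have "pairing u (K w) = pairing (K u) (K (K w))" by (simp add: pairing_complexD(2)[OF assms])
  also have "\<dots> = - pairing (K u) w" by (simp add: pairing_complexD(3)[OF assms] pairing_def)
  finally show ?thesis .
qed

text \<open>The covector terms cancel on each side separately: on the left by orthogonality, on the
  right by skewness. The remaining directional derivatives agree by \<open>K (K a) = - a\<close>.
  With \<open>v'\<close> the derivative of a section, this removes from \<open>N\<close> all terms
  in which sections are differentiated.\<close>

lemma half_bracket_tensorial:
  fixes K :: "'e::euclidean_space \<times> 'e \<Rightarrow> 'e \<times> 'e"
  assumes K: "pairing_complex K"
  shows "K (half_bracket u v' - half_bracket (K u) (\<lambda>w. K (v' w)))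
    = half_bracket u (\<lambda>w. K (v' w)) + half_bracket (K u) v'"
proof -
  let ?r = "\<lambda>u v'. (0 :: 'e, \<Sum>b\<in>Basis. pairing u (v' b) *\<^sub>R b)"
  have lin: "linear K" and sq: "K (K a) = - a" for a by (rule pairing_complexD[OF K])+
  have 1: "?r (K u) (\<lambda>w. K (v' w)) = ?r u v'" by (simp add: pairing_complexD(2)[OF K])
  have 2: "?r u (\<lambda>w. K (v' w)) = - ?r (K u) v'"
    by (simp add: pairing_complex_skew[OF K] sum_negf)
  show ?thesis
    unfolding half_bracket_def 1 2
    by (simp add: linear_diff[OF lin] linear_add[OF lin] linear_scale[OF lin] sq algebra_simps zero_prod_def)
qed

text \<open>The part of \<open>N\<close> in which the derivative falls on the matrix
  \<open>K\<close> with \<open>v\<close> held constant. In this order of \<open>u\<close> and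
  \<open>v\<close> only the brackets \<open>[K u, K v]\<close> and \<open>[u, K v]\<close>
  contribute.\<close>

definition nijenhuis_half ::
  "('e::euclidean_space \<Rightarrow> 'e \<times> 'e \<Rightarrow> 'e \<times> 'e) \<Rightarrow> 'e \<Rightarrow> 'e \<times> 'e \<Rightarrow> 'e \<times> 'e \<Rightarrow> 'e \<times> 'e" where
  "nijenhuis_half K p u v =
     (let K' = frechet_derivative (\<lambda>q. K q v) (at p)
      in - K p (half_bracket (K p u) K') - half_bracket u K')"

definition nijenhuis ::
  "('e::euclidean_space \<Rightarrow> 'e \<times> 'e \<Rightarrow> 'e \<times> 'e) \<Rightarrow> 'e \<Rightarrow> 'e \<times> 'e \<Rightarrow> 'e \<times> 'e \<Rightarrow> 'e \<times> 'e" where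
  "nijenhuis K p u v = nijenhuis_half K p u v - nijenhuis_half K p v u"

context
  fixes S :: "'e::euclidean_space set" and K :: "'e \<Rightarrow> 'e \<times> 'e \<Rightarrow> 'e \<times> 'e"
  assumes S: "open S" and K: "\<And>q. q \<in> S \<Longrightarrow> pairing_complex (K q)"
    and smooth_K: "\<And>a. smooth_on S (\<lambda>q. K q a)"
begin

lemma endomorphism_expand: "q \<in> S \<Longrightarrow> K q a = (\<Sum>b\<in>Basis. (a \<bullet> b) *\<^sub>R K q b)"
  using K by (intro linear_eq_sum_Basis) (simp add: pairing_complex_def)

lemma smooth_on_endomorphism:
  assumes f: "smooth_on S f"
  shows "smooth_on S (\<lambda>q. K q (f q))"
  by (rule smooth_on_eq[OF S _ endomorphism_expand])
    (intro smooth_on_sum smooth_on_scaleR smooth_on_inner smooth_on_const f S smooth_K)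

lemma frechet_derivative_endomorphism:
  assumes f: "smooth_on S f" and p: "p \<in> S"
  shows "frechet_derivative (\<lambda>q. K q (f q)) (at p)
    = (\<lambda>w. frechet_derivative (\<lambda>q. K q (f p)) (at p) w + K p (frechet_derivative f (at p) w))"
proof
  fix w
  let ?K = "\<lambda>b. frechet_derivative (\<lambda>q. K q b) (at p)" and ?f = "frechet_derivative f (at p)"
  have D: "((\<lambda>q. K q b) has_derivative ?K b) (at p)" for b
    by (rule smooth_on_has_derivative[OF smooth_K p])
  have "((\<lambda>z. f z \<bullet> b) has_derivative (\<lambda>w. ?f w \<bullet> b)) (at p)" for b
    by (intro has_derivative_inner_left smooth_on_has_derivative[OF f p])
  then have d: "((\<lambda>q. \<Sum>b\<in>Basis. (f q \<bullet> b) *\<^sub>R K q b) has_derivative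
      (\<lambda>w. \<Sum>b\<in>Basis. (f p \<bullet> b) *\<^sub>R ?K b w + (?f w \<bullet> b) *\<^sub>R K p b)) (at p)"
    by (intro has_derivative_sum has_derivative_scaleR D)
  have 1: "frechet_derivative (\<lambda>q. K q (f q)) (at p) w
      = (\<Sum>b\<in>Basis. (f p \<bullet> b) *\<^sub>R ?K b w + (?f w \<bullet> b) *\<^sub>R K p b)"
    by (rule frechet_derivative_eqI, rule has_derivative_cong_open[OF S p _ d])
      (rule endomorphism_expand)
  have d': "((\<lambda>q. \<Sum>b\<in>Basis. (f p \<bullet> b) *\<^sub>R K q b) has_derivative
      (\<lambda>w. \<Sum>b\<in>Basis. (f p \<bullet> b) *\<^sub>R ?K b w)) (at p)"
    by (intro has_derivative_sum has_derivative_scaleR_right D)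
  have 2: "?K (f p) w = (\<Sum>b\<in>Basis. (f p \<bullet> b) *\<^sub>R ?K b w)"
    by (rule frechet_derivative_eqI, rule has_derivative_cong_open[OF S p _ d'])
      (rule endomorphism_expand)
  show "frechet_derivative (\<lambda>q. K q (f q)) (at p) w = ?K (f p) w + K p (?f w)"
    unfolding 1 2 endomorphism_expand[OF p, of "?f w"] by (simp add: sum.distrib)
qed

text \<open>By the product rule the derivative of \<open>K f\<close> splits into one of
  \<open>K\<close> and one of \<open>f\<close>. \<open>half_bracket_tensorial\<close>, used for
  \<open>f\<close>, \<open>g\<close> in both orders, cancels the latter, so \<open>f\<close> and
  \<open>g\<close> enter the right side only through their values at \<open>p\<close>.\<close>

lemma nijenhuis_coord_bracket:
  assumes f: "smooth_on S f" and g: "smooth_on S g" and p: "p \<in> S"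
  defines "Kf \<equiv> \<lambda>q. K q (f q)" and "Kg \<equiv> \<lambda>q. K q (g q)"
  shows "K p (coord_bracket f g p - coord_bracket Kf Kg p) - (coord_bracket f Kg p + coord_bracket Kf g p)
    = nijenhuis K p (f p) (g p)"
proof -
  have Kp: "pairing_complex (K p)" and lin: "linear (K p)"
    using K[OF p] by (auto simp: pairing_complex_def)
  note t = half_bracket_tensorial[OF Kp, of "f p" "frechet_derivative g (at p)"]
    half_bracket_tensorial[OF Kp, of "g p" "frechet_derivative f (at p)"]
  show ?thesis
    using t
    unfolding coord_bracket_def nijenhuis_def nijenhuis_half_def Let_def Kf_def Kg_def
      frechet_derivative_endomorphism[OF f p] frechet_derivative_endomorphism[OF g p] half_bracket_add
    by (simp add: linear_diff[OF lin] linear_add[OF lin] algebra_simps)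
qed

end

lemma coord_bracket_cong:
  assumes "open S" "p \<in> S" "\<And>q. q \<in> S \<Longrightarrow> f q = f' q" "\<And>q. q \<in> S \<Longrightarrow> g q = g' q"
  shows "coord_bracket f g p = coord_bracket f' g' p"
  using frechet_derivative_cong_open[OF assms(1,2,3)] frechet_derivative_cong_open[OF assms(1,2,4)]
    assms(2-4) by (simp add: coord_bracket_def)

context atlas
begin

context
  fixes c x
  assumes c: "c \<in> A" and x: "x \<in> fst c"
begin

lemma subspace_double: "subspace (fib (double_tangent A) x)"
  by (rule linear_iso_on_subspace[OF linear_iso_on_double[OF c x]])

lemma double_coord_add:
  "u \<in> fib (double_tangent A) x \<Longrightarrow> v \<in> fib (double_tangent A) x \<Longrightarrow>
   double_coord A c x (u + v) = double_coord A c x u + double_coord A c x v"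
  by (rule linear_iso_on_add[OF linear_iso_on_double[OF c x]])

lemma double_coord_minus:
  "u \<in> fib (double_tangent A) x \<Longrightarrow> double_coord A c x (- u) = - double_coord A c x u"
  using linear_iso_on_scale[OF linear_iso_on_double[OF c x], of u "-1"] by simp

lemma double_coord_diff:
  "u \<in> fib (double_tangent A) x \<Longrightarrow> v \<in> fib (double_tangent A) x \<Longrightarrow>
   double_coord A c x (u - v) = double_coord A c x u - double_coord A c x v"
  using double_coord_add[of u "- v"] double_coord_minus subspace_neg[OF subspace_double] by simp

lemma double_coord_eqI:
  "u \<in> fib (double_tangent A) x \<Longrightarrow> v \<in> fib (double_tangent A) x \<Longrightarrow>
   double_coord A c x u = double_coord A c x v \<Longrightarrow> u = v"
  by (rule linear_iso_on_eqI[OF linear_iso_on_double[OF c x]])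

end

lemma smooth_section_add_diff:
  assumes U: "openin (mtop A) U"
    and a: "smooth_section A (double_tangent A) U a" and b: "smooth_section A (double_tangent A) U b"
  shows "smooth_section A (double_tangent A) U (a + b)" "smooth_section A (double_tangent A) U (a - b)"
proof -
  note mem = section_mem[OF U a] section_mem[OF U b]
  have c: "chart_at A x \<in> A" "x \<in> fst (chart_at A x)" if "x \<in> U" for x
    using chart_at openin_subset_carrier[OF U] that by auto
  have op: "open (snd c ` (U \<inter> fst c))" if "c \<in> A" for c by (rule open_image_chart[OF U that])
  note sm = smooth_on_coord_rep[OF U a] smooth_on_coord_rep[OF U b]
  show "smooth_section A (double_tangent A) U (a + b)"
  proof (rule smooth_section_doubleI[OF _ U])
    show "(a + b) x \<in> fib (double_tangent A) x" if "x \<in> U" for x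
      unfolding plus_fun_def using mem that c[OF that] subspace_add[OF subspace_double] by blast
    fix x assume "x \<in> U"
    note c = c[OF this]
    have "smooth_on (snd (chart_at A x) ` (U \<inter> fst (chart_at A x)))
        (\<lambda>q. coord_rep A (chart_at A x) a q + coord_rep A (chart_at A x) b q)"
      by (intro smooth_on_add op sm c)
    then have "smooth_on (snd (chart_at A x) ` (U \<inter> fst (chart_at A x)))
        ((\<lambda>y. double_coord A (chart_at A x) y ((a + b) y)) \<circ> chart_inv (chart_at A x))"
      by (rule smooth_on_eq[OF op[OF c(1)]])
        (use c mem in \<open>auto simp: coord_rep_def plus_fun_def double_coord_add\<close>)
    then show "\<exists>c\<in>A. x \<in> fst c \<and>
        smooth_on (snd c ` (U \<inter> fst c)) ((\<lambda>x. double_coord A c x ((a + b) x)) \<circ> chart_inv c)"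
      using c by blast
  qed
  show "smooth_section A (double_tangent A) U (a - b)"
  proof (rule smooth_section_doubleI[OF _ U])
    show "(a - b) x \<in> fib (double_tangent A) x" if "x \<in> U" for x
      unfolding minus_apply using mem that c[OF that] subspace_diff[OF subspace_double] by blast
    fix x assume "x \<in> U"
    note c = c[OF this]
    have "smooth_on (snd (chart_at A x) ` (U \<inter> fst (chart_at A x)))
        (\<lambda>q. coord_rep A (chart_at A x) a q - coord_rep A (chart_at A x) b q)"
      by (intro smooth_on_diff op sm c)
    then have "smooth_on (snd (chart_at A x) ` (U \<inter> fst (chart_at A x)))
        ((\<lambda>y. double_coord A (chart_at A x) y ((a - b) y)) \<circ> chart_inv (chart_at A x))"
      by (rule smooth_on_eq[OF op[OF c(1)]])
        (use c mem in \<open>auto simp: coord_rep_def double_coord_diff\<close>)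
    then show "\<exists>c\<in>A. x \<in> fst c \<and>
        smooth_on (snd c ` (U \<inter> fst c)) ((\<lambda>x. double_coord A c x ((a - b) x)) \<circ> chart_inv c)"
      using c by blast
  qed
qed

section \<open>The Nijenhuis criterion for an endomorphism given by matrices in a covering family of
  charts\<close>

context
  fixes C :: "(('a, 'e) chart \<times> ('e \<Rightarrow> 'e \<times> 'e \<Rightarrow> 'e \<times> 'e)) set"
    and J :: "'a \<Rightarrow> ('a, 'e) tvector \<times> (('a, 'e) tvector \<Rightarrow> real) \<Rightarrow>
         ('a, 'e) tvector \<times> (('a, 'e) tvector \<Rightarrow> real)"
  assumes C: "\<And>c k. (c, k) \<in> C \<Longrightarrow> c \<in> A" "\<And>x. x \<in> carrier_of A \<Longrightarrow> \<exists>(c, k)\<in>C. x \<in> fst c"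
    and J_mem: "\<And>c k x u. (c, k) \<in> C \<Longrightarrow> x \<in> fst c \<Longrightarrow> u \<in> fib (double_tangent A) x \<Longrightarrow>
      J x u \<in> fib (double_tangent A) x"
    and J_coord: "\<And>c k x u. (c, k) \<in> C \<Longrightarrow> x \<in> fst c \<Longrightarrow> u \<in> fib (double_tangent A) x \<Longrightarrow>
      double_coord A c x (J x u) = k (snd c x) (double_coord A c x u)"
    and K: "\<And>c k p. (c, k) \<in> C \<Longrightarrow> p \<in> snd c ` fst c \<Longrightarrow> pairing_complex (k p)"
    and smooth_K: "\<And>c k a. (c, k) \<in> C \<Longrightarrow> smooth_on (snd c ` fst c) (\<lambda>p. k p a)"
begin

lemma J_squared:
  assumes c: "(c, k) \<in> C" "x \<in> fst c" and u: "u \<in> fib (double_tangent A) x"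
  shows "J x (J x u) = - u"
proof (rule double_coord_eqI[OF _ c(2)])
  show "c \<in> A" using c C by auto
  with c show "- u \<in> fib (double_tangent A) x"
    using subspace_neg[OF subspace_double u] by blast
  show "double_coord A c x (J x (J x u)) = double_coord A c x (- u)"
    using pairing_complexD(3)[OF K[OF c(1) imageI[OF c(2)]]] c u \<open>c \<in> A\<close>
    by (simp add: J_coord[OF c] J_mem[OF c] double_coord_minus)
qed (intro J_mem[OF c] u)

lemma smooth_section_J:
  assumes U: "openin (mtop A) U" and a: "smooth_section A (double_tangent A) U a"
  shows "smooth_section A (double_tangent A) U (\<lambda>x. J x (a x))"
proof (rule smooth_section_doubleI[OF _ U])
  fix x assume x: "x \<in> U"
  then obtain c k where c: "(c, k) \<in> C" "x \<in> fst c" using C(2) openin_subset_carrier[OF U] by blast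
  then have cA: "c \<in> A" using C by blast
  show "J x (a x) \<in> fib (double_tangent A) x" using J_mem c section_mem[OF U a x] by blast
  let ?S = "snd c ` (U \<inter> fst c)"
  have "smooth_on ?S (\<lambda>q. k q (coord_rep A c a q))"
  proof (rule smooth_on_endomorphism[where K = k and f = "coord_rep A c a", OF open_image_chart[OF U cA]])
    show "pairing_complex (k q)" if "q \<in> ?S" for q
      by (rule K[OF c(1)]) (use that in blast)
    show "smooth_on ?S (\<lambda>q. k q b)" for b
      by (rule smooth_on_subset[OF smooth_K[OF c(1)]]) blast
    show "smooth_on ?S (coord_rep A c a)" by (rule smooth_on_coord_rep[OF U a cA])
  qed
  then have "smooth_on ?S ((\<lambda>x. double_coord A c x (J x (a x))) \<circ> chart_inv c)"
  proof (rule smooth_on_eq[OF open_image_chart[OF U cA]])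
    fix q assume "q \<in> ?S"
    then obtain y where y: "y \<in> U" "y \<in> fst c" "q = snd c y" by blast
    show "((\<lambda>x. double_coord A c x (J x (a x))) \<circ> chart_inv c) q = k q (coord_rep A c a q)"
      using J_coord[OF c(1) y(2) section_mem[OF U a y(1)]] y cA by (simp add: coord_rep_def)
  qed
  then show "\<exists>c\<in>A. x \<in> fst c \<and>
      smooth_on (snd c ` (U \<inter> fst c)) ((\<lambda>x. double_coord A c x (J x (a x))) \<circ> chart_inv c)"
    using cA c by blast
qed

text \<open>With \<open>s = snd a\<close> and \<open>s' = snd b\<close>, the real and imaginary
  parts of the bracket are \<open>[J s, J s'] - [s, s']\<close> and
  \<open>[J s, s'] + [s, J s']\<close>, so the equation on the left says
  \<open>N (s, s') = 0\<close> at \<open>x\<close>.\<close>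

lemma eigen_iff_nijenhuis:
  assumes U: "openin (mtop A) U" and a: "eigenbundle_section A J U a" and b: "eigenbundle_section A J U b"
    and x: "x \<in> U" and c: "(c, k) \<in> C" "x \<in> fst c"
  defines "z \<equiv> courant_bracket_complex A a b"
  shows "J x (fst z x) = - snd z x
    \<longleftrightarrow> nijenhuis k (snd c x) (double_coord A c x (snd a x)) (double_coord A c x (snd b x)) = 0"
proof -
  have cA: "c \<in> A" using C c by blast
  define S where "S = snd c ` (U \<inter> fst c)"
  have S: "open S" "snd c x \<in> S" "S \<subseteq> snd c ` fst c"
    using open_image_chart[OF U cA] x c by (auto simp: S_def)
  have sa: "smooth_section A (double_tangent A) U (fst a)" "smooth_section A (double_tangent A) U (snd a)"
    and sb: "smooth_section A (double_tangent A) U (fst b)" "smooth_section A (double_tangent A) U (snd b)"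
    and Ja: "\<And>y. y \<in> U \<Longrightarrow> J y (snd a y) = fst a y" and Jb: "\<And>y. y \<in> U \<Longrightarrow> J y (snd b y) = fst b y"
    using a b by (auto simp: eigenbundle_section_def)
  let ?f = "coord_rep A c (snd a)" and ?g = "coord_rep A c (snd b)" and ?p = "snd c x"
  let ?Kf = "\<lambda>q. k q (?f q)" and ?Kg = "\<lambda>q. k q (?g q)"
  have f0: "coord_rep A c (fst a) q = ?Kf q" and g0: "coord_rep A c (fst b) q = ?Kg q" if "q \<in> S" for q
  proof -
    from that obtain y where y: "y \<in> U" "y \<in> fst c" "q = snd c y" by (auto simp: S_def)
    show "coord_rep A c (fst a) q = ?Kf q" "coord_rep A c (fst b) q = ?Kg q"
      using J_coord[OF c(1) y(2) section_mem[OF U sa(2) y(1)]]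
        J_coord[OF c(1) y(2) section_mem[OF U sb(2) y(1)]] Ja[OF y(1)] Jb[OF y(1)] y cA
      by (simp_all add: coord_rep_def)
  qed
  note cb = courant_bracket_coord[OF U]
  have mem: "courant_bracket A (fst a) (fst b) x \<in> fib (double_tangent A) x"
    "courant_bracket A (snd a) (snd b) x \<in> fib (double_tangent A) x"
    "courant_bracket A (fst a) (snd b) x \<in> fib (double_tangent A) x"
    "courant_bracket A (snd a) (fst b) x \<in> fib (double_tangent A) x"
    using cb(1) sa sb x by auto
  have 1: "double_coord A c x (fst z x) = coord_bracket ?Kf ?Kg ?p - coord_bracket ?f ?g ?p"
    using cb(2)[OF sa(1) sb(1) x cA c(2)] cb(2)[OF sa(2) sb(2) x cA c(2)]
      coord_bracket_cong[OF S(1,2) f0 g0] mem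
    by (simp add: z_def courant_bracket_complex_def double_coord_diff[OF cA c(2)])
  have cong: "coord_bracket (coord_rep A c (fst a)) ?g ?p = coord_bracket ?Kf ?g ?p"
    "coord_bracket ?f (coord_rep A c (fst b)) ?p = coord_bracket ?f ?Kg ?p"
    by (rule coord_bracket_cong[OF S(1,2)]; simp only: f0 g0)+
  have 2: "double_coord A c x (snd z x) = coord_bracket ?Kf ?g ?p + coord_bracket ?f ?Kg ?p"
    using cb(2)[OF sa(1) sb(2) x cA c(2)] cb(2)[OF sa(2) sb(1) x cA c(2)]
      cong mem
    by (simp add: z_def courant_bracket_complex_def plus_fun_def double_coord_add[OF cA c(2)])
  note sub = subspace_double[OF cA c(2)]
  have m: "fst z x \<in> fib (double_tangent A) x" "snd z x \<in> fib (double_tangent A) x"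
    using mem subspace_diff[OF sub] subspace_add[OF sub]
    by (simp_all add: z_def courant_bracket_complex_def plus_fun_def)
  have "J x (fst z x) = - snd z x \<longleftrightarrow> double_coord A c x (J x (fst z x)) = double_coord A c x (- snd z x)"
    using double_coord_eqI[OF cA c(2) J_mem[OF c m(1)] subspace_neg[OF sub m(2)]] by metis
  also have "\<dots> \<longleftrightarrow> k ?p (coord_bracket ?Kf ?Kg ?p - coord_bracket ?f ?g ?p)
      = - (coord_bracket ?Kf ?g ?p + coord_bracket ?f ?Kg ?p)"
    unfolding J_coord[OF c m(1)] double_coord_minus[OF cA c(2) m(2)] 1 2 ..
  also have "\<dots> \<longleftrightarrow> nijenhuis k ?p (?f ?p) (?g ?p) = 0"
  proof -
    have "linear (k ?p)" using K[OF c(1)] c by (auto simp: pairing_complex_def)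
    from linear_neg[OF this, of "coord_bracket ?f ?g ?p - coord_bracket ?Kf ?Kg ?p"]
    have "k ?p (coord_bracket ?Kf ?Kg ?p - coord_bracket ?f ?g ?p)
      = - k ?p (coord_bracket ?f ?g ?p - coord_bracket ?Kf ?Kg ?p)" by simp
    moreover have "k ?p (coord_bracket ?f ?g ?p - coord_bracket ?Kf ?Kg ?p)
        - (coord_bracket ?f ?Kg ?p + coord_bracket ?Kf ?g ?p) = nijenhuis k ?p (?f ?p) (?g ?p)"
      using K[OF c(1)] S(3) smooth_on_coord_rep[OF U sa(2) cA] smooth_on_coord_rep[OF U sb(2) cA]
      by (intro nijenhuis_coord_bracket[OF S(1)] S(2) smooth_on_subset[OF smooth_K[OF c(1)]])
        (auto simp: S_def)
    moreover have "(x = - s \<longleftrightarrow> n = 0)" if "x = - y" "y - (r + t) = n" "s = t + r" for x y s t r n :: "'e \<times> 'e"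
    proof -
      have "n = y - s" using that(2,3) by (simp add: add.commute)
      then have "n = 0 \<longleftrightarrow> y = s" by simp
      then show ?thesis using that(1) by auto
    qed
    ultimately show ?thesis by blast
  qed
  finally show ?thesis using coord_rep_apply[OF cA c(2)] by simp
qed

text \<open>Tensoriality serves both directions: for necessity, arbitrary values \<open>u\<close>
  and \<open>v\<close> are extended to sections with constant coordinates on a chart domain; for
  sufficiency, the values of the given sections are inserted.\<close>

theorem integrable_gcs_iff_nijenhuis:
  "integrable_gcs A J \<longleftrightarrow> (\<forall>(c, k)\<in>C. \<forall>p\<in>snd c ` fst c. \<forall>u v. nijenhuis k p u v = 0)"
proof
  assume int: "integrable_gcs A J"
  have "nijenhuis k p u v = 0" if c: "(c, k) \<in> C" and p: "p \<in> snd c ` fst c" for c k p u v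
  proof -
  from p obtain x where x: "x \<in> fst c" "p = snd c x" by blast
  have cA: "c \<in> A" using c C by blast
  have U: "openin (mtop A) (fst c)" by (rule openin_chart[OF cA])
  let ?s = "\<lambda>u y. double_vec A c y u"
  have s: "smooth_section A (double_tangent A) (fst c) (?s u)" for u
  proof (rule smooth_section_doubleI[OF double_vec_mem[OF cA] U])
    fix y assume "y \<in> fst c"
    have op: "open (snd c ` (fst c \<inter> fst c))" by (rule open_image_chart[OF U cA])
    have "smooth_on (snd c ` (fst c \<inter> fst c)) ((\<lambda>x. double_coord A c x (?s u x)) \<circ> chart_inv c)"
      by (rule smooth_on_eq[OF op smooth_on_const]) (use cA in \<open>auto simp: double_coord_vec\<close>)
    then show "\<exists>c'\<in>A. y \<in> fst c' \<and> smooth_on (snd c' ` (fst c \<inter> fst c'))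
        ((\<lambda>x. double_coord A c' x (?s u x)) \<circ> chart_inv c')"
      using cA \<open>y \<in> fst c\<close> by blast
  qed
  let ?a = "\<lambda>u. (\<lambda>y. J y (?s u y), ?s u)"
  have a: "eigenbundle_section A J (fst c) (?a u)" for u
    using s smooth_section_J[OF U s] J_squared[OF c _ double_vec_mem[OF cA]]
    by (simp add: eigenbundle_section_def)
  have "eigenbundle_section A J (fst c) (courant_bracket_complex A (?a u) (?a v))"
    using int a U by (simp add: integrable_gcs_def)
  with x(1) have "J x (fst (courant_bracket_complex A (?a u) (?a v)) x)
      = - snd (courant_bracket_complex A (?a u) (?a v)) x"
    unfolding eigenbundle_section_def by blast
  from iffD1[OF eigen_iff_nijenhuis[OF U a a x(1) c x(1)] this]
  show "nijenhuis k p u v = 0"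
    by (simp add: double_coord_vec[OF cA x(1)] x(2))
  qed
  then show "\<forall>(c, k)\<in>C. \<forall>p\<in>snd c ` fst c. \<forall>u v. nijenhuis k p u v = 0" by blast
next
  assume nij: "\<forall>(c, k)\<in>C. \<forall>p\<in>snd c ` fst c. \<forall>u v. nijenhuis k p u v = 0"
  show "integrable_gcs A J"
    unfolding integrable_gcs_def
  proof (intro allI impI)
    fix U a b assume U: "openin (mtop A) U"
      and a: "eigenbundle_section A J U a" and b: "eigenbundle_section A J U b"
    let ?z = "courant_bracket_complex A a b"
    have "smooth_section A (double_tangent A) U (fst ?z)" "smooth_section A (double_tangent A) U (snd ?z)"
      using a b unfolding courant_bracket_complex_def fst_conv snd_conv
      by (auto simp: eigenbundle_section_def
          intro!: smooth_section_add_diff[OF U] smooth_section_courant_bracket[OF U])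
    moreover have "J x (fst ?z x) = - snd ?z x \<and> J x (snd ?z x) = fst ?z x" if x: "x \<in> U" for x
    proof -
      obtain c k where c: "(c, k) \<in> C" "x \<in> fst c" using C(2) openin_subset_carrier[OF U] x by blast
      have 1: "J x (fst ?z x) = - snd ?z x"
        by (rule iffD2[OF eigen_iff_nijenhuis[OF U a b x c]]) (use nij c in blast)
      have cA: "c \<in> A" using C c by blast
      note sub = subspace_double[OF cA c(2)]
      have m: "fst ?z x \<in> fib (double_tangent A) x"
        using section_mem[OF U calculation(1) x] .
      \<comment> \<open>The second eigenvalue equation follows from the first by
        \<open>J\<^sup>2 = -1\<close>. Linearity of \<open>J\<close> is available only through its
        matrices, so the sign is moved inside in coordinates.\<close>
      have "snd ?z x = - J x (fst ?z x)" using 1 by simp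
      also have "\<dots> = J x (- fst ?z x)"
      proof (rule double_coord_eqI[OF _ c(2)])
        show "c \<in> A" by (rule cA)
        show "- J x (fst ?z x) \<in> fib (double_tangent A) x" "J x (- fst ?z x) \<in> fib (double_tangent A) x"
          by (intro subspace_neg[OF sub] J_mem[OF c] m)+
        have "linear (k (snd c x))" using K[OF c(1)] c by (auto simp: pairing_complex_def)
        then show "double_coord A c x (- J x (fst ?z x)) = double_coord A c x (J x (- fst ?z x))"
          using m subspace_neg[OF sub m] c cA
          by (simp add: double_coord_minus[OF cA c(2)] J_mem[OF c] J_coord[OF c] linear_neg)
      qed
      finally have "J x (snd ?z x) = J x (J x (- fst ?z x))" by simp
      also have "\<dots> = fst ?z x"
        using J_squared[OF c subspace_neg[OF sub m]] by simp
      finally show ?thesis using 1 by simp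
    qed
    ultimately show "eigenbundle_section A J U ?z" by (simp add: eigenbundle_section_def)
  qed
qed

end

end

section \<open>Adapted charts\<close>

abbreviation param_map ::
  "('m, 'd) chart \<Rightarrow> ('m \<Rightarrow> 'e \<Rightarrow> 'z) \<Rightarrow> 'd \<times> 'e \<Rightarrow> 'z" where
  "param_map c \<psi> \<equiv> (\<lambda>(\<xi>, y). \<psi> (chart_inv c \<xi>) y)"

text \<open>Names a member of \<open>adapted_charts\<close> by the data that produce it, so that
  points can be computed from coordinates by \<open>param_map\<close> rather than through
  \<open>inv_into\<close>.\<close>

definition param_chart ::
  "('m, 'd) chart \<Rightarrow> ('m \<Rightarrow> 'e \<Rightarrow> 'z) \<Rightarrow> ('d \<times> 'e) set \<Rightarrow> ('z, 'd \<times> 'e) chart" where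
  "param_chart c \<psi> W = (param_map c \<psi> ` W, inv_into W (param_map c \<psi>))"

lemma param_chart:
  assumes "inj_on (param_map c \<psi>) W"
  shows "fst (param_chart c \<psi> W) = param_map c \<psi> ` W"
    "p \<in> W \<Longrightarrow> snd (param_chart c \<psi> W) (param_map c \<psi> p) = p"
    "p \<in> W \<Longrightarrow> chart_inv (param_chart c \<psi> W) p = param_map c \<psi> p"
    "snd (param_chart c \<psi> W) ` fst (param_chart c \<psi> W) = W"
    "inj_on (snd (param_chart c \<psi> W)) (fst (param_chart c \<psi> W))"
proof -
  let ?P = "param_map c \<psi>"
  show 1: "fst (param_chart c \<psi> W) = ?P ` W" by (simp add: param_chart_def)
  show 2: "p \<in> W \<Longrightarrow> snd (param_chart c \<psi> W) (?P p) = p" for p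
    using inv_into_f_f[OF assms] by (simp add: param_chart_def)
  show inj: "inj_on (snd (param_chart c \<psi> W)) (fst (param_chart c \<psi> W))"
    unfolding 1 by (auto simp: inj_on_def 2 simp del: split_paired_All)
  show "p \<in> W \<Longrightarrow> chart_inv (param_chart c \<psi> W) p = ?P p"
    unfolding chart_inv_def[of "param_chart c \<psi> W"] by (rule inv_into_f_eq[OF inj]) (auto simp: 1 2)
  show "snd (param_chart c \<psi> W) ` fst (param_chart c \<psi> W) = W"
    unfolding 1 by (simp add: image_image 2)
qed

text \<open>One interface for parametrizations of several total spaces: of the torus bundle by its
  trivializations, of a quotient by a lattice bundle, and of the vector bundle itself, where
  \<open>L = {0}\<close>. The bound \<open>1\<close> in \<open>discrete\<close> is the gap between
  distinct integer vectors.\<close>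

locale lattice_params = atlas A for A :: "('m, 'd::euclidean_space) chart set" +
  fixes \<Phi> :: "('m set \<times> ('m \<Rightarrow> 'e::euclidean_space \<Rightarrow> 'z)) set" and L :: "'e set"
  assumes param_open: "(U, \<psi>) \<in> \<Phi> \<Longrightarrow> openin (mtop A) U"
    and param_base: "(U, \<psi>) \<in> \<Phi> \<Longrightarrow> (U', \<psi>') \<in> \<Phi> \<Longrightarrow> x \<in> U \<Longrightarrow> x' \<in> U' \<Longrightarrow> \<psi> x y = \<psi>' x' y' \<Longrightarrow> x = x'"
    and param_kernel: "(U, \<psi>) \<in> \<Phi> \<Longrightarrow> x \<in> U \<Longrightarrow> \<psi> x y = \<psi> x y' \<longleftrightarrow> y - y' \<in> L"
    and discrete: "l \<in> L \<Longrightarrow> norm l < 1 \<Longrightarrow> l = 0"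
begin

definition valid :: "('m, 'd) chart \<Rightarrow> 'm set \<Rightarrow> ('m \<Rightarrow> 'e \<Rightarrow> 'z) \<Rightarrow> ('d \<times> 'e) set \<Rightarrow> bool" where
  "valid c U \<psi> W \<longleftrightarrow> c \<in> A \<and> (U, \<psi>) \<in> \<Phi> \<and> open W \<and> W \<subseteq> snd c ` (fst c \<inter> U) \<times> UNIV \<and>
     inj_on (param_map c \<psi>) W"

lemma adapted_charts_eq: "adapted_charts A \<Phi> = {param_chart c \<psi> W | c U \<psi> W. valid c U \<psi> W}"
  unfolding adapted_charts_def valid_def param_chart_def by blast

lemma validD:
  assumes "valid c U \<psi> W"
  shows "c \<in> A" "(U, \<psi>) \<in> \<Phi>" "open W" "inj_on (param_map c \<psi>) W"
    "(\<xi>, y) \<in> W \<Longrightarrow> chart_inv c \<xi> \<in> fst c \<and> chart_inv c \<xi> \<in> U \<and> snd c (chart_inv c \<xi>) = \<xi>"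
  using assms inv_left unfolding valid_def by (simp_all del: inv_left, auto)

lemma validE:
  assumes "valid c U \<psi> W" "z \<in> fst (param_chart c \<psi> W)"
  obtains x y where "x \<in> fst c" "x \<in> U" "(snd c x, y) \<in> W" "z = \<psi> x y"
    "snd (param_chart c \<psi> W) z = (snd c x, y)"
proof -
  note V = validD[OF assms(1)]
  obtain \<xi> y where p: "(\<xi>, y) \<in> W" "z = \<psi> (chart_inv c \<xi>) y"
    using assms(2) param_chart(1)[OF V(4)] by auto
  show ?thesis
    using that[of "chart_inv c \<xi>" y] V(5)[OF p(1)] p param_chart(2)[OF V(4) p(1)] by simp
qed

lemma valid_mem:
  assumes "valid c U \<psi> W" "x \<in> fst c" "(snd c x, y) \<in> W"
  shows "\<psi> x y \<in> fst (param_chart c \<psi> W)" "snd (param_chart c \<psi> W) (\<psi> x y) = (snd c x, y)"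
proof -
  note V = validD[OF assms(1)]
  have P: "param_map c \<psi> (snd c x, y) = \<psi> x y" using inv_left[OF V(1) assms(2)] by simp
  show "\<psi> x y \<in> fst (param_chart c \<psi> W)"
    unfolding param_chart(1)[OF V(4)] P[symmetric] using assms(3) by blast
  show "snd (param_chart c \<psi> W) (\<psi> x y) = (snd c x, y)"
    using param_chart(2)[OF V(4) assms(3)] unfolding P .
qed

lemma valid_exists:
  assumes c: "c \<in> A" and \<psi>: "(U, \<psi>) \<in> \<Phi>" and x: "x \<in> fst c" "x \<in> U"
  shows "\<exists>W. valid c U \<psi> W \<and> (snd c x, y) \<in> W"
proof (intro exI conjI)
  \<comment> \<open>Two points of a ball of radius \<open>1/2\<close> differ by less than the bound
    \<open>1\<close> of \<open>discrete\<close>, so no two of them are identified.\<close>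
  let ?W = "snd c ` (fst c \<inter> U) \<times> ball y (1/2)"
  show "(snd c x, y) \<in> ?W" using x by auto
  have "open (snd c ` (fst c \<inter> U))"
    using open_image_chart[OF param_open[OF \<psi>] c] by (simp add: Int_commute)
  moreover have "inj_on (param_map c \<psi>) ?W"
  proof (rule inj_onI)
    fix p p' assume p: "p \<in> ?W" "p' \<in> ?W" "param_map c \<psi> p = param_map c \<psi> p'"
    then obtain w y1 w' y2 where w: "w \<in> fst c" "w \<in> U" "p = (snd c w, y1)" "y1 \<in> ball y (1/2)"
      "w' \<in> fst c" "w' \<in> U" "p' = (snd c w', y2)" "y2 \<in> ball y (1/2)" by auto
    have eq: "\<psi> w y1 = \<psi> w' y2" using p(3) w c by simp
    have "w = w'" by (rule param_base[OF \<psi> \<psi> w(2,6) eq])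
    then have "y1 - y2 \<in> L" using eq param_kernel[OF \<psi> w(2)] by simp
    moreover have "norm (y1 - y2) < 1"
      using w(4,8) dist_triangle2[of y1 y2 y] by (simp add: dist_norm norm_minus_commute)
    ultimately have "y1 = y2" using discrete by fastforce
    then show "p = p'" using w \<open>w = w'\<close> by simp
  qed
  ultimately show "valid c U \<psi> ?W"
    unfolding valid_def using c \<psi> by (simp add: open_Times Sigma_mono)
qed

lemma valid_inv:
  assumes "valid c U \<psi> W" "(\<xi>, y) \<in> W"
  shows "chart_inv c \<xi> \<in> fst c" "chart_inv c \<xi> \<in> U" "snd c (chart_inv c \<xi>) = \<xi>"
    "chart_inv (param_chart c \<psi> W) (\<xi>, y) = \<psi> (chart_inv c \<xi>) y"
  using validD(5)[OF assms] param_chart(3)[OF validD(4)[OF assms(1)] assms(2)] by simp_all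

lemma tangent_map_proj:
  assumes B: "atlas B" "param_chart c \<psi> W \<in> B" and V: "valid c U \<psi> W"
    and pr: "\<And>x y. x \<in> U \<Longrightarrow> pr (\<psi> x y) = x"
    and x: "x \<in> fst c" "x \<in> U" "(snd c x, y) \<in> W" and w: "w \<in> tangent_space B (\<psi> x y)"
  shows "tangent_map B A pr (\<psi> x y) w = tvec A c x (fst (w (param_chart c \<psi> W)))"
proof -
  let ?k = "param_chart c \<psi> W"
  note v = validD[OF V] and z = valid_mem[OF V x(1,3)]
  have p: "pr (chart_inv ?k r) \<in> fst c" "snd c (pr (chart_inv ?k r)) = fst r" if "r \<in> W" for r
    using valid_inv[OF V, of "fst r" "snd r"] pr that by simp_all
  have d: "((snd c \<circ> pr \<circ> chart_inv ?k) has_derivative fst) (at (snd ?k (\<psi> x y)))"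
    by (rule has_derivative_cong_open[OF v(3) _ _ has_derivative_fst[OF has_derivative_ident]])
      (use x z p(2) in auto)
  show ?thesis
    using tangent_map_eq[OF B(1) atlas_axioms B(2) z(1) v(1) w v(3) _ p(1) d] x z(2) pr by simp
qed

text \<open>In the coordinates of the adapted chart the curve is the straight line
  \<open>\<tau> \<mapsto> (snd c x, y + \<tau> e)\<close> as long as it stays in
  \<open>W\<close>.\<close>

lemma velocity_param:
  assumes B: "atlas B" "param_chart c \<psi> W \<in> B" and V: "valid c U \<psi> W"
    and x: "x \<in> fst c" "(snd c x, y) \<in> W"
  shows "velocity B (\<lambda>\<tau>. \<psi> x (y + \<tau> *\<^sub>R e)) 0 = tvec B (param_chart c \<psi> W) (\<psi> x y) (0, e)"
proof -
  let ?k = "param_chart c \<psi> W" and ?\<gamma> = "\<lambda>\<tau>. \<psi> x (y + \<tau> *\<^sub>R e)"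
  let ?g = "\<lambda>\<tau>::real. (snd c x, y + \<tau> *\<^sub>R e)"
  define O' where "O' = ?g -` W"
  have O': "open O'" "0 \<in> O'"
    using x(2) unfolding O'_def by (auto intro!: open_vimage validD(3)[OF V] continuous_intros)
  have mem: "?\<gamma> \<tau> \<in> fst ?k" "snd ?k (?\<gamma> \<tau>) = ?g \<tau>" if "\<tau> \<in> O'" for \<tau>
    using valid_mem[OF V x(1)] that by (auto simp: O'_def)
  have "(?g has_vector_derivative (0, e)) (at 0)"
    unfolding has_vector_derivative_def by (auto intro!: derivative_eq_intros)
  then have d: "((snd ?k \<circ> ?\<gamma>) has_vector_derivative (0, e)) (at 0)"
    unfolding has_vector_derivative_def
    by (rule has_derivative_cong_open[OF O', rotated]) (use mem(2) in auto)
  have "velocity B ?\<gamma> 0 = tvec B ?k (?\<gamma> 0) (0, e)"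
    by (rule atlas.velocity_eq[OF B O' mem(1) d])
  then show ?thesis by simp
qed

end

text \<open>\<open>H\<close> is the same for all base points in \<open>N\<close>: this is flatness,
  and it makes the transition functions locally constant.\<close>

locale flat_params = lattice_params +
  assumes param_change: "(U, \<psi>) \<in> \<Phi> \<Longrightarrow> (U', \<psi>') \<in> \<Phi> \<Longrightarrow> x \<in> U \<Longrightarrow> x \<in> U' \<Longrightarrow>
      \<exists>N H. openin (mtop A) N \<and> x \<in> N \<and> N \<subseteq> U \<inter> U' \<and> linear H \<and> (\<forall>x\<in>N. \<forall>y. \<psi> x y = \<psi>' x (H y))"
begin

text \<open>\<open>\<psi>' x (H y + l) = \<psi>' x (H y) = \<psi> x y\<close> for each
  \<open>l\<close> in \<open>L\<close>. The vector \<open>l\<close> selects the lift of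
  \<open>z\<close> that lies in \<open>W'\<close>; injectivity on \<open>W'\<close> then identifies
  the fibre part of the coordinate change with \<open>H y + l\<close> as long as the result stays in
  \<open>W'\<close>.\<close>

lemma param_transition:
  assumes V: "valid c U \<psi> W" and V': "valid c' U' \<psi>' W'"
    and mem: "z \<in> fst (param_chart c \<psi> W)" "z \<in> fst (param_chart c' \<psi>' W')"
  obtains T H l where "open T" "snd (param_chart c \<psi> W) z \<in> T"
    "T \<subseteq> snd (param_chart c \<psi> W) ` (fst (param_chart c \<psi> W) \<inter> fst (param_chart c' \<psi>' W'))"
    "linear H" "\<And>\<xi> y. (\<xi>, y) \<in> T \<Longrightarrow> transition (param_chart c \<psi> W) (param_chart c' \<psi>' W') (\<xi>, y)
      = (transition c c' \<xi>, H y + l)" "T \<subseteq> snd c ` (fst c \<inter> fst c') \<times> UNIV"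
    "(c' = c \<and> \<psi>' = \<psi> \<and> U' = U) \<Longrightarrow> H = (\<lambda>y. y)"
proof -
  note v = validD[OF V] and v' = validD[OF V']
  obtain x y where x: "x \<in> fst c" "x \<in> U" "(snd c x, y) \<in> W" "z = \<psi> x y"
    "snd (param_chart c \<psi> W) z = (snd c x, y)" by (rule validE[OF V mem(1)])
  obtain x' y' where x': "x' \<in> fst c'" "x' \<in> U'" "(snd c' x', y') \<in> W'" "z = \<psi>' x' y'"
    "snd (param_chart c' \<psi>' W') z = (snd c' x', y')" by (rule validE[OF V' mem(2)])
  have "x' = x" using param_base[OF v(2) v'(2) x(2) x'(2)] x(4) x'(4) by metis
  note x' = x'[unfolded this]
  \<comment> \<open>\<open>param_change\<close> only guarantees some \<open>H\<close>. For a
    parametrization compared with itself the identity is taken, so that the fibre part of the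
    coordinate change becomes a translation.\<close>
  have "\<exists>N H. openin (mtop A) N \<and> x \<in> N \<and> N \<subseteq> U \<inter> U' \<and> linear H \<and>
      (\<forall>x\<in>N. \<forall>y. \<psi> x y = \<psi>' x (H y)) \<and> ((c' = c \<and> \<psi>' = \<psi> \<and> U' = U) \<longrightarrow> H = (\<lambda>y. y))"
  proof (cases "c' = c \<and> \<psi>' = \<psi> \<and> U' = U")
    case True
    then show ?thesis using param_open[OF v(2)] x
      by (intro exI[of _ U] exI[of _ "\<lambda>y. y"]) (auto intro: linear_id[unfolded id_def])
  next
    case False
    then show ?thesis using param_change[OF v(2) v'(2) x(2) x'(2)] by blast
  qed
  then obtain N H where N: "openin (mtop A) N" "x \<in> N" "N \<subseteq> U \<inter> U'" and H: "linear H"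
    "\<And>x y. x \<in> N \<Longrightarrow> \<psi> x y = \<psi>' x (H y)" "(c' = c \<and> \<psi>' = \<psi> \<and> U' = U) \<longrightarrow> H = (\<lambda>y. y)" by blast
  define l where "l = y' - H y"
  have l: "l \<in> L"
    using param_kernel[OF v'(2) x'(2), of y' "H y"] x(4) x'(4) H(2)[OF N(2), of y] by (simp add: l_def)
  define D where "D = snd c ` (N \<inter> fst c' \<inter> fst c) \<times> UNIV \<inter> W"
  define G where "G = (\<lambda>p. (transition c c' (fst p), H (snd p) + l))"
  define T where "T = D \<inter> G -` W'"
  have opN: "open (snd c ` (N \<inter> fst c' \<inter> fst c))"
    by (intro open_image_chart openin_Int N openin_chart v v')
  have opD: "open D" unfolding D_def by (intro open_Int open_Times opN v open_UNIV)
  have "continuous_on D (\<lambda>p. transition c c' (fst p))"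
    by (rule continuous_on_compose2[OF smooth_on_continuous_on[OF transition_smooth[OF v(1) v'(1)]]])
      (auto simp: D_def intro: continuous_on_fst continuous_on_id)
  moreover have "continuous_on D (\<lambda>p. H (snd p) + l)"
  proof (intro continuous_on_add continuous_on_const)
    have "bounded_linear H" using H(1) linear_conv_bounded_linear by blast
    from bounded_linear.continuous_on[OF this continuous_on_snd[OF continuous_on_id]]
    show "continuous_on D (\<lambda>p. H (snd p))" .
  qed
  ultimately have "continuous_on D G" unfolding G_def by (rule continuous_on_Pair)
  then have opT: "open T" unfolding T_def by (rule continuous_open_preimage_image[OF opD _ v'(3)])
  have "G (snd c x, y) = (snd c' x, y')" using x(1) v(1) by (simp add: G_def l_def)
  then have zT: "(snd c x, y) \<in> T" using x(1,3) x'(1,3) N(2) by (simp add: T_def D_def)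
  have key: "param_map c \<psi> p = param_map c' \<psi>' (G p)" "p \<in> W" "G p \<in> W'" if p: "p \<in> T" for p
  proof -
    show "p \<in> W" "G p \<in> W'" using p by (auto simp: T_def D_def)
    obtain w \<eta> where w: "w \<in> N" "w \<in> fst c" "w \<in> fst c'" "p = (snd c w, \<eta>)"
      using p by (cases p) (auto simp: T_def D_def)
    have "w \<in> U'" using w N by blast
    then have "\<psi>' w (H \<eta> + l) = \<psi>' w (H \<eta>)" using param_kernel[OF v'(2)] l by simp
    then show "param_map c \<psi> p = param_map c' \<psi>' (G p)"
      using w v(1) v'(1) H(2)[OF w(1), of \<eta>] by (simp add: G_def)
  qed
  show ?thesis
  proof (rule that[OF opT _ _ H(1)])
    show "snd (param_chart c \<psi> W) z \<in> T" using zT x(5) by simp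
    show "T \<subseteq> snd (param_chart c \<psi> W) ` (fst (param_chart c \<psi> W) \<inter> fst (param_chart c' \<psi>' W'))"
    proof
      fix p assume "p \<in> T"
      note k = key[OF this]
      show "p \<in> snd (param_chart c \<psi> W) ` (fst (param_chart c \<psi> W) \<inter> fst (param_chart c' \<psi>' W'))"
      proof (rule rev_image_eqI)
        show "p = snd (param_chart c \<psi> W) (param_map c \<psi> p)" using param_chart(2)[OF v(4) k(2)] by (rule sym)
        show "param_map c \<psi> p \<in> fst (param_chart c \<psi> W) \<inter> fst (param_chart c' \<psi>' W')"
          unfolding param_chart(1)[OF v(4)] param_chart(1)[OF v'(4)] using k by blast
      qed
    qed
    show "transition (param_chart c \<psi> W) (param_chart c' \<psi>' W') (\<xi>, y) = (transition c c' \<xi>, H y + l)"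
      if "(\<xi>, y) \<in> T" for \<xi> y
    proof -
      note k = key[OF that]
      have "transition (param_chart c \<psi> W) (param_chart c' \<psi>' W') (\<xi>, y) = G (\<xi>, y)"
        unfolding o_apply param_chart(3)[OF v(4) k(2)] k(1) by (rule param_chart(2)[OF v'(4) k(3)])
      then show ?thesis by (simp add: G_def)
    qed
    show "T \<subseteq> snd c ` (fst c \<inter> fst c') \<times> UNIV" by (auto simp: T_def D_def)
  qed (use H(3) in blast)
qed

text \<open>By \<open>param_transition\<close> a coordinate change is locally the product of a
  coordinate change of the base and an affine map of the fibre.\<close>

lemma smooth_atlas_adapted: "smooth_atlas (adapted_charts A \<Phi>)"
proof -
  have half: "open (snd \<kappa> ` (fst \<kappa> \<inter> fst \<kappa>'))" "smooth_on (snd \<kappa> ` (fst \<kappa> \<inter> fst \<kappa>')) (transition \<kappa> \<kappa>')"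
    if \<kappa>: "\<kappa> \<in> adapted_charts A \<Phi>" "\<kappa>' \<in> adapted_charts A \<Phi>" for \<kappa> \<kappa>'
  proof -
    obtain c U \<psi> W where V: "valid c U \<psi> W" "\<kappa> = param_chart c \<psi> W" using \<kappa>(1) adapted_charts_eq by auto
    obtain c' U' \<psi>' W' where V': "valid c' U' \<psi>' W'" "\<kappa>' = param_chart c' \<psi>' W'" using \<kappa>(2) adapted_charts_eq by auto
    note v = validD[OF V(1)] and v' = validD[OF V'(1)]
    have "\<exists>T. open T \<and> p \<in> T \<and> T \<subseteq> snd \<kappa> ` (fst \<kappa> \<inter> fst \<kappa>') \<and> smooth_on T (transition \<kappa> \<kappa>')"
      if "p \<in> snd \<kappa> ` (fst \<kappa> \<inter> fst \<kappa>')" for p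
    proof -
      from that obtain z where z: "z \<in> fst \<kappa>" "z \<in> fst \<kappa>'" "p = snd \<kappa> z" by blast
      obtain T H l where T: "open T" "snd \<kappa> z \<in> T" "T \<subseteq> snd \<kappa> ` (fst \<kappa> \<inter> fst \<kappa>')" "linear H"
        "\<And>\<xi> y. (\<xi>, y) \<in> T \<Longrightarrow> transition \<kappa> \<kappa>' (\<xi>, y) = (transition c c' \<xi>, H y + l)"
        "T \<subseteq> snd c ` (fst c \<inter> fst c') \<times> UNIV"
        using param_transition[OF V(1) V'(1)] z unfolding V(2) V'(2) by metis
      have id: "smooth_on T (\<lambda>p. p)" by (rule smooth_on_ident)
      have "smooth_on T (\<lambda>p. (transition c c' (fst p), H (snd p) + l))"
      proof (intro smooth_on_Pair T(1) smooth_on_add smooth_on_const)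
        show "smooth_on T (\<lambda>p. transition c c' (fst p))"
          by (rule smooth_on_compose[where g = fst, OF T(1) transition_smooth[OF v(1) v'(1)] smooth_on_fst[OF T(1) id]])
            (use T(6) in auto)
        show "smooth_on T (\<lambda>p. H (snd p))"
          by (rule smooth_on_linear[OF T(1) T(4) smooth_on_snd[OF T(1) id]])
      qed
      then have "smooth_on T (transition \<kappa> \<kappa>')"
        by (rule smooth_on_eq[OF T(1)]) (use T(5) in \<open>auto simp del: o_apply\<close>)
      then show ?thesis using T z by blast
    qed
    note * = this
    show "open (snd \<kappa> ` (fst \<kappa> \<inter> fst \<kappa>'))"
      by (subst open_subopen) (use * in meson)
    show "smooth_on (snd \<kappa> ` (fst \<kappa> \<inter> fst \<kappa>')) (transition \<kappa> \<kappa>')"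
      by (rule smooth_on_local) (use * in meson)
  qed
  have "is_chart \<kappa>" if \<kappa>: "\<kappa> \<in> adapted_charts A \<Phi>" for \<kappa>
  proof -
    obtain c U \<psi> W where V: "valid c U \<psi> W" "\<kappa> = param_chart c \<psi> W" using \<kappa> adapted_charts_eq by auto
    note v = validD[OF V(1)]
    show ?thesis unfolding is_chart_def V(2) using param_chart(4,5)[OF v(4)] v(3) by simp
  qed
  then show ?thesis
    unfolding smooth_atlas_def compatible_def
    using half by (metis (no_types, lifting) Int_commute)
qed

end

section \<open>Quotients by bundles of lattices\<close>

lemma int_vecs_small:
  fixes l :: "real ^ 'n"
  assumes "l \<in> int_vecs" "norm l < 1"
  shows "l = 0"
proof -
  have "l $ i = 0" for i
  proof -
    have "l $ i \<in> \<int>" using assms(1) by (simp add: int_vecs_def)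
    moreover have "\<bar>l $ i\<bar> < 1" using component_le_norm_cart[of l i] assms(2) by simp
    ultimately show ?thesis using Ints_nonzero_abs_less1 by blast
  qed
  then show ?thesis by (simp add: vec_eq_iff)
qed

text \<open>What the torus bundle and its dual share before charts of the total space are
  considered: the trivializations take the lattice to the integer vectors and change by locally
  constant matrices, and \<open>lq_map\<close> identifies exactly the vectors of a fibre that differ
  by the lattice.\<close>

locale flat_lattice_bundle =
  fixes Q :: "('m, 'v::real_vector, 'z, 'n::finite) lattice_quotient"
  assumes smooth_base: "smooth_atlas (lq_base Q)"
    and triv_open: "(U, t) \<in> vtrivs (lq_bundle Q) \<Longrightarrow> openin (mtop (lq_base Q)) U"
    and triv_iso: "(U, t) \<in> vtrivs (lq_bundle Q) \<Longrightarrow> x \<in> U \<Longrightarrow> linear_iso_on (fib (lq_bundle Q) x) (t x)"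
    and triv_lattice: "(U, t) \<in> vtrivs (lq_bundle Q) \<Longrightarrow> x \<in> U \<Longrightarrow> t x ` lq_lattice Q x = int_vecs"
    and lattice_subset: "x \<in> carrier_of (lq_base Q) \<Longrightarrow> lq_lattice Q x \<subseteq> fib (lq_bundle Q) x"
    and triv_cover: "x \<in> carrier_of (lq_base Q) \<Longrightarrow> \<exists>(U, t)\<in>vtrivs (lq_bundle Q). x \<in> U"
    and triv_change: "(U, t) \<in> vtrivs (lq_bundle Q) \<Longrightarrow> (U', t') \<in> vtrivs (lq_bundle Q) \<Longrightarrow> x \<in> U \<Longrightarrow> x \<in> U' \<Longrightarrow>
      \<exists>N H. openin (mtop (lq_base Q)) N \<and> x \<in> N \<and> N \<subseteq> U \<inter> U' \<and> linear H \<and>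
        (\<forall>x\<in>N. \<forall>v\<in>fib (lq_bundle Q) x. t' x v = H (t x v))"
    and map_eq: "x \<in> carrier_of (lq_base Q) \<Longrightarrow> v \<in> fib (lq_bundle Q) x \<Longrightarrow> v' \<in> fib (lq_bundle Q) x \<Longrightarrow>
      lq_map Q (x, v) = lq_map Q (x, v') \<longleftrightarrow> v - v' \<in> lq_lattice Q x"
    and proj_map: "x \<in> carrier_of (lq_base Q) \<Longrightarrow> v \<in> fib (lq_bundle Q) x \<Longrightarrow> lq_proj Q (lq_map Q (x, v)) = x"
begin

abbreviation "A \<equiv> lq_base Q"
abbreviation "B \<equiv> lq_total Q"
abbreviation "V \<equiv> lq_bundle Q"
abbreviation tinv :: "('m \<Rightarrow> 'v \<Rightarrow> real ^ 'n) \<Rightarrow> 'm \<Rightarrow> real ^ 'n \<Rightarrow> 'v" where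
  "tinv t x \<equiv> inv_into (fib V x) (t x)"
abbreviation "ztriv t \<equiv> (\<lambda>x y. lq_map Q (x, tinv t x y))"
abbreviation "xtriv t \<equiv> (\<lambda>x y. (x, tinv t x y))"
abbreviation "X \<equiv> total_space A V"

sublocale base: atlas A
  by standard (rule smooth_base)

lemma triv_carrier: "(U, t) \<in> vtrivs V \<Longrightarrow> x \<in> U \<Longrightarrow> x \<in> carrier_of A"
  using base.openin_subset_carrier[OF triv_open] by blast

lemma tinv:
  assumes "(U, t) \<in> vtrivs V" "x \<in> U"
  shows tinv_mem: "tinv t x y \<in> fib V x" and tinv_right: "t x (tinv t x y) = y"
    and tinv_left: "v \<in> fib V x \<Longrightarrow> tinv t x (t x v) = v" and linear_tinv: "linear (tinv t x)"
  using linear_iso_on_inv_mem linear_iso_on_right linear_iso_on_left linear_iso_on_linear_inv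
    triv_iso[OF assms] by blast+

lemma tinv_change:
  assumes t: "(U, t) \<in> vtrivs V" "(U', t') \<in> vtrivs V" and x: "x \<in> U" "x \<in> U'"
  shows "\<exists>N H. openin (mtop A) N \<and> x \<in> N \<and> N \<subseteq> U \<inter> U' \<and> linear H \<and> (\<forall>x\<in>N. \<forall>y. tinv t x y = tinv t' x (H y))"
proof -
  obtain N H where N: "openin (mtop A) N" "x \<in> N" "N \<subseteq> U \<inter> U'" "linear H"
    and H: "\<And>x v. x \<in> N \<Longrightarrow> v \<in> fib V x \<Longrightarrow> t' x v = H (t x v)"
    using triv_change[OF t x] by blast
  have "tinv t x y = tinv t' x (H y)" if "x \<in> N" for x y
  proof -
    have x: "x \<in> U" "x \<in> U'" using that N by auto
    have "H y = t' x (tinv t x y)"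
      using H[OF that tinv_mem[OF t(1) x(1)]] tinv_right[OF t(1) x(1)] by simp
    then show ?thesis using tinv_left[OF t(2) x(2) tinv_mem[OF t(1) x(1)]] by simp
  qed
  then show ?thesis using N by blast
qed

lemma lattice_iff:
  assumes t: "(U, t) \<in> vtrivs V" "x \<in> U"
  shows "tinv t x y - tinv t x y' \<in> lq_lattice Q x \<longleftrightarrow> y - y' \<in> int_vecs"
proof -
  have sub: "lq_lattice Q x \<subseteq> fib V x" by (rule lattice_subset[OF triv_carrier[OF t]])
  have "tinv t x y - tinv t x y' = tinv t x (y - y')" using linear_diff[OF linear_tinv[OF t]] by simp
  moreover have "tinv t x w \<in> lq_lattice Q x \<longleftrightarrow> w \<in> int_vecs" for w
  proof
    assume "tinv t x w \<in> lq_lattice Q x"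
    then have "t x (tinv t x w) \<in> t x ` lq_lattice Q x" by (rule imageI)
    then show "w \<in> int_vecs" unfolding triv_lattice[OF t] tinv_right[OF t] .
  next
    assume "w \<in> int_vecs"
    then obtain v where v: "v \<in> lq_lattice Q x" "w = t x v" unfolding triv_lattice[OF t, symmetric] by blast
    then show "tinv t x w \<in> lq_lattice Q x" using tinv_left[OF t, of v] sub by auto
  qed
  ultimately show ?thesis by simp
qed

sublocale Z: flat_params A "(\<lambda>(U, t). (U, ztriv t)) ` vtrivs V" int_vecs
proof (unfold_locales, goal_cases)
  case (1 U \<psi>)
  then show ?case using triv_open by auto
next
  case (2 U \<psi> U' \<psi>' x x' y y')
  then obtain t t' where t: "(U, t) \<in> vtrivs V" "(U', t') \<in> vtrivs V" "\<psi> = ztriv t" "\<psi>' = ztriv t'" by auto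
  from 2(5) have "lq_proj Q (ztriv t x y) = lq_proj Q (ztriv t' x' y')" using t by simp
  then show ?case
    using 2 proj_map[OF triv_carrier[OF t(1)] tinv_mem[OF t(1)]]
      proj_map[OF triv_carrier[OF t(2)] tinv_mem[OF t(2)]] by simp
next
  case (3 U \<psi> x y y')
  then obtain t where t: "(U, t) \<in> vtrivs V" "\<psi> = ztriv t" by auto
  show ?case
    using map_eq[OF triv_carrier[OF t(1) 3(2)] tinv_mem[OF t(1) 3(2)] tinv_mem[OF t(1) 3(2)]]
      lattice_iff[OF t(1) 3(2)] t by simp
next
  case (4 l)
  then show ?case by (rule int_vecs_small)
next
  case (5 U \<psi> U' \<psi>' x)
  then obtain t t' where t: "(U, t) \<in> vtrivs V" "(U', t') \<in> vtrivs V" "\<psi> = ztriv t" "\<psi>' = ztriv t'" by auto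
  from tinv_change[OF t(1,2) 5(3,4)] show ?case unfolding t(3,4) by metis
qed

text \<open>\<open>total_splitting\<close> lives on the total space of \<open>V\<close>, which
  therefore needs adapted charts of its own; there the kernel is trivial.\<close>

sublocale X: flat_params A "(\<lambda>(U, t). (U, xtriv t)) ` vtrivs V" "{0}"
proof (unfold_locales, goal_cases)
  case (1 U \<psi>)
  then show ?case using triv_open by auto
next
  case (2 U \<psi> U' \<psi>' x x' y y')
  then show ?case by auto
next
  case (3 U \<psi> x y y')
  then obtain t where t: "(U, t) \<in> vtrivs V" "\<psi> = xtriv t" by auto
  have "tinv t x y = tinv t x y' \<longleftrightarrow> y = y'" using tinv_right[OF t(1) 3(2)] by metis
  then show ?case using t by simp
next
  case (5 U \<psi> U' \<psi>' x)
  then obtain t t' where t: "(U, t) \<in> vtrivs V" "(U', t') \<in> vtrivs V" "\<psi> = xtriv t" "\<psi>' = xtriv t'" by auto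
  from tinv_change[OF t(1,2) 5(3,4)] show ?case unfolding t(3,4) by metis
qed simp

lemma total_space_eq: "X = max_atlas (adapted_charts A ((\<lambda>(U, t). (U, xtriv t)) ` vtrivs V))"
  by (simp add: total_space_def)

sublocale tot: atlas X
  unfolding total_space_eq by standard (rule smooth_atlas_max_atlas[OF X.smooth_atlas_adapted])

end

text \<open>The atlas is only required to contain the adapted charts, because that of the torus
  bundle is given in advance, whereas that of the dual is generated by them.\<close>

locale flat_quotient = flat_lattice_bundle Q for Q :: "('m, 'v::real_vector, 'z, 'n::finite) lattice_quotient" +
  assumes smooth_total: "smooth_atlas (lq_total Q)"
    and carrier_total: "z \<in> carrier_of (lq_total Q) \<Longrightarrow>
      \<exists>x\<in>carrier_of (lq_base Q). \<exists>v\<in>fib (lq_bundle Q) x. z = lq_map Q (x, v)"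
    and adapted_total: "adapted_charts (lq_base Q)
      ((\<lambda>(U, t). (U, \<lambda>x y. lq_map Q (x, inv_into (fib (lq_bundle Q) x) (t x) y))) ` vtrivs (lq_bundle Q))
      \<subseteq> lq_total Q"
begin

sublocale total: atlas B
  by standard (rule smooth_total)

text \<open>\<open>W\<close> is small enough for the quotient map to be injective over it. The same
  \<open>W\<close> then serves on the total space of \<open>V\<close>, so that \<open>lq_map\<close>
  becomes the identity between \<open>xchart\<close> and \<open>zchart\<close>.\<close>

definition flat :: "('m, real ^ 'n) chart \<Rightarrow> 'm set \<Rightarrow> ('m \<Rightarrow> 'v \<Rightarrow> real ^ 'n) \<Rightarrow> ((real ^ 'n) \<times> (real ^ 'n)) set \<Rightarrow> bool" where
  "flat c U t W \<longleftrightarrow> (U, t) \<in> vtrivs V \<and> Z.valid c U (ztriv t) W"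

abbreviation "zchart c t W \<equiv> param_chart c (ztriv t) W"
abbreviation "xchart c t W \<equiv> param_chart c (xtriv t) W"

lemma flatD:
  assumes "flat c U t W"
  shows "(U, t) \<in> vtrivs V" "Z.valid c U (ztriv t) W" "X.valid c U (xtriv t) W"
    "c \<in> A" "open W" "zchart c t W \<in> B" "xchart c t W \<in> X"
proof -
  show 1: "(U, t) \<in> vtrivs V" and 2: "Z.valid c U (ztriv t) W" using assms by (auto simp: flat_def)
  note v = Z.validD[OF 2]
  show "c \<in> A" "open W" by (rule v)+
  have "param_map c (ztriv t) = lq_map Q \<circ> param_map c (xtriv t)" by auto
  with v(4) have "inj_on (lq_map Q \<circ> param_map c (xtriv t)) W" by simp
  then have "inj_on (param_map c (xtriv t)) W" by (rule inj_on_imageI2)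
  moreover have "(U, xtriv t) \<in> (\<lambda>(U, t). (U, xtriv t)) ` vtrivs V" using 1 by force
  ultimately show 3: "X.valid c U (xtriv t) W"
    using 2 unfolding X.valid_def Z.valid_def by blast
  show "zchart c t W \<in> B" using adapted_total 2 unfolding Z.adapted_charts_eq by blast
  have "xchart c t W \<in> adapted_charts A ((\<lambda>(U, t). (U, xtriv t)) ` vtrivs V)"
    using 3 unfolding X.adapted_charts_eq by blast
  then show "xchart c t W \<in> X"
    unfolding total_space_eq using subset_max_atlas[OF X.smooth_atlas_adapted] by blast
qed

lemma flat_exists:
  assumes "c \<in> A" "(U, t) \<in> vtrivs V" "x \<in> fst c" "x \<in> U"
  shows "\<exists>W. flat c U t W \<and> (snd c x, y) \<in> W"
  using Z.valid_exists[OF assms(1) _ assms(3,4), of "ztriv t" y] assms(2) unfolding flat_def by force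

lemma flat_mem:
  assumes "flat c U t W" "x \<in> fst c" "x \<in> U" "(snd c x, y) \<in> W"
  shows "ztriv t x y \<in> fst (zchart c t W)" "snd (zchart c t W) (ztriv t x y) = (snd c x, y)"
    "xtriv t x y \<in> fst (xchart c t W)" "snd (xchart c t W) (xtriv t x y) = (snd c x, y)"
    "lq_proj Q (ztriv t x y) = x"
  using Z.valid_mem[OF flatD(2)[OF assms(1)] assms(2,4)] X.valid_mem[OF flatD(3)[OF assms(1)] assms(2,4)]
    proj_map[OF triv_carrier[OF flatD(1)[OF assms(1)] assms(3)] tinv_mem[OF flatD(1)[OF assms(1)] assms(3)]]
  by simp_all

lemma flatE:
  assumes F: "flat c U t W" and z: "z \<in> fst (zchart c t W)"
  obtains x y where "x \<in> fst c" "x \<in> U" "(snd c x, y) \<in> W" "z = ztriv t x y"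
    "snd (zchart c t W) z = (snd c x, y)" "lq_proj Q z = x"
proof -
  obtain x y where x: "x \<in> fst c" "x \<in> U" "(snd c x, y) \<in> W" "z = ztriv t x y"
    "snd (zchart c t W) z = (snd c x, y)" by (rule Z.validE[OF flatD(2)[OF F] z])
  show ?thesis by (rule that[OF x]) (simp only: x(4) flat_mem(5)[OF F x(1-3)])
qed

lemma flat_inv:
  assumes F: "flat c U t W" and p: "(\<xi>, y) \<in> W"
  shows "chart_inv c \<xi> \<in> fst c" "chart_inv c \<xi> \<in> U" "snd c (chart_inv c \<xi>) = \<xi>"
    "chart_inv (zchart c t W) (\<xi>, y) = ztriv t (chart_inv c \<xi>) y"
    "chart_inv (xchart c t W) (\<xi>, y) = xtriv t (chart_inv c \<xi>) y"
  using Z.valid_inv[OF flatD(2)[OF F] p] X.valid_inv(4)[OF flatD(3)[OF F] p] by simp_all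

text \<open>Over the same \<open>c\<close> and \<open>t\<close> the coordinate change is a
  translation along the fibre. This makes the results of \<open>lq_D\<close> and \<open>lq_j\<close>
  independent of the chosen lifts.\<close>

lemma dtransition_translation:
  assumes F: "flat c U t W" "flat c U t W'" and z: "z \<in> fst (zchart c t W)" "z \<in> fst (zchart c t W')"
  shows "dtransition (zchart c t W) (zchart c t W') z v = v"
proof -
  obtain T H l where T: "open T" "snd (zchart c t W) z \<in> T" "linear H"
    "\<And>\<xi> y. (\<xi>, y) \<in> T \<Longrightarrow> transition (zchart c t W) (zchart c t W') (\<xi>, y) = (transition c c \<xi>, H y + l)"
    "T \<subseteq> snd c ` (fst c \<inter> fst c) \<times> UNIV" "H = (\<lambda>y. y)"
    by (rule Z.param_transition[OF flatD(2)[OF F(1)] flatD(2)[OF F(2)] z]) (use that in blast)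
  have eq: "transition (zchart c t W) (zchart c t W') p = p + (0, l)" if p: "p \<in> T" for p
  proof -
    obtain \<xi> y where p': "p = (\<xi>, y)" by force
    have "\<xi> \<in> snd c ` fst c" using T(5) p p' by auto
    then have "transition c c \<xi> = \<xi>" using flatD(4)[OF F(1)] by auto
    then show ?thesis using T(4)[of \<xi> y] p unfolding p' T(6) by (simp del: o_apply)
  qed
  have d: "((\<lambda>p. p + (0, l)) has_derivative (\<lambda>v. v)) (at (snd (zchart c t W) z))"
    by (auto intro!: derivative_eq_intros)
  show ?thesis
    by (rule frechet_derivative_eqI, rule has_derivative_cong_open[OF T(1,2) eq d])
qed

context
  fixes c U t W z x y
  assumes F: "flat c U t W"
    and x: "x \<in> fst c" "x \<in> U" "(snd c x, y) \<in> W" "z = ztriv t x y"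
begin

lemma flat_z: "z \<in> fst (zchart c t W)" "snd (zchart c t W) z = (snd c x, y)" "lq_proj Q z = x"
  unfolding x(4) by (rule flat_mem[OF F x(1-3)])+

lemma lq_dp_flat:
  assumes w: "w \<in> tangent_space B z"
  shows "lq_dp Q z w = tvec A c x (fst (w (zchart c t W)))"
proof -
  have pr: "lq_proj Q (ztriv t x y) = x" if "x \<in> U" for x y
    by (rule proj_map[OF triv_carrier[OF flatD(1)[OF F] that] tinv_mem[OF flatD(1)[OF F] that]])
  show ?thesis
    unfolding lq_dp_def x(4)
    by (rule Z.tangent_map_proj[where \<psi> = "ztriv t", OF total.atlas_axioms flatD(6)[OF F] flatD(2)[OF F] pr x(1-3)])
      (use w x(4) in simp_all)
qed

text \<open>\<open>pullback_connection\<close> differentiates in a trivialization \<open>t0\<close>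
  picked by \<open>SOME\<close>. Near \<open>x\<close> it differs from \<open>t\<close> by the
  constant matrix \<open>H\<close>, which comes out of the derivative and is undone by
  \<open>tinv t0 x (H y) = tinv t x y\<close>.\<close>

lemma total_splitting_flat:
  assumes u: "u \<in> tangent_space X (xtriv t x y)"
  shows "total_splitting Q (xtriv t x y) u = tinv t x (snd (u (xchart c t W)))"
proof -
  note t = flatD(1)[OF F]
  have ft: "flat_trivs V (lq_lattice Q) = vtrivs V"
    unfolding flat_trivs_def using triv_lattice by blast
  obtain U0 t0 where s: "(SOME (U, t). (U, t) \<in> flat_trivs V (lq_lattice Q) \<and> x \<in> U) = (U0, t0)"
    by force
  have "\<exists>P. case P of (U, t) \<Rightarrow> (U, t) \<in> vtrivs V \<and> x \<in> U" using t x(2) by auto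
  from someI_ex[OF this] have t0: "(U0, t0) \<in> vtrivs V" "x \<in> U0" using s unfolding ft by auto
  obtain N H where N: "openin (mtop A) N" "x \<in> N" "N \<subseteq> U \<inter> U0" and H: "linear H"
    "\<And>x y. x \<in> N \<Longrightarrow> tinv t x y = tinv t0 x (H y)" using tinv_change[OF t t0(1) x(2) t0(2)] by blast
  define T where "T = W \<inter> snd c ` (N \<inter> fst c) \<times> UNIV"
  have T: "open T" "snd (xchart c t W) (xtriv t x y) \<in> T"
    using flatD(5)[OF F] base.open_image_chart[OF N(1) flatD(4)[OF F]] flat_mem(4)[OF F x(1-3)] x N(2)
    by (auto simp: T_def open_Times)
  have d: "((\<lambda>a. t0 (fst a) (snd a)) \<circ> chart_inv (xchart c t W) has_derivative (\<lambda>r. H (snd r)))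
      (at (snd (xchart c t W) (xtriv t x y)))"
  proof (rule has_derivative_cong_open[OF T])
    have "bounded_linear H" using H(1) linear_conv_bounded_linear by blast
    from bounded_linear.has_derivative[OF this has_derivative_snd[OF has_derivative_ident]]
    show "((\<lambda>r. H (snd r)) has_derivative (\<lambda>r. H (snd r))) (at (snd (xchart c t W) (xtriv t x y)))" .
    fix r assume r: "r \<in> T"
    obtain \<xi> \<eta> where r': "r = (\<xi>, \<eta>)" by force
    have "(\<xi>, \<eta>) \<in> W" using r r' by (simp add: T_def)
    note f = flat_inv[OF F this]
    have n: "chart_inv c \<xi> \<in> N" using r r' flatD(4)[OF F] by (auto simp: T_def)
    then have "chart_inv c \<xi> \<in> U0" using N by blast
    then show "((\<lambda>a. t0 (fst a) (snd a)) \<circ> chart_inv (xchart c t W)) r = H (snd r)"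
      unfolding o_apply r' f(5) fst_conv snd_conv H(2)[OF n] by (rule tinv_right[OF t0(1)])
  qed
  have "differential X (\<lambda>a. t0 (fst a) (snd a)) (xtriv t x y) u = H (snd (u (xchart c t W)))"
    by (rule tot.differential_eq[OF flatD(7)[OF F] flat_mem(3)[OF F x(1-3)] u d])
  then show ?thesis
    unfolding total_splitting_def pullback_connection_def Let_def fst_conv s prod.case
    by (simp only: H(2)[OF N(2)])
qed

lemma tangent_map_flat:
  assumes u: "u \<in> tangent_space X (xtriv t x y)"
  shows "tangent_map X B (lq_map Q) (xtriv t x y) u = tvec B (zchart c t W) z (u (xchart c t W))"
proof -
  have q: "lq_map Q (chart_inv (xchart c t W) r) \<in> fst (zchart c t W)"
    "snd (zchart c t W) (lq_map Q (chart_inv (xchart c t W) r)) = r" if "r \<in> W" for r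
  proof -
    obtain \<xi> \<eta> where r: "r = (\<xi>, \<eta>)" by force
    note f = flat_inv[OF F that[unfolded r]]
    have W: "(snd c (chart_inv c \<xi>), \<eta>) \<in> W" using that r f by simp
    show "lq_map Q (chart_inv (xchart c t W) r) \<in> fst (zchart c t W)"
      "snd (zchart c t W) (lq_map Q (chart_inv (xchart c t W) r)) = r"
      using flat_mem(1,2)[OF F f(1,2) W] f(3) unfolding r f(5) by simp_all
  qed
  have d: "((snd (zchart c t W) \<circ> lq_map Q \<circ> chart_inv (xchart c t W)) has_derivative (\<lambda>r. r))
      (at (snd (xchart c t W) (xtriv t x y)))"
    by (rule has_derivative_cong_open[OF flatD(5)[OF F] _ _ has_derivative_ident])
      (use x(3) flat_mem(4)[OF F x(1-3)] q(2) in auto)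
  show ?thesis
    using tangent_map_eq[OF tot.atlas_axioms total.atlas_axioms flatD(7)[OF F] flat_mem(3)[OF F x(1-3)]
        flatD(6)[OF F] u flatD(5)[OF F] _ q(1) d] x(3,4) flat_mem(4)[OF F x(1-3)] by simp
qed


text \<open>The description by \<open>THE\<close> is met by the lift with fibre coordinate
  \<open>y\<close>. Any other lift of \<open>z\<close> lies over the same \<open>x\<close>, which is
  the projection of \<open>z\<close>, and is seen in a flat chart that differs from the given one by
  a translation, so the fibre component of \<open>w\<close> is unchanged.\<close>

lemma lq_D_flat:
  assumes w: "w \<in> tangent_space B z"
  shows "lq_D Q z w = tinv t x (snd (w (zchart c t W)))"
proof -
  note t = flatD(1)[OF F]
  let ?w = "w (zchart c t W)"
  have "(THE e. \<exists>a\<in>carrier_of X. \<exists>u\<in>tangent_space X a. lq_map Q a = z \<and>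
      tangent_map X B (lq_map Q) a u = w \<and> e = total_splitting Q a u) = tinv t x (snd ?w)"
  proof (rule the_equality)
    let ?a = "xtriv t x y" and ?u = "tvec X (xchart c t W) (xtriv t x y) ?w"
    note a = flat_mem(3)[OF F x(1-3)]
    have u: "?u \<in> tangent_space X ?a" by (rule tot.tvec_mem[OF flatD(7)[OF F] a])
    show "\<exists>a\<in>carrier_of X. \<exists>u\<in>tangent_space X a. lq_map Q a = z \<and>
      tangent_map X B (lq_map Q) a u = w \<and> tinv t x (snd ?w) = total_splitting Q a u"
    proof (intro bexI[of _ ?a] bexI[of _ ?u] conjI u)
      show "?a \<in> carrier_of X" by (rule tot.mem_carrier[OF flatD(7)[OF F] a])
      show "lq_map Q ?a = z" using x(4) by simp
      have e: "?u (xchart c t W) = ?w" by (rule tot.tvec_self[OF flatD(7)[OF F] a])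
      show "tangent_map X B (lq_map Q) ?a ?u = w"
        unfolding tangent_map_flat[OF u] e by (rule total.tvec_tangent[OF w flatD(6)[OF F] flat_z(1)])
      show "tinv t x (snd ?w) = total_splitting Q ?a ?u"
        unfolding total_splitting_flat[OF u] e ..
    qed
  next
    fix e assume "\<exists>a\<in>carrier_of X. \<exists>u\<in>tangent_space X a. lq_map Q a = z \<and>
      tangent_map X B (lq_map Q) a u = w \<and> e = total_splitting Q a u"
    then obtain a u where a: "a \<in> carrier_of X" and u: "u \<in> tangent_space X a" and qa: "lq_map Q a = z"
      and wu: "tangent_map X B (lq_map Q) a u = w" and e: "e = total_splitting Q a u" by blast
    \<comment> \<open>An arbitrary point of the total space lies in an adapted chart, hence is a
      pair \<open>(x', v)\<close> with \<open>v\<close> in the fibre over \<open>x'\<close>.\<close>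
    have "a \<in> carrier_of (adapted_charts A ((\<lambda>(U, t). (U, xtriv t)) ` vtrivs V))"
      using a unfolding total_space_eq carrier_of_max_atlas[OF X.smooth_atlas_adapted] .
    then obtain \<kappa> where \<kappa>: "\<kappa> \<in> adapted_charts A ((\<lambda>(U, t). (U, xtriv t)) ` vtrivs V)" "a \<in> fst \<kappa>"
      unfolding carrier_of_def by blast
    then obtain c' U' \<psi>' W' where V': "X.valid c' U' \<psi>' W'" "a \<in> fst (param_chart c' \<psi>' W')"
      using X.adapted_charts_eq by auto
    obtain x' y' where x': "x' \<in> U'" "a = \<psi>' x' y'" by (rule X.validE[OF V'])
    obtain t' where t': "(U', t') \<in> vtrivs V" "\<psi>' = xtriv t'" using X.validD(2)[OF V'(1)] by auto
    define v where "v = tinv t' x' y'"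
    have a': "a = (x', v)" using x' t' by (simp add: v_def)
    have "lq_proj Q z = x'"
      using qa a' proj_map[OF triv_carrier[OF t'(1) x'(1)] tinv_mem[OF t'(1) x'(1)], of y'] by (simp add: v_def)
    then have xx: "x' = x" using flat_z(3) by simp
    have v: "v \<in> fib V x" using tinv_mem[OF t'(1) x'(1)] xx by (simp add: v_def)
    have a2: "a = xtriv t x (t x v)" using a' xx tinv_left[OF t x(2) v] by simp
    obtain W2 where F2: "flat c U t W2" and W2: "(snd c x, t x v) \<in> W2"
      using flat_exists[OF flatD(4)[OF F] t x(1,2)] by blast
    have z2: "z = ztriv t x (t x v)" using qa a2 by simp
    note f2 = flat_mem[OF F2 x(1,2) W2]
    have u2: "u \<in> tangent_space X (xtriv t x (t x v))" using u a2 by simp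
    have w2: "w = tvec B (zchart c t W2) z (u (xchart c t W2))"
      using flat_quotient.tangent_map_flat[OF flat_quotient_axioms F2 x(1,2) W2 z2 u2] wu a2 by simp
    have "w (zchart c t W2) = u (xchart c t W2)"
      unfolding w2 by (rule total.tvec_self[OF flatD(6)[OF F2] f2(1)[folded z2]])
    moreover have "?w = w (zchart c t W2)"
      using total.tangent_change[OF w flatD(6)[OF F2] flatD(6)[OF F] f2(1)[folded z2] flat_z(1)]
        dtransition_translation[OF F2 F f2(1)[folded z2] flat_z(1)] by simp
    ultimately show "e = tinv t x (snd ?w)"
      using flat_quotient.total_splitting_flat[OF flat_quotient_axioms F2 x(1,2) W2 z2 u2] e a2 by simp
  qed
  then show ?thesis by (simp add: lq_D_def Let_def)
qed

text \<open>The vector \<open>e0\<close> is picked by \<open>SOME\<close> and need not have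
  coordinate \<open>y\<close>; a flat chart around its own coordinate differs from the given one by
  a translation.\<close>

lemma lq_j_flat:
  assumes e: "e \<in> fib V x"
  shows "lq_j Q z e = tvec B (zchart c t W) z (0, t x e)"
proof -
  note t = flatD(1)[OF F] and iso = triv_iso[OF flatD(1)[OF F] x(2)]
  define e0 where "e0 = (SOME e0. e0 \<in> fib V x \<and> lq_map Q (x, e0) = z)"
  have "\<exists>e0. e0 \<in> fib V x \<and> lq_map Q (x, e0) = z"
    using tinv_mem[OF t x(2)] x(4) by blast
  from someI_ex[OF this] have e0: "e0 \<in> fib V x" "lq_map Q (x, e0) = z" by (simp_all add: e0_def)
  obtain W2 where F2: "flat c U t W2" and W2: "(snd c x, t x e0) \<in> W2"
    using flat_exists[OF flatD(4)[OF F] t x(1,2)] by blast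
  have z2: "z = ztriv t x (t x e0)" using e0 tinv_left[OF t x(2)] by simp
  note zW2 = flat_mem(1)[OF F2 x(1,2) W2, folded z2]
  let ?\<gamma> = "\<lambda>\<tau>. lq_map Q (x, e0 + \<tau> *\<^sub>R e)"
  have \<gamma>: "?\<gamma> \<tau> = ztriv t x (t x e0 + \<tau> *\<^sub>R t x e)" for \<tau>
  proof -
    have "tinv t x (t x e0 + \<tau> *\<^sub>R t x e) = e0 + \<tau> *\<^sub>R e"
      using linear_add[OF linear_tinv[OF t x(2)]] linear_scale[OF linear_tinv[OF t x(2)]]
        tinv_left[OF t x(2)] e0 e by simp
    then show ?thesis by simp
  qed
  have "velocity B ?\<gamma> 0 = tvec B (zchart c t W2) (ztriv t x (t x e0)) (0, t x e)"
    unfolding \<gamma>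
    by (rule Z.velocity_param[where \<psi> = "ztriv t", OF total.atlas_axioms flatD(6)[OF F2] flatD(2)[OF F2] x(1) W2])
  also have "ztriv t x (t x e0) = z" using z2 by simp
  also have "tvec B (zchart c t W2) z (0, t x e) = tvec B (zchart c t W) z (0, t x e)"
    using total.tvec_change[OF flatD(6)[OF F2] flatD(6)[OF F] zW2 flat_z(1)]
      dtransition_translation[OF F2 F zW2 flat_z(1)] by simp
  finally show ?thesis
    unfolding lq_j_def Let_def flat_z(3) e0_def[symmetric] .
qed

text \<open>Prescribing \<open>lq_dp\<close> and \<open>lq_D\<close> fixes the base half and the
  fibre half of the coordinates of a tangent vector, which gives existence and uniqueness.\<close>

lemma lq_alpha_flat:
  assumes a: "a \<in> tangent_space A x"
  shows "lq_alpha Q z a = tvec B (zchart c t W) z (a c, 0)"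
  unfolding lq_alpha_def
proof (rule the_equality)
  note k = flatD(6)[OF F] flat_z(1)
  note t = flatD(1)[OF F] x(2)
  let ?w = "tvec B (zchart c t W) z (a c, 0)"
  have w: "?w \<in> tangent_space B z" by (rule total.tvec_mem[OF k])
  show "?w \<in> tangent_space B z \<and> lq_dp Q z ?w = a \<and> lq_D Q z ?w = 0"
    using w lq_dp_flat[OF w] lq_D_flat[OF w] total.tvec_self[OF k]
      base.tvec_tangent[OF a flatD(4)[OF F] x(1)] linear_0[OF linear_tinv[OF t]] by simp
  fix w' assume "w' \<in> tangent_space B z \<and> lq_dp Q z w' = a \<and> lq_D Q z w' = 0"
  then have w': "w' \<in> tangent_space B z" "lq_dp Q z w' = a" "lq_D Q z w' = 0" by auto
  have "tvec A c x (fst (w' (zchart c t W))) = a" using lq_dp_flat[OF w'(1)] w'(2) by simp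
  then have "tvec A c x (fst (w' (zchart c t W))) c = a c" by (rule arg_cong)
  then have 1: "fst (w' (zchart c t W)) = a c"
    unfolding base.tvec_self[OF flatD(4)[OF F] x(1)] .
  have "tinv t x (snd (w' (zchart c t W))) = tinv t x 0"
    using lq_D_flat[OF w'(1)] w'(3) linear_0[OF linear_tinv[OF t]] by simp
  then have "t x (tinv t x (snd (w' (zchart c t W)))) = t x (tinv t x 0)" by (rule arg_cong)
  then have 2: "snd (w' (zchart c t W)) = 0" unfolding tinv_right[OF t] .
  show "w' = ?w"
    by (rule total.tangent_eqI[OF w'(1) w k]) (simp add: total.tvec_self[OF k] prod_eq_iff 1 2)
qed

end

end

section \<open>Semi-flat structures in flat coordinates\<close>

definition quad_coord ::
  "('m, 'd::euclidean_space) chart set \<Rightarrow> ('m, 'd) chart \<Rightarrow> 'm \<Rightarrow> 'v::real_vector set \<Rightarrow>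
   ('v \<Rightarrow> 'e::euclidean_space) \<Rightarrow> ('v, ('m, 'd) tvector) quad \<Rightarrow> 'e \<times> 'd \<times> 'e \<times> 'd" where
  "quad_coord A c x S \<tau> = (\<lambda>(v, a, f, h).
     (\<tau> v, a c, \<Sum>b\<in>Basis. f (inv_into S \<tau> b) *\<^sub>R b, \<Sum>b\<in>Basis. h (tvec A c x b) *\<^sub>R b))"

text \<open>Coordinates \<open>(x, y)\<close> on the base and the fibre are listed fibre first in a \<open>quad\<close>.\<close>

definition shuffle :: "('d \<times> 'e) \<times> ('d \<times> 'e) \<Rightarrow> 'e \<times> 'd \<times> 'e \<times> 'd" where
  "shuffle = (\<lambda>((x, y), (p, q)). (y, x, q, p))"

definition unshuffle :: "'e \<times> 'd \<times> 'e \<times> 'd \<Rightarrow> ('d \<times> 'e) \<times> ('d \<times> 'e)" where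
  "unshuffle = (\<lambda>(y, x, q, p). ((x, y), (p, q)))"

lemma shuffle_unshuffle [simp]: "shuffle (unshuffle s) = s" "unshuffle (shuffle u) = u"
  by (auto simp: shuffle_def unshuffle_def split: prod.split)

lemma linear_unshuffle:
  "linear (unshuffle :: 'e::real_vector \<times> 'd::real_vector \<times> 'e \<times> 'd \<Rightarrow> _)"
  by (rule linearI) (auto simp: unshuffle_def split: prod.split)

lemma (in atlas) linear_iso_on_quad:
  assumes c: "c \<in> A" "x \<in> fst c" and iso: "linear_iso_on S \<tau>"
  shows "linear_iso_on (S \<times> tangent_space A x \<times> dual_space S \<times> dual_space (tangent_space A x))
     (quad_coord A c x S \<tau>)"
proof -
  note T = linear_iso_on_tangent[OF c]
  have eq: "quad_coord A c x S \<tau> = (\<lambda>(v, s). (\<tau> v, (\<lambda>(a, s). (a c, (\<lambda>(f, h). (\<Sum>b\<in>Basis. f (inv_into S \<tau> b) *\<^sub>R b,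
      \<Sum>b\<in>Basis. h (inv_into (tangent_space A x) (\<lambda>v. v c) b) *\<^sub>R b)) s)) s))"
    by (auto simp: quad_coord_def inv_into_tangent[OF c] split: prod.split)
  show ?thesis
    unfolding eq by (intro linear_iso_on_Times(1) iso T linear_iso_on_dual(1))
qed

lemma quad_fib_eq: "quad_fib V (tangent_bundle A) x
    = fib V x \<times> tangent_space A x \<times> dual_space (fib V x) \<times> dual_space (tangent_space A x)"
  by (simp add: quad_fib_def fib_tangent)

lemma sum_Basis_prod:
  fixes F :: "'a::euclidean_space \<times> 'b::euclidean_space \<Rightarrow> 'c::comm_monoid_add"
  shows "(\<Sum>b\<in>Basis. F b) = (\<Sum>b\<in>Basis. F (b, 0)) + (\<Sum>b\<in>Basis. F (0, b))"
  unfolding Basis_prod_def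
  by (subst sum.union_disjoint) (auto simp: sum.reindex inj_on_def)

context flat_lattice_bundle
begin

abbreviation "qcoord c t x \<equiv> quad_coord A c x (fib V x) (t x)"
abbreviation "qfib \<equiv> quad_fib V (tangent_bundle A)"

lemma linear_iso_on_qcoord:
  assumes "c \<in> A" "(U, t) \<in> vtrivs V" "x \<in> fst c" "x \<in> U"
  shows "linear_iso_on (qfib x) (qcoord c t x)"
  unfolding quad_fib_eq by (rule base.linear_iso_on_quad[OF assms(1,3) triv_iso[OF assms(2,4)]])

text \<open>A function of the base coordinate alone; that no fibre coordinate enters is what makes
  the derivatives along the fibre vanish.\<close>

definition endo_coord ::
  "('m \<Rightarrow> ('v, ('m, real ^ 'n) tvector) quad \<Rightarrow> ('v, ('m, real ^ 'n) tvector) quad) \<Rightarrow>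
   ('m, real ^ 'n) chart \<Rightarrow> ('m \<Rightarrow> 'v \<Rightarrow> real ^ 'n) \<Rightarrow> real ^ 'n \<Rightarrow>
   (real ^ 'n) \<times> (real ^ 'n) \<times> (real ^ 'n) \<times> (real ^ 'n) \<Rightarrow>
   (real ^ 'n) \<times> (real ^ 'n) \<times> (real ^ 'n) \<times> (real ^ 'n)" where
  "endo_coord K c t \<xi> s =
     (let x = chart_inv c \<xi> in qcoord c t x (K x (inv_into (qfib x) (qcoord c t x) s)))"

lemma endo_coord:
  assumes "c \<in> A" "(U, t) \<in> vtrivs V" "x \<in> fst c" "x \<in> U" "s \<in> qfib x"
  shows "qcoord c t x (K x s) = endo_coord K c t (snd c x) (qcoord c t x s)"
  using linear_iso_on_left[OF linear_iso_on_qcoord[OF assms(1-4)] assms(5)] base.inv_left[OF assms(1,3)]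
  by (simp add: endo_coord_def)

end

context flat_quotient
begin

context
  fixes c U t W z x y
  assumes F: "flat c U t W"
    and x: "x \<in> fst c" "x \<in> U" "(snd c x, y) \<in> W" "z = ztriv t x y"
begin

text \<open>In a flat chart \<open>lq_D\<close> and \<open>lq_dp\<close> read off the two halves of
  a tangent vector, while \<open>lq_j\<close> and \<open>lq_alpha\<close> are the two coordinate
  inclusions, whose transposes read off the two halves of a covector. So \<open>lq_F\<close> merely
  reorders coordinates.\<close>

lemma
  assumes u: "u \<in> fib (double_tangent B) z"
  shows lq_F_mem: "lq_F Q z u \<in> qfib x"
    and lq_F_coord: "qcoord c t x (lq_F Q z u) = shuffle (double_coord B (zchart c t W) z u)"
proof -
  note zz = flat_z[OF F x] and c = flatD(4)[OF F] x(1) and t = flatD(1)[OF F] x(2)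
  note k = flatD(6)[OF F] zz(1)
  obtain w \<zeta> where u': "u = (w, \<zeta>)" by force
  have w: "w \<in> tangent_space B z" and \<zeta>: "\<zeta> \<in> dual_space (tangent_space B z)"
    using u u' by (auto simp: fib_double fib_tangent)
  note D = lq_D_flat[OF F x w] and dp = lq_dp_flat[OF F x w] and j = lq_j_flat[OF F x]
    and \<alpha> = lq_alpha_flat[OF F x]
  let ?s = "snd (double_coord B (zchart c t W) z u)"
  have \<zeta>v: "\<zeta> (tvec B (zchart c t W) z b) = ?s \<bullet> b" for b
    using total.one_form_coord[OF k u total.tvec_mem[OF k]] u' total.tvec_self[OF k] by simp
  define f where "f = transpose_on (fib V x) (lq_j Q z) \<zeta>"
  define h where "h = transpose_on (tangent_space A x) (lq_alpha Q z) \<zeta>"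
  have f: "f e = ?s \<bullet> (0, t x e)" if "e \<in> fib V x" for e
    using that j[OF that] \<zeta>v by (simp add: f_def transpose_on_def)
  have h: "h a = ?s \<bullet> (a c, 0)" if "a \<in> tangent_space A x" for a
    using that \<alpha>[OF that] \<zeta>v by (simp add: h_def transpose_on_def)
  have Feq: "lq_F Q z u = (tinv t x (snd (w (zchart c t W))), tvec A c x (fst (w (zchart c t W))), f, h)"
    by (simp add: lq_F_def u' D dp zz(3) f_def h_def)
  note iso = triv_iso[OF t] and isoT = base.linear_iso_on_tangent[OF c]
  have "f \<in> dual_space (fib V x)"
    unfolding dual_space_def
    using linear_iso_on_subspace[OF iso] f linear_iso_on_add[OF iso] linear_iso_on_scale[OF iso]
    by (auto simp: subspace_add subspace_scale inner_prod_def inner_add_right f_def[unfolded transpose_on_def])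
  moreover have "h \<in> dual_space (tangent_space A x)"
    unfolding dual_space_def
    using linear_iso_on_subspace[OF isoT] h linear_iso_on_add[OF isoT] linear_iso_on_scale[OF isoT]
    by (auto simp: subspace_add subspace_scale inner_prod_def inner_add_right h_def[unfolded transpose_on_def])
  ultimately show "lq_F Q z u \<in> qfib x"
    unfolding Feq quad_fib_eq using tinv_mem[OF t] base.tvec_mem[OF c] by simp
  have 1: "(\<Sum>b\<in>Basis. f (tinv t x b) *\<^sub>R b) = snd ?s"
    by (simp add: f[OF tinv_mem[OF t]] tinv_right[OF t] inner_prod_def euclidean_representation)
  have 2: "(\<Sum>b\<in>Basis. h (tvec A c x b) *\<^sub>R b) = fst ?s"
    by (simp add: h[OF base.tvec_mem[OF c]] base.tvec_self[OF c] inner_prod_def euclidean_representation)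
  have 3: "fst (double_coord B (zchart c t W) z u) = w (zchart c t W)"
    by (simp add: double_coord_def u')
  show "qcoord c t x (lq_F Q z u) = shuffle (double_coord B (zchart c t W) z u)"
    unfolding Feq quad_coord_def prod.case 1 2 tinv_right[OF t] base.tvec_self[OF c] 3[symmetric]
    by (simp add: shuffle_def split_beta)
qed

text \<open>\<open>lq_structure\<close> inverts \<open>lq_F\<close> by \<open>inv_into\<close>;
  injectivity comes from the coordinate form of \<open>lq_F\<close>, and the preimage is found by
  writing down its coordinates.\<close>

lemma lq_structure_flat:
  assumes K: "K x ` qfib x \<subseteq> qfib x" "\<And>s. s \<in> qfib x \<Longrightarrow> qcoord c t x (K x s) = k (qcoord c t x s)"
    and u: "u \<in> fib (double_tangent B) z"
  shows "lq_structure Q K z u \<in> fib (double_tangent B) z"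
    and "double_coord B (zchart c t W) z (lq_structure Q K z u)
      = unshuffle (k (shuffle (double_coord B (zchart c t W) z u)))"
proof -
  note zz = flat_z[OF F x]
  note kk = flatD(6)[OF F] zz(1)
  note iso = linear_iso_on_qcoord[OF flatD(4)[OF F] flatD(1)[OF F] x(1,2)]
  let ?r = "unshuffle (k (shuffle (double_coord B (zchart c t W) z u)))"
  let ?u = "double_vec B (zchart c t W) z ?r"
  have u': "?u \<in> fib (double_tangent B) z" by (rule total.double_vec_mem[OF kk])
  have inj: "inj_on (lq_F Q z) (fib (double_tangent B) z)"
  proof (rule inj_onI)
    fix a b assume ab: "a \<in> fib (double_tangent B) z" "b \<in> fib (double_tangent B) z" "lq_F Q z a = lq_F Q z b"
    then have "unshuffle (shuffle (double_coord B (zchart c t W) z a))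
        = unshuffle (shuffle (double_coord B (zchart c t W) z b))"
      using lq_F_coord[OF ab(1)] lq_F_coord[OF ab(2)] by simp
    then show "a = b" using total.double_coord_eqI[OF kk ab(1,2)] by simp
  qed
  have "lq_F Q z ?u = K x (lq_F Q z u)"
  proof (rule linear_iso_on_eqI[OF iso lq_F_mem[OF u']])
    show "K x (lq_F Q z u) \<in> qfib x" using K(1) lq_F_mem[OF u] by blast
    show "qcoord c t x (lq_F Q z ?u) = qcoord c t x (K x (lq_F Q z u))"
      unfolding lq_F_coord[OF u'] K(2)[OF lq_F_mem[OF u]] lq_F_coord[OF u] total.double_coord_vec[OF kk]
      by simp
  qed
  then have "lq_structure Q K z u = ?u"
    unfolding lq_structure_def zz(3) by (rule inv_into_f_eq[OF inj u'])
  then show "lq_structure Q K z u \<in> fib (double_tangent B) z"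
    "double_coord B (zchart c t W) z (lq_structure Q K z u) = ?r"
    using u' total.double_coord_vec[OF kk] by simp_all
qed

end

text \<open>The covering family consists of all flat charts. Each model point
  \<open>(snd c x, y)\<close> lies in one of them by \<open>flat_exists\<close>, which justifies the
  quantifier over all \<open>y\<close> and yields a criterion free of charts of the total
  space.\<close>

theorem integrable_lq_structure_iff:
  assumes K: "\<And>x. x \<in> carrier_of A \<Longrightarrow> K x ` qfib x \<subseteq> qfib x"
    and k: "\<And>c U t x. c \<in> A \<Longrightarrow> (U, t) \<in> vtrivs V \<Longrightarrow> x \<in> fst c \<Longrightarrow> x \<in> U \<Longrightarrow>
      pairing_complex (\<lambda>u. unshuffle (endo_coord K c t (snd c x) (shuffle u)))"
    and smooth_k: "\<And>c U t s. c \<in> A \<Longrightarrow> (U, t) \<in> vtrivs V \<Longrightarrow>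
      smooth_on (snd c ` (fst c \<inter> U)) (\<lambda>\<xi>. endo_coord K c t \<xi> s)"
  shows "integrable_gcs B (lq_structure Q K) \<longleftrightarrow>
    (\<forall>c\<in>A. \<forall>(U, t)\<in>vtrivs V. \<forall>x\<in>fst c \<inter> U. \<forall>y u v.
      nijenhuis (\<lambda>p u. unshuffle (endo_coord K c t (fst p) (shuffle u))) (snd c x, y) u v = 0)"
proof -
  let ?k = "\<lambda>c t (p :: (real ^ 'n) \<times> (real ^ 'n)) u. unshuffle (endo_coord K c t (fst p) (shuffle u))"
  define C where "C = {(zchart c t W, ?k c t) | c U t W. flat c U t W}"
  have CD: "\<exists>c U t W. flat c U t W \<and> \<kappa> = zchart c t W \<and> k' = ?k c t" if "(\<kappa>, k') \<in> C" for \<kappa> k'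
    using that unfolding C_def by blast
  have img: "snd (zchart c t W) ` fst (zchart c t W) = W" if "flat c U t W" for c U t W
    by (rule param_chart(4)[OF Z.validD(4)[OF flatD(2)[OF that]]])
  have 1: "\<kappa> \<in> B" if "(\<kappa>, k') \<in> C" for \<kappa> k' using CD[OF that] flatD(6) by blast
  have 2: "\<exists>(\<kappa>, k')\<in>C. z \<in> fst \<kappa>" if z: "z \<in> carrier_of B" for z
  proof -
    obtain x v where x: "x \<in> carrier_of A" "v \<in> fib V x" "z = lq_map Q (x, v)" using carrier_total[OF z] by blast
    obtain U t where t: "(U, t) \<in> vtrivs V" "x \<in> U" using triv_cover[OF x(1)] by blast
    let ?c = "chart_at A x"
    note c = base.chart_at[OF x(1)]
    obtain W where F: "flat ?c U t W" "(snd ?c x, t x v) \<in> W" using flat_exists[OF c(1) t(1) c(2) t(2)] by blast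
    have "z \<in> fst (zchart ?c t W)"
      using flat_mem(1)[OF F(1) c(2) t(2) F(2)] tinv_left[OF t x(2)] x(3) by simp
    moreover have "(zchart ?c t W, ?k ?c t) \<in> C" unfolding C_def using F(1) by blast
    ultimately show ?thesis by blast
  qed
  have 34: "lq_structure Q K z u \<in> fib (double_tangent B) z"
      "double_coord B \<kappa> z (lq_structure Q K z u) = k' (snd \<kappa> z) (double_coord B \<kappa> z u)"
    if C: "(\<kappa>, k') \<in> C" and z: "z \<in> fst \<kappa>" and u: "u \<in> fib (double_tangent B) z" for \<kappa> k' z u
  proof -
    obtain c U t W where F: "flat c U t W" "\<kappa> = zchart c t W" "k' = ?k c t" using CD[OF C] by blast
    obtain x y where x: "x \<in> fst c" "x \<in> U" "(snd c x, y) \<in> W" "z = ztriv t x y"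
      "snd (zchart c t W) z = (snd c x, y)" by (rule flatE[OF F(1) z[unfolded F(2)]])
    note st = lq_structure_flat[where K = K and k = "endo_coord K c t (snd c x)", OF F(1) x(1-4) K[OF base.mem_carrier[OF flatD(4)[OF F(1)] x(1)]]
        endo_coord[OF flatD(4,1)[OF F(1)] x(1,2)] u]
    show "lq_structure Q K z u \<in> fib (double_tangent B) z" by (rule st(1))
    show "double_coord B \<kappa> z (lq_structure Q K z u) = k' (snd \<kappa> z) (double_coord B \<kappa> z u)"
      unfolding F(2,3) x(5) fst_conv by (rule st(2))
  qed
  have 5: "pairing_complex (k' p)" if C: "(\<kappa>, k') \<in> C" and p: "p \<in> snd \<kappa> ` fst \<kappa>" for \<kappa> k' p
  proof -
    obtain c U t W where F: "flat c U t W" "\<kappa> = zchart c t W" "k' = ?k c t" using CD[OF C] by blast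
    have "(fst p, snd p) \<in> W" using p img[OF F(1)] F(2) by simp
    note f = flat_inv[OF F(1) this]
    show ?thesis using k[OF flatD(4,1)[OF F(1)] f(1,2)] unfolding f(3) F(3) .
  qed
  have 6: "smooth_on (snd \<kappa> ` fst \<kappa>) (\<lambda>p. k' p a)" if C: "(\<kappa>, k') \<in> C" for \<kappa> k' a
  proof -
    obtain c U t W where F: "flat c U t W" "\<kappa> = zchart c t W" "k' = ?k c t" using CD[OF C] by blast
    note op = flatD(5)[OF F(1)]
    have sub: "fst ` W \<subseteq> snd c ` (fst c \<inter> U)"
      using flatD(2)[OF F(1)] unfolding Z.valid_def by auto
    show ?thesis
      unfolding F(2,3) img[OF F(1)]
      by (intro smooth_on_linear[OF op linear_unshuffle]
          smooth_on_compose[OF op smooth_k[OF flatD(4,1)[OF F(1)]] smooth_on_fst[OF op smooth_on_ident] sub])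
  qed
  have "integrable_gcs B (lq_structure Q K) \<longleftrightarrow>
      (\<forall>(\<kappa>, k')\<in>C. \<forall>p\<in>snd \<kappa> ` fst \<kappa>. \<forall>u v. nijenhuis k' p u v = 0)"
    by (rule total.integrable_gcs_iff_nijenhuis[where C = C and J = "lq_structure Q K"])
      (fact 1 2 34 5 6)+
  also have "\<dots> \<longleftrightarrow> (\<forall>c\<in>A. \<forall>(U, t)\<in>vtrivs V. \<forall>x\<in>fst c \<inter> U. \<forall>y u v. nijenhuis (?k c t) (snd c x, y) u v = 0)"
  proof
    assume L: "\<forall>(\<kappa>, k')\<in>C. \<forall>p\<in>snd \<kappa> ` fst \<kappa>. \<forall>u v. nijenhuis k' p u v = 0"
    have "nijenhuis (?k c t) (snd c x, y) u v = 0"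
      if ctx: "c \<in> A" "(U, t) \<in> vtrivs V" "x \<in> fst c" "x \<in> U" for c U t x y u v
    proof -
      obtain W where F: "flat c U t W" "(snd c x, y) \<in> W" using flat_exists[OF ctx] by blast
      then have "(zchart c t W, ?k c t) \<in> C" unfolding C_def by blast
      then show ?thesis using L F(2) img[OF F(1)] by blast
    qed
    then show "\<forall>c\<in>A. \<forall>(U, t)\<in>vtrivs V. \<forall>x\<in>fst c \<inter> U. \<forall>y u v. nijenhuis (?k c t) (snd c x, y) u v = 0" by blast
  next
    assume R: "\<forall>c\<in>A. \<forall>(U, t)\<in>vtrivs V. \<forall>x\<in>fst c \<inter> U. \<forall>y u v. nijenhuis (?k c t) (snd c x, y) u v = 0"
    have "nijenhuis k' p u v = 0" if C: "(\<kappa>, k') \<in> C" and p: "p \<in> snd \<kappa> ` fst \<kappa>" for \<kappa> k' p u v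
    proof -
      obtain c U t W where F: "flat c U t W" "\<kappa> = zchart c t W" "k' = ?k c t" using CD[OF C] by blast
      have "(fst p, snd p) \<in> W" using p img[OF F(1)] F(2) by simp
      note f = flat_inv[OF F(1) this]
      have "nijenhuis (?k c t) (snd c (chart_inv c (fst p)), snd p) u v = 0"
        using R flatD(4,1)[OF F(1)] f(1,2) by blast
      then show ?thesis unfolding f(3) F(3) by simp
    qed
    then show "\<forall>(\<kappa>, k')\<in>C. \<forall>p\<in>snd \<kappa> ` fst \<kappa>. \<forall>u v. nijenhuis k' p u v = 0" by blast
  qed
  finally show ?thesis .
qed

end

text \<open>The coordinate form of \<open>tau\<close>; \<open>swap_fibre\<close> is the same
  exchange in the ordering used by charts of the total space, that is, the permutation
  \<open>R\<close>.\<close>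

definition swap_quad :: "'e \<times> 'd \<times> 'e \<times> 'd \<Rightarrow> 'e \<times> 'd \<times> 'e \<times> 'd" where
  "swap_quad = (\<lambda>(v, a, f, g). (f, a, v, g))"

definition swap_fibre :: "('d \<times> 'e) \<times> ('d \<times> 'e) \<Rightarrow> ('d \<times> 'e) \<times> ('d \<times> 'e)" where
  "swap_fibre = (\<lambda>((x, y), (p, q)). ((x, q), (p, y)))"

lemma swap_fibre_involution [simp]: "swap_fibre (swap_fibre u) = u"
  by (simp add: swap_fibre_def split_beta)

lemma swap_quad_shuffle: "swap_quad (shuffle u) = shuffle (swap_fibre u)"
  "unshuffle (swap_quad s) = swap_fibre (unshuffle s)"
  by (simp_all add: swap_quad_def shuffle_def unshuffle_def swap_fibre_def split_beta)

lemma linear_swap_fibre: "linear (swap_fibre :: ('d::real_vector \<times> 'e::real_vector) \<times> _ \<Rightarrow> _)"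
  by (rule linearI) (simp_all add: swap_fibre_def split_beta)

lemma linear_swap_quad: "linear (swap_quad :: 'e::real_vector \<times> 'd::real_vector \<times> _ \<Rightarrow> _)"
  by (rule linearI) (simp_all add: swap_quad_def split_beta)

lemma pairing_swap_fibre: "pairing (swap_fibre a) (swap_fibre b) = pairing a b"
  by (simp add: pairing_def swap_fibre_def split_beta inner_prod_def inner_commute)

lemma pairing_complex_swap:
  assumes "pairing_complex K"
  shows "pairing_complex (\<lambda>u. swap_fibre (K (swap_fibre u)))"
proof -
  note K = pairing_complexD[OF assms]
  have "linear (swap_fibre \<circ> K \<circ> swap_fibre)"
    by (intro linear_compose K linear_swap_fibre)
  moreover have "swap_fibre (- a) = - swap_fibre a" for a :: "('a \<times> 'b) \<times> ('a \<times> 'b)"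
    using linear_neg[OF linear_swap_fibre] .
  ultimately show ?thesis
    unfolding pairing_complex_def by (simp add: o_def pairing_swap_fibre K)
qed

text \<open>Only base derivatives occur, and exchanging the fibre directions with their duals preserves
  the pairing: this is why the mirror has the same Nijenhuis expression.\<close>

lemma half_bracket_swap:
  fixes u :: "('d::euclidean_space \<times> 'e::euclidean_space) \<times> ('d \<times> 'e)"
  assumes "linear h"
  shows "half_bracket (swap_fibre u) (\<lambda>w. swap_fibre (h (fst w))) = swap_fibre (half_bracket u (\<lambda>w. h (fst w)))"
proof -
  let ?s = "\<Sum>b\<in>Basis. pairing u (h (fst b)) *\<^sub>R b :: 'd \<times> 'e"
  \<comment> \<open>Basis vectors along the fibre have \<open>fst b = 0\<close>, so the covector has
    base components only, and these are fixed by the swap.\<close>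
  have "snd ?s = 0"
    using linear_0[OF assms] by (simp add: sum_Basis_prod snd_sum pairing_def)
  then have "swap_fibre (0, ?s) = (0, ?s)" by (simp add: swap_fibre_def split_beta prod_eq_iff)
  \<comment> \<open>The other place where \<open>u\<close> enters is the direction of
    differentiation, whose base part the swap preserves.\<close>
  moreover have "fst (fst (swap_fibre u)) = fst (fst u)" by (simp add: swap_fibre_def split_beta)
  ultimately show ?thesis
    unfolding half_bracket_def pairing_swap_fibre
      linear_diff[OF linear_swap_fibre] linear_scale[OF linear_swap_fibre] by simp
qed

lemma nijenhuis_swap:
  fixes g :: "'d::euclidean_space \<Rightarrow> ('d \<times> 'e::euclidean_space) \<times> ('d \<times> 'e) \<Rightarrow> _"
  assumes S: "open S" "\<xi> \<in> S" and g: "\<And>s. smooth_on S (\<lambda>\<xi>. g \<xi> s)"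
  shows "nijenhuis (\<lambda>p u. swap_fibre (g (fst p) (swap_fibre u))) (\<xi>, y) (swap_fibre u) (swap_fibre v)
    = swap_fibre (nijenhuis (\<lambda>p. g (fst p)) (\<xi>, y) u v)"
proof -
  note lin = linear_swap_fibre
  let ?g = "\<lambda>v. frechet_derivative (\<lambda>\<xi>. g \<xi> v) (at \<xi>)"
  have "((\<lambda>p. g (fst p) v) has_derivative (\<lambda>w. ?g v (fst w))) (at (\<xi>, y))" for v
    by (rule has_derivative_compose[where f = fst, OF has_derivative_fst[OF has_derivative_ident]])
      (use smooth_on_has_derivative[OF g S(2)] in simp)
  note d = this and d' = bounded_linear.has_derivative[OF linear_conv_bounded_linear[THEN iffD1, OF lin] this]
  have D: "frechet_derivative (\<lambda>p. g (fst p) v) (at (\<xi>, y)) = (\<lambda>w. ?g v (fst w))"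
    "frechet_derivative (\<lambda>p. swap_fibre (g (fst p) v)) (at (\<xi>, y)) = (\<lambda>w. swap_fibre (?g v (fst w)))" for v
    using frechet_derivative_at[OF d] frechet_derivative_at[OF d'] by simp_all
  have h: "half_bracket (swap_fibre u) (\<lambda>w. swap_fibre (?g v (fst w)))
      = swap_fibre (half_bracket u (\<lambda>w. ?g v (fst w)))" for u v
    by (rule half_bracket_swap[OF smooth_on_linear_derivative[OF g S(2)]])
  show ?thesis
    unfolding nijenhuis_def nijenhuis_half_def Let_def swap_fibre_involution D h fst_conv
    by (simp add: linear_diff[OF lin] linear_neg[OF lin])
qed

section \<open>Dual lattices and flat trivializations of torus bundles\<close>

lemma int_vecs_inner:
  fixes a b :: "real ^ 'n"
  assumes "a \<in> int_vecs" "b \<in> int_vecs"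
  shows "a \<bullet> b \<in> \<int>"
  using assms unfolding inner_vec_def int_vecs_def by (auto intro!: Ints_sum)

lemma axis_int_vecs: "axis i 1 \<in> int_vecs"
  by (simp add: int_vecs_def axis_def)

context flat_lattice_bundle
begin

abbreviation "DQ \<equiv> quotient_by_lattice A (dual_bundle V) (\<lambda>x. dual_lattice (fib V x) (lq_lattice Q x))"
abbreviation "dtriv t \<equiv> (\<lambda>x h. \<Sum>b\<in>Basis. h (tinv t x b) *\<^sub>R b)"

lemma DQ_simps [simp]:
  "lq_base DQ = A" "lq_bundle DQ = dual_bundle V" "lq_proj DQ = fst"
  "lq_lattice DQ = (\<lambda>x. dual_lattice (fib V x) (lq_lattice Q x))"
  "lq_map DQ = coset_map (dual_bundle V) (\<lambda>x. dual_lattice (fib V x) (lq_lattice Q x))"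
  by (simp_all add: quotient_by_lattice_def)

lemma fib_dual: "fib (dual_bundle V) x = dual_space (fib V x)"
  by (simp add: dual_bundle_def)

lemma vtrivs_dual: "vtrivs (dual_bundle V) = (\<lambda>(U, t). (U, dtriv t)) ` vtrivs V"
  by (simp add: dual_bundle_def)

context
  fixes U t x
  assumes t: "(U, t) \<in> vtrivs V" "x \<in> U"
begin

lemma dtriv_iso: "linear_iso_on (dual_space (fib V x)) (dtriv t x)"
  and inv_into_dtriv: "inv_into (dual_space (fib V x)) (dtriv t x) = (\<lambda>e v. if v \<in> fib V x then e \<bullet> t x v else 0)"
  using linear_iso_on_dual[OF triv_iso[OF t]] by blast+

lemma dual_apply: "h \<in> dual_space (fib V x) \<Longrightarrow> v \<in> fib V x \<Longrightarrow> h v = dtriv t x h \<bullet> t x v"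
  using fun_cong[OF linear_iso_on_left[OF dtriv_iso], of h v] by (simp add: inv_into_dtriv)

text \<open>The lattice of integer vectors is self-dual: pairing with the \<open>axis\<close>
  vectors, which come from lattice vectors, reads off the components of \<open>e\<close>;
  conversely, inner products of integer vectors are integers.\<close>

lemma dtriv_lattice: "dtriv t x ` dual_lattice (fib V x) (lq_lattice Q x) = int_vecs"
proof (intro equalityI subsetI)
  note sub = lattice_subset[OF triv_carrier[OF t]]
  fix e assume "e \<in> dtriv t x ` dual_lattice (fib V x) (lq_lattice Q x)"
  then obtain h where h: "h \<in> dual_space (fib V x)" "\<And>v. v \<in> lq_lattice Q x \<Longrightarrow> h v \<in> \<int>" "e = dtriv t x h"
    by (auto simp: dual_lattice_def)
  have "e $ i \<in> \<int>" for i
  proof -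
    have "axis i 1 \<in> t x ` lq_lattice Q x" unfolding triv_lattice[OF t] by (rule axis_int_vecs)
    then obtain v where v: "v \<in> lq_lattice Q x" "t x v = axis i 1" by auto
    have "e $ i = e \<bullet> t x v" unfolding v(2) by (rule cart_eq_inner_axis)
    also have "\<dots> = h v" unfolding h(3) using dual_apply[OF h(1)] v(1) sub by auto
    finally show ?thesis using h(2)[OF v(1)] by simp
  qed
  then show "e \<in> int_vecs" by (simp add: int_vecs_def)
next
  note sub = lattice_subset[OF triv_carrier[OF t]]
  fix e :: "real ^ 'n" assume e: "e \<in> int_vecs"
  let ?h = "\<lambda>v. if v \<in> fib V x then e \<bullet> t x v else 0"
  have h: "?h \<in> dual_space (fib V x)" "dtriv t x ?h = e"
    using linear_iso_on_inv_mem[OF dtriv_iso, of e] linear_iso_on_right[OF dtriv_iso, of e]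
    unfolding inv_into_dtriv by blast+
  have "?h v \<in> \<int>" if v: "v \<in> lq_lattice Q x" for v
  proof -
    have "t x v \<in> int_vecs" unfolding triv_lattice[OF t, symmetric] using v by (rule imageI)
    then show ?thesis using int_vecs_inner[OF e] by simp
  qed
  then have "?h \<in> dual_lattice (fib V x) (lq_lattice Q x)"
    unfolding dual_lattice_def using h(1) by blast
  from imageI[OF this, of "dtriv t x"] show "e \<in> dtriv t x ` dual_lattice (fib V x) (lq_lattice Q x)"
    unfolding h(2) .
qed

end

lemma dual_lattice_diff:
  "h \<in> dual_lattice S L \<Longrightarrow> k \<in> dual_lattice S L \<Longrightarrow> subspace S \<Longrightarrow> h - k \<in> dual_lattice S L"
  unfolding dual_lattice_def by (auto intro: subspace_diff[OF subspace_dual_space])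

lemma flat_lattice_bundle_dual: "flat_lattice_bundle DQ"
proof (unfold_locales, unfold DQ_simps vtrivs_dual fib_dual, goal_cases)
  case 1
  show ?case by (rule smooth_base)
next
  case (2 U t)
  then show ?case using triv_open by auto
next
  case (3 U t x)
  then show ?case using dtriv_iso by auto
next
  case (4 U t' x)
  then obtain t where t: "(U, t) \<in> vtrivs V" "t' = dtriv t" by auto
  show ?case unfolding t(2) by (rule dtriv_lattice[OF t(1) 4(2)])
next
  case (5 x)
  show ?case by (auto simp: dual_lattice_def)
next
  case (6 x)
  then show ?case using triv_cover by force
next
  case (7 U t' U' s' x)
  then obtain t s where t: "(U, t) \<in> vtrivs V" "t' = dtriv t" and s: "(U', s) \<in> vtrivs V" "s' = dtriv s" by auto
  \<comment> \<open>The roles of \<open>t\<close> and \<open>s\<close> are exchanged because dual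
    coordinates change by the inverse transpose; \<open>?H\<close> below is the transpose of
    \<open>H\<close>.\<close>
  obtain N H where N: "openin (mtop A) N" "x \<in> N" "N \<subseteq> U' \<inter> U" "linear H"
    and H: "\<And>x y. x \<in> N \<Longrightarrow> tinv s x y = tinv t x (H y)" using tinv_change[OF s(1) t(1) 7(4,3)] by blast
  let ?H = "\<lambda>w. \<Sum>b\<in>Basis. (H b \<bullet> w) *\<^sub>R b"
  have "linear ?H"
    by (intro linearI) (simp_all add: inner_add_right scaleR_add_left sum.distrib scaleR_sum_right)
  moreover have "dtriv s y h = ?H (dtriv t y h)" if y: "y \<in> N" and h: "h \<in> dual_space (fib V y)" for y h
  proof -
    have yU: "y \<in> U" using y N by blast
    have e: "h (tinv t y e) = e \<bullet> dtriv t y h" for e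
    proof -
      have "h (tinv t y e) = dtriv t y h \<bullet> t y (tinv t y e)"
        by (rule dual_apply[OF t(1) yU h tinv_mem[OF t(1) yU]])
      also have "\<dots> = dtriv t y h \<bullet> e" by (simp only: tinv_right[OF t(1) yU])
      also have "\<dots> = e \<bullet> dtriv t y h" by (rule inner_commute)
      finally show ?thesis .
    qed
    have "h (tinv s y b) = H b \<bullet> dtriv t y h" for b
      by (rule trans[OF arg_cong[where f = h, OF H[OF y]] e])
    then show ?thesis by (intro sum.cong refl arg_cong[where f = "\<lambda>r. r *\<^sub>R _"])
  qed
  ultimately show ?case
    unfolding t(2) s(2) using N by (intro exI[of _ N] exI[of _ ?H]) auto
next
  case (8 x v v')
  have S: "subspace (fib V x)" using triv_cover[OF 8(1)] linear_iso_on_subspace[OF triv_iso] by blast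
  let ?L = "dual_lattice (fib V x) (lq_lattice Q x)"
  have zero: "0 \<in> ?L" unfolding dual_lattice_def using subspace_0[OF subspace_dual_space[OF S]] by simp
  have "{w \<in> dual_space (fib V x). w - v \<in> ?L} = {w \<in> dual_space (fib V x). w - v' \<in> ?L} \<longleftrightarrow> v - v' \<in> ?L"
  proof
    assume "{w \<in> dual_space (fib V x). w - v \<in> ?L} = {w \<in> dual_space (fib V x). w - v' \<in> ?L}"
    moreover have "v \<in> {w \<in> dual_space (fib V x). w - v \<in> ?L}" using 8(2) zero by simp
    ultimately show "v - v' \<in> ?L" by blast
  next
    assume vv: "v - v' \<in> ?L"
    have "w - v \<in> ?L \<longleftrightarrow> w - v' \<in> ?L" for w
    proof
      assume "w - v' \<in> ?L"
      from dual_lattice_diff[OF this vv S] show "w - v \<in> ?L" by simp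
    next
      assume "w - v \<in> ?L"
      from dual_lattice_diff[OF this dual_lattice_diff[OF zero vv S] S] show "w - v' \<in> ?L" by simp
    qed
    then show "{w \<in> dual_space (fib V x). w - v \<in> ?L} = {w \<in> dual_space (fib V x). w - v' \<in> ?L}" by simp
  qed
  then show ?case by (simp add: coset_map_def fib_dual)
next
  case (9 x v)
  show ?case by (simp add: coset_map_def)
qed

end

lemma (in flat_lattice_bundle) flat_quotientI:
  assumes total: "B = max_atlas (adapted_charts A ((\<lambda>(U, t). (U, ztriv t)) ` vtrivs V))"
  shows "flat_quotient Q"
proof unfold_locales
  show "smooth_atlas B" unfolding total by (rule smooth_atlas_max_atlas[OF Z.smooth_atlas_adapted])
  show "adapted_charts A ((\<lambda>(U, t). (U, ztriv t)) ` vtrivs V) \<subseteq> B"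
    unfolding total by (rule subset_max_atlas[OF Z.smooth_atlas_adapted])
  fix z assume "z \<in> carrier_of B"
  then obtain \<kappa> where \<kappa>: "\<kappa> \<in> adapted_charts A ((\<lambda>(U, t). (U, ztriv t)) ` vtrivs V)" "z \<in> fst \<kappa>"
    unfolding total carrier_of_max_atlas[OF Z.smooth_atlas_adapted] by (auto simp: carrier_of_def)
  then obtain c U \<psi> W where V': "Z.valid c U \<psi> W" "z \<in> fst (param_chart c \<psi> W)"
    using Z.adapted_charts_eq by auto
  obtain x y where x: "x \<in> U" "z = \<psi> x y" by (rule Z.validE[OF V'])
  obtain t where t: "(U, t) \<in> vtrivs V" "\<psi> = ztriv t" using Z.validD(2)[OF V'(1)] by auto
  show "\<exists>x\<in>carrier_of A. \<exists>v\<in>fib V x. z = lq_map Q (x, v)"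
    using triv_carrier[OF t(1) x(1)] tinv_mem[OF t(1) x(1)] x(2) t(2) by blast
qed

lemma (in flat_lattice_bundle) flat_quotient_dual: "flat_quotient DQ"
  by (rule flat_lattice_bundle.flat_quotientI[OF flat_lattice_bundle_dual])
    (simp add: quotient_by_lattice_def)

text \<open>Distinct integers are at distance at least \<open>1\<close>, so each component has
  discrete range and is constant on a connected set.\<close>

lemma int_vecs_locally_constant:
  fixes f :: "'a::topological_space \<Rightarrow> real ^ 'n"
  assumes "connected S" "continuous_on S f" "\<And>x. x \<in> S \<Longrightarrow> f x \<in> int_vecs" "a \<in> S" "b \<in> S"
  shows "f a = f b"
proof -
  have "f a $ i = f b $ i" for i
  proof -
    have "(\<lambda>x. f x $ i) constant_on S"
    proof (rule continuous_discrete_range_constant[OF assms(1)])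
      show "continuous_on S (\<lambda>x. f x $ i)" by (intro continuous_on_component assms(2))
      fix x assume x: "x \<in> S"
      show "\<exists>e>0. \<forall>y. y \<in> S \<and> f y $ i \<noteq> f x $ i \<longrightarrow> e \<le> norm (f y $ i - f x $ i)"
      proof (intro exI[of _ 1] conjI allI impI)
        fix y assume y: "y \<in> S \<and> f y $ i \<noteq> f x $ i"
        have "f y $ i - f x $ i \<in> \<int>" using assms(3) x y by (auto simp: int_vecs_def)
        then show "1 \<le> norm (f y $ i - f x $ i)" using Ints_nonzero_abs_ge1 y by force
      qed simp
    qed
    then show ?thesis using assms(4,5) by (auto simp: constant_on_def)
  qed
  then show ?thesis by (simp add: vec_eq_iff)
qed

section \<open>Flat trivializations of a torus bundle\<close>

locale torus =
  fixes Z :: "('m, 'z, 'n::finite) torus_bundle_data"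
  assumes torus_bundle: "torus_bundle Z"
begin

abbreviation "M \<equiv> tb_base Z"
abbreviation "T \<equiv> tb_total Z"
abbreviation "\<Psi> \<equiv> tb_trivs Z"

lemma smooth_atlas_base: "smooth_atlas M" and smooth_atlas_total: "smooth_atlas T"
  and proj_carrier: "z \<in> carrier_of T \<Longrightarrow> tb_proj Z z \<in> carrier_of M"
  and adapted: "adapted_charts M \<Psi> \<subseteq> T"
  using torus_bundle by (auto simp: torus_bundle_def smooth_manifold_def)

lemma torus_cover: "x \<in> carrier_of M \<Longrightarrow> \<exists>(U, \<psi>)\<in>\<Psi>. x \<in> U"
  using torus_bundle unfolding torus_bundle_def by blast

lemma
  assumes "(U, \<psi>) \<in> \<Psi>"
  shows torus_open: "openin (mtop M) U"
    and torus_range: "x \<in> U \<Longrightarrow> range (\<psi> x) = {z \<in> carrier_of T. tb_proj Z z = x}"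
    and torus_kernel: "x \<in> U \<Longrightarrow> \<psi> x y = \<psi> x y' \<longleftrightarrow> y - y' \<in> int_vecs"
    and torus_zero: "x \<in> U \<Longrightarrow> \<psi> x 0 = tb_zero Z x"
  using assms torus_bundle unfolding torus_bundle_def by blast+

lemma torus_proj: "(U, \<psi>) \<in> \<Psi> \<Longrightarrow> x \<in> U \<Longrightarrow> tb_proj Z (\<psi> x y) = x"
  using torus_range by blast

lemma torus_GLZ:
  assumes "(U, \<psi>) \<in> \<Psi>" "(U', \<psi>') \<in> \<Psi>" "x \<in> U" "x \<in> U'"
  shows "\<exists>G\<in>GLZ. \<forall>y. \<psi>' x y = \<psi> x (G *v y)"
proof -
  have "\<forall>(U, \<psi>)\<in>\<Psi>. \<forall>(U', \<psi>')\<in>\<Psi>. \<forall>x\<in>U \<inter> U'. \<exists>G\<in>GLZ. \<forall>y. \<psi>' x y = \<psi> x (G *v y)"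
    using torus_bundle unfolding torus_bundle_def by (elim conjE)
  with assms show ?thesis by blast
qed

sublocale base: atlas M
  by standard (rule smooth_atlas_base)

sublocale total: atlas T
  by standard (rule smooth_atlas_total)

text \<open>Not yet \<open>flat_params\<close>: \<open>torus_bundle\<close> provides a matrix in
  \<open>GLZ\<close> at each point, with no stated regularity in the point.\<close>

sublocale params: lattice_params M \<Psi> int_vecs
proof (unfold_locales, goal_cases)
  case (2 U \<psi> U' \<psi>' x x' y y')
  then show ?case using torus_proj by metis
next
  case (3 U \<psi> x y y')
  then show ?case by (rule torus_kernel)
qed (fact torus_open int_vecs_small)+

lemma valid_total: "params.valid c U \<psi> W \<Longrightarrow> param_chart c \<psi> W \<in> T"
  using adapted params.adapted_charts_eq by blast

lemma int_vecs_axisI: "G \<in> GLZ \<Longrightarrow> G *v axis j 1 \<in> int_vecs"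
  by (simp add: GLZ_def int_vecs_def matrix_vector_mult_basis column_def)

text \<open>Near the zero section the transition between two parametrizations is \<open>y \<mapsto> G y\<close> with no
  translation part, so the columns of \<open>G\<close> depend continuously on the base point; they are integral.\<close>

lemma torus_change:
  assumes \<psi>: "(U, \<psi>) \<in> \<Psi>" and \<psi>': "(U', \<psi>') \<in> \<Psi>" and x0: "x0 \<in> U" "x0 \<in> U'"
  shows "\<exists>N H. openin (mtop M) N \<and> x0 \<in> N \<and> N \<subseteq> U \<inter> U' \<and> linear H \<and> (\<forall>x\<in>N. \<forall>y. \<psi>' x y = \<psi> x (H y))"
proof -
  have "\<forall>x\<in>U \<inter> U'. \<exists>G. G \<in> GLZ \<and> (\<forall>y. \<psi>' x y = \<psi> x (G *v y))" using torus_GLZ[OF \<psi> \<psi>'] by blast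
  then obtain G where "\<forall>x\<in>U \<inter> U'. G x \<in> GLZ \<and> (\<forall>y. \<psi>' x y = \<psi> x (G x *v y))" using bchoice by metis
  then have G: "\<And>x. x \<in> U \<Longrightarrow> x \<in> U' \<Longrightarrow> G x \<in> GLZ"
    "\<And>x y. x \<in> U \<Longrightarrow> x \<in> U' \<Longrightarrow> \<psi>' x y = \<psi> x (G x *v y)" by auto
  let ?c = "chart_at M x0"
  have c: "?c \<in> M" "x0 \<in> fst ?c"
    using base.chart_at base.openin_subset_carrier[OF torus_open[OF \<psi>]] x0 by auto
  obtain W where W: "params.valid ?c U \<psi> W" "(snd ?c x0, 0) \<in> W" using params.valid_exists[OF c(1) \<psi> c(2) x0(1)] by blast
  obtain W' where W': "params.valid ?c U' \<psi>' W'" "(snd ?c x0, 0) \<in> W'" using params.valid_exists[OF c(1) \<psi>' c(2) x0(2)] by blast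
  let ?k = "param_chart ?c \<psi> W" and ?k' = "param_chart ?c \<psi>' W'"
  note k = valid_total[OF W(1)] and k' = valid_total[OF W'(1)]
  \<comment> \<open>The overlap in the coordinates of \<open>?k'\<close>, cut with \<open>W\<close>
    so that \<open>(\<xi>, 0)\<close> also lies in the domain on which \<open>\<psi>\<close> is
    injective; this pins down the lift at the zero section.\<close>
  define D where "D = snd ?k' ` (fst ?k' \<inter> fst ?k) \<inter> W"
  have opD: "open D" unfolding D_def using total.open_overlap[OF k' k] params.validD(3)[OF W(1)] by blast
  have z0: "\<psi> x0 0 = \<psi>' x0 0" using torus_zero[OF \<psi> x0(1)] torus_zero[OF \<psi>' x0(2)] by simp
  have "(snd ?c x0, 0) \<in> D"
    using params.valid_mem[OF W(1) c(2) W(2)] params.valid_mem[OF W'(1) c(2) W'(2)] z0 W(2)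
    unfolding D_def by (metis IntI rev_image_eqI)
  then obtain r1 where r1: "r1 > 0" "ball (snd ?c x0, 0) r1 \<subseteq> D" using opD open_contains_ball by blast
  \<comment> \<open>Half the radius, so that the product of two balls of radius \<open>r\<close>
    fits into the ball of radius \<open>r1\<close>.\<close>
  define r where "r = r1 / 2"
  have r: "r > 0" using r1 by (simp add: r_def)
  have rD: "(\<xi>, y) \<in> D" if "\<xi> \<in> ball (snd ?c x0) r" "y \<in> ball 0 r" for \<xi> y
  proof -
    have "dist (snd ?c x0, 0) (\<xi>, y) \<le> dist (snd ?c x0) \<xi> + dist 0 y"
      unfolding dist_Pair_Pair by (rule sqrt_sum_squares_le_sum) auto
    also have "\<dots> < r1" using that by (simp add: r_def)
    finally show ?thesis using r1 by auto
  qed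
  \<comment> \<open>The fibre coordinate with respect to \<open>\<psi>\<close> of the point that has
    coordinates \<open>(\<xi>, y)\<close> with respect to \<open>\<psi>'\<close>.\<close>
  define \<tau> where "\<tau> = (\<lambda>\<xi> y. snd (transition ?k' ?k (\<xi>, y)))"
  have contT: "continuous_on D (transition ?k' ?k)"
    using smooth_on_continuous_on[OF total.transition_smooth[OF k' k]] by (rule continuous_on_subset) (simp add: D_def)
  have key: "chart_inv ?c \<xi> \<in> U" "chart_inv ?c \<xi> \<in> U'" "chart_inv ?c \<xi> \<in> fst ?c" "snd ?c (chart_inv ?c \<xi>) = \<xi>"
    "(\<xi>, \<tau> \<xi> y) \<in> W" "\<psi> (chart_inv ?c \<xi>) (\<tau> \<xi> y) = \<psi>' (chart_inv ?c \<xi>) y"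
    if p: "(\<xi>, y) \<in> D" for \<xi> y
  proof -
    obtain z where z: "z \<in> fst ?k'" "z \<in> fst ?k" "(\<xi>, y) = snd ?k' z" using p by (auto simp: D_def)
    obtain w' y' where w': "w' \<in> fst ?c" "w' \<in> U'" "z = \<psi>' w' y'" "snd ?k' z = (snd ?c w', y')"
      by (rule params.validE[OF W'(1) z(1)])
    obtain w y'' where w: "w \<in> fst ?c" "w \<in> U" "(snd ?c w, y'') \<in> W" "z = \<psi> w y''" "snd ?k z = (snd ?c w, y'')"
      by (rule params.validE[OF W(1) z(2)])
    have ww: "w' = w" by (rule params.param_base[OF \<psi>' \<psi> w'(2) w(2)]) (use w w' in simp)
    have e: "\<xi> = snd ?c w" "y = y'" using z(3) w'(4) ww by auto
    have iz: "chart_inv ?k' (\<xi>, y) = z" unfolding z(3) by (rule total.inv_left[OF k' z(1)])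
    have cw: "chart_inv ?c \<xi> = w" unfolding e by (rule base.inv_left[OF c(1) w(1)])
    have \<tau>y: "\<tau> \<xi> y = y''" unfolding \<tau>_def o_apply iz w(5) by simp
    show "chart_inv ?c \<xi> \<in> U" "chart_inv ?c \<xi> \<in> U'" "chart_inv ?c \<xi> \<in> fst ?c" "snd ?c (chart_inv ?c \<xi>) = \<xi>"
      "(\<xi>, \<tau> \<xi> y) \<in> W" "\<psi> (chart_inv ?c \<xi>) (\<tau> \<xi> y) = \<psi>' (chart_inv ?c \<xi>) y"
      using w w' ww e cw \<tau>y by auto
  qed
  have linear_\<tau>: "\<tau> \<xi> y = G (chart_inv ?c \<xi>) *v y" if \<xi>: "\<xi> \<in> ball (snd ?c x0) r" and y: "y \<in> ball 0 r" for \<xi> y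
  proof -
    let ?w = "chart_inv ?c \<xi>" and ?f = "\<lambda>y. \<tau> \<xi> y - G (chart_inv ?c \<xi>) *v y"
    \<comment> \<open>\<open>\<tau> \<xi> y\<close> and the image of \<open>y\<close> under
      \<open>G\<close> are two lifts of the same point of the torus.\<close>
    have int: "?f y \<in> int_vecs" if "y \<in> ball 0 r" for y
      using key[OF rD[OF \<xi> that]] G(2) torus_kernel[OF \<psi>] by metis
    have "continuous_on (ball 0 r) (\<lambda>y. transition ?k' ?k (\<xi>, y))"
      by (rule continuous_on_compose2[OF contT]) (use rD[OF \<xi>] in \<open>auto intro!: continuous_intros\<close>)
    then have "continuous_on (ball 0 r) ?f"
      unfolding \<tau>_def
      by (intro continuous_on_diff continuous_on_snd
          linear_continuous_on[OF matrix_vector_mul_bounded_linear])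
    then have "?f y = ?f 0"
      using int y r by (intro int_vecs_locally_constant[of "ball 0 r"]) (auto simp: convex_connected)
    \<comment> \<open>Both trivializations take \<open>0\<close> to the zero section; injectivity on
      \<open>W\<close> excludes a non-zero lattice vector.\<close>
    moreover have "\<tau> \<xi> 0 = 0"
    proof -
      have D0: "(\<xi>, 0) \<in> D" using rD[OF \<xi>] r by simp
      note k0 = key[OF D0]
      have "\<psi> ?w (\<tau> \<xi> 0) = \<psi> ?w 0"
        using k0(6) torus_zero[OF \<psi> k0(1)] torus_zero[OF \<psi>' k0(2)] by simp
      then have "param_map ?c \<psi> (\<xi>, \<tau> \<xi> 0) = param_map ?c \<psi> (\<xi>, 0)" by simp
      moreover have "(\<xi>, 0) \<in> W" using D0 by (simp add: D_def)
      ultimately have "(\<xi>, \<tau> \<xi> 0) = (\<xi>, 0)" using params.validD(4)[OF W(1)] k0(5) inj_onD by metis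
      then show ?thesis by simp
    qed
    ultimately show ?thesis by simp
  qed
  have col: "G (chart_inv ?c \<xi>) *v axis j 1 = G x0 *v axis j 1" if \<xi>: "\<xi> \<in> ball (snd ?c x0) r" for \<xi> j
  proof -
    \<comment> \<open>The basis vector is scaled into the ball where \<open>\<tau>\<close> agrees
      with \<open>G\<close>; the factor \<open>2 / r\<close> below restores the column of
      \<open>G\<close>.\<close>
    let ?e = "(r / 2) *\<^sub>R axis j 1 :: real ^ 'n"
    have e: "?e \<in> ball 0 r" using r by (simp add: norm_axis_1)
    have f: "(2 / r) *\<^sub>R \<tau> \<xi> ?e = G (chart_inv ?c \<xi>) *v axis j 1" if "\<xi> \<in> ball (snd ?c x0) r" for \<xi>
      using linear_\<tau>[OF that e] r by (simp add: matrix_vector_mult_scaleR)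
    have "continuous_on (ball (snd ?c x0) r) (\<lambda>\<xi>. transition ?k' ?k (\<xi>, ?e))"
      by (rule continuous_on_compose2[OF contT]) (use rD e in \<open>auto intro!: continuous_intros\<close>)
    then have "continuous_on (ball (snd ?c x0) r) (\<lambda>\<xi>. (2 / r) *\<^sub>R \<tau> \<xi> ?e)"
      unfolding \<tau>_def by (intro continuous_on_scaleR continuous_on_const continuous_on_snd)
    moreover have "(2 / r) *\<^sub>R \<tau> \<xi> ?e \<in> int_vecs" if "\<xi> \<in> ball (snd ?c x0) r" for \<xi>
    proof -
      have "(\<xi>, 0) \<in> D" using rD[OF that] r by simp
      note k0 = key[OF this]
      show ?thesis unfolding f[OF that] by (rule int_vecs_axisI[OF G(1)[OF k0(1,2)]])
    qed
    ultimately have "(2 / r) *\<^sub>R \<tau> \<xi> ?e = (2 / r) *\<^sub>R \<tau> (snd ?c x0) ?e"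
      using \<xi> r by (intro int_vecs_locally_constant[of "ball (snd ?c x0) r" "\<lambda>\<xi>. (2 / r) *\<^sub>R \<tau> \<xi> ?e"])
        (auto simp: convex_connected)
    then show ?thesis using f[OF \<xi>] f[of "snd ?c x0"] r base.inv_left[OF c] by simp
  qed
  define N where "N = {x \<in> fst ?c. snd ?c x \<in> ball (snd ?c x0) r}"
  have N: "openin (mtop M) N" "x0 \<in> N"
    unfolding N_def using base.openin_chart_preimage[OF c(1) open_ball] c r by auto
  have NU: "x \<in> U" "x \<in> U'" "G x = G x0" if "x \<in> N" for x
  proof -
    have \<xi>: "snd ?c x \<in> ball (snd ?c x0) r" "chart_inv ?c (snd ?c x) = x"
      using that base.inv_left[OF c(1)] by (auto simp: N_def)
    have "(snd ?c x, 0) \<in> D" using rD[OF \<xi>(1)] r by simp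
    from key(1,2)[OF this] show "x \<in> U" "x \<in> U'" unfolding \<xi>(2) .
    have "G x $ i $ j = G x0 $ i $ j" for i j
      using arg_cong[OF col[OF \<xi>(1), of j], of "\<lambda>v. v $ i"]
      unfolding \<xi>(2) by (simp add: matrix_vector_mult_basis column_def)
    then show "G x = G x0" by (simp add: vec_eq_iff)
  qed
  show ?thesis
  proof (intro exI[of _ N] exI[of _ "(*v) (G x0)"] conjI matrix_vector_mul_linear N ballI allI subsetI)
    show "x \<in> U \<inter> U'" if "x \<in> N" for x using NU that by blast
    show "\<psi>' x y = \<psi> x (G x0 *v y)" if "x \<in> N" for x y
      using G(2)[OF NU(1,2)[OF that], of y] unfolding NU(3)[OF that] .
  qed
qed

end

text \<open>Parametrizations are total functions of the base point but are meaningful only over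
  \<open>U\<close>. Two that agree there yield the same chart as a pair, including the values of
  \<open>inv_into\<close> off the image.\<close>

lemma (in atlas) adapted_charts_mono:
  assumes "\<And>U \<psi>. (U, \<psi>) \<in> \<Phi> \<Longrightarrow> \<exists>\<psi>'. (U, \<psi>') \<in> \<Phi>' \<and> (\<forall>x\<in>U. \<psi> x = \<psi>' x)"
  shows "adapted_charts A \<Phi> \<subseteq> adapted_charts A \<Phi>'"
proof
  fix \<kappa> assume "\<kappa> \<in> adapted_charts A \<Phi>"
  then obtain c U \<psi> W where \<kappa>: "\<kappa> = (param_map c \<psi> ` W, inv_into W (param_map c \<psi>))" "c \<in> A" "(U, \<psi>) \<in> \<Phi>"
    "open W" "W \<subseteq> snd c ` (fst c \<inter> U) \<times> UNIV" "inj_on (param_map c \<psi>) W"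
    unfolding adapted_charts_def by blast
  obtain \<psi>' where \<psi>': "(U, \<psi>') \<in> \<Phi>'" "\<And>x. x \<in> U \<Longrightarrow> \<psi> x = \<psi>' x" using assms[OF \<kappa>(3)] by blast
  have eq: "param_map c \<psi> p = param_map c \<psi>' p" if "p \<in> W" for p
  proof -
    obtain \<xi> y where p: "p = (\<xi>, y)" by force
    have "\<xi> \<in> snd c ` (fst c \<inter> U)" using that \<kappa>(5) p by blast
    then obtain w where w: "w \<in> fst c" "w \<in> U" "\<xi> = snd c w" by blast
    have U: "chart_inv c \<xi> \<in> U" unfolding w(3) inv_left[OF \<kappa>(2) w(1)] by (rule w(2))
    show ?thesis unfolding p prod.case by (rule fun_cong[OF \<psi>'(2)[OF U]])
  qed
  have 1: "param_map c \<psi> ` W = param_map c \<psi>' ` W" by (rule image_cong[OF refl eq])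
  have 2: "inv_into W (param_map c \<psi>) = inv_into W (param_map c \<psi>')"
  proof
    fix z
    have "(\<lambda>p. p \<in> W \<and> param_map c \<psi> p = z) = (\<lambda>p. p \<in> W \<and> param_map c \<psi>' p = z)"
      by (intro ext conj_cong refl) (simp only: eq)
    then show "inv_into W (param_map c \<psi>) z = inv_into W (param_map c \<psi>') z"
      by (simp only: inv_into_def)
  qed
  have 3: "inj_on (param_map c \<psi>') W"
  proof (rule inj_onI)
    fix p q assume pq: "p \<in> W" "q \<in> W" "param_map c \<psi>' p = param_map c \<psi>' q"
    then have "param_map c \<psi> p = param_map c \<psi> q" by (simp only: eq)
    then show "p = q" by (rule inj_onD[OF \<kappa>(6) _ pq(1,2)])
  qed
  show "\<kappa> \<in> adapted_charts A \<Phi>'"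
    unfolding adapted_charts_def \<kappa>(1) 1 2 using \<kappa>(2,4,5) \<psi>'(1) 3 by blast
qed

section \<open>The vertical bundle, its lattice and the fibrewise exponential map\<close>

context torus
begin

abbreviation "V \<equiv> vertical_bundle Z"
abbreviation "vel \<psi> x \<equiv> (\<lambda>y. velocity T (\<lambda>\<tau>. \<psi> x (\<tau> *\<^sub>R y)) 0)"

text \<open>In an adapted chart through the zero point the projection is \<open>fst\<close>, so the
  vertical vectors are those with coordinates \<open>(0, y)\<close>, and
  \<open>vel \<psi> x y\<close> is exactly this vector. Hence \<open>vel\<close> and the fibre
  coordinate are inverse to each other.\<close>

lemma
  assumes \<psi>: "(U, \<psi>) \<in> \<Psi>" and x: "x \<in> U"
  shows vel_iso: "linear_iso_on (fib V x) (inv (vel \<psi> x))"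
    and inv_into_vel: "inv_into (fib V x) (inv (vel \<psi> x)) = vel \<psi> x"
    and inj_vel: "inj (vel \<psi> x)"
proof -
  let ?c = "chart_at M x"
  have c: "?c \<in> M" "x \<in> fst ?c"
    using base.chart_at base.openin_subset_carrier[OF torus_open[OF \<psi>]] x by auto
  obtain W where W: "params.valid ?c U \<psi> W" "(snd ?c x, 0) \<in> W" using params.valid_exists[OF c(1) \<psi> c(2) x] by blast
  let ?k = "param_chart ?c \<psi> W" and ?z = "tb_zero Z x"
  have z: "\<psi> x 0 = ?z" by (rule torus_zero[OF \<psi> x])
  have k: "?k \<in> T" "?z \<in> fst ?k"
    using valid_total[OF W(1)] params.valid_mem(1)[OF W(1) c(2) W(2)] z by auto
  have vel: "vel \<psi> x y = tvec T ?k ?z (0, y)" for y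
    using params.velocity_param[OF total.atlas_axioms k(1) W(1) c(2) W(2), of y] z by simp
  have tm: "tangent_map T M (tb_proj Z) ?z v = tvec M ?c x (fst (v ?k))" if "v \<in> tangent_space T ?z" for v
    using params.tangent_map_proj[OF total.atlas_axioms k(1) W(1) torus_proj[OF \<psi>] c(2) x W(2)] that z by simp
  have zero: "tvec M ?c x a = 0 \<longleftrightarrow> a = 0" for a
  proof
    assume "tvec M ?c x a = 0"
    then have "tvec M ?c x a ?c = 0" by simp
    then show "a = 0" unfolding base.tvec_self[OF c] .
  next
    have "0 \<in> tangent_space M x" using base.subspace_tangent_space[OF base.mem_carrier[OF c]] by (rule subspace_0)
    from base.tvec_tangent[OF this c] show "a = 0 \<Longrightarrow> tvec M ?c x a = 0" by simp
  qed
  have fib: "v \<in> fib V x \<longleftrightarrow> v \<in> tangent_space T ?z \<and> fst (v ?k) = 0" for v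
  proof -
    have "v \<in> fib V x \<longleftrightarrow> v \<in> tangent_space T ?z \<and> tangent_map T M (tb_proj Z) ?z v = 0"
      by (simp add: vertical_bundle_def)
    also have "\<dots> \<longleftrightarrow> v \<in> tangent_space T ?z \<and> tvec M ?c x (fst (v ?k)) = 0"
      by (intro conj_cong refl) (simp only: tm)
    finally show ?thesis unfolding zero .
  qed
  have vk: "vel \<psi> x y ?k = (0, y)" for y unfolding vel by (rule total.tvec_self[OF k])
  have vmem: "vel \<psi> x y \<in> fib V x" for y
    unfolding fib vk unfolding vel by (simp add: total.tvec_mem[OF k])
  show inj: "inj (vel \<psi> x)"
  proof (rule injI)
    fix a b assume "vel \<psi> x a = vel \<psi> x b"
    then have "vel \<psi> x a ?k = vel \<psi> x b ?k" by (rule arg_cong)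
    then show "a = b" unfolding vk by simp
  qed
  have vs: "vel \<psi> x (snd (v ?k)) = v" if v: "v \<in> fib V x" for v
  proof -
    have "(0, snd (v ?k)) = v ?k" using v by (simp add: fib prod_eq_iff)
    then show ?thesis unfolding vel using total.tvec_tangent[OF _ k] v by (simp add: fib)
  qed
  have inv: "inv (vel \<psi> x) v = snd (v ?k)" if v: "v \<in> fib V x" for v
    using inv_f_f[OF inj, of "snd (v ?k)"] unfolding vs[OF v] .
  have ps: "(v + w) d = v d + w d" "(r *\<^sub>R v) d = r *\<^sub>R v d"
    for v w :: "('z, (real ^ 'n) \<times> (real ^ 'n)) tvector" and r d
    by (simp_all add: plus_fun_def scaleR_fun_def)
  have sub: "subspace (fib V x)"
    using total.subspace_tangent_space[OF total.mem_carrier[OF k]]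
    unfolding subspace_def by (auto simp: ps fib)
  have add: "inv (vel \<psi> x) (v + w) = inv (vel \<psi> x) v + inv (vel \<psi> x) w" if "v \<in> fib V x" "w \<in> fib V x" for v w
    unfolding inv[OF that(1)] inv[OF that(2)] inv[OF subspace_add[OF sub that]] by (simp add: ps)
  have scale: "inv (vel \<psi> x) (r *\<^sub>R v) = r *\<^sub>R inv (vel \<psi> x) v" if "v \<in> fib V x" for v r
    unfolding inv[OF that] inv[OF subspace_scale[OF sub that]] by (simp add: ps)
  have left: "vel \<psi> x (inv (vel \<psi> x) v) = v" if "v \<in> fib V x" for v
    unfolding inv[OF that] by (rule vs[OF that])
  note lin = linear_iso_onI[where g = "vel \<psi> x", OF sub add scale vmem inv_f_f[OF inj] left]
  show "linear_iso_on (fib V x) (inv (vel \<psi> x))" "inv_into (fib V x) (inv (vel \<psi> x)) = vel \<psi> x"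
    by (rule lin(1), assumption+, rule lin(2))
qed

lemma vel_change:
  assumes "\<And>y. \<psi>' x y = \<psi> x (H y)" "linear H"
  shows "vel \<psi>' x y = vel \<psi> x (H y)"
  by (simp add: assms(1) linear_scale[OF assms(2)])

text \<open>The same matrix \<open>G\<close> relates the velocities and the end points in two
  trivializations, so the value described by \<open>THE\<close> does not depend on the
  trivialization.\<close>

lemma fibre_exp_vel:
  assumes \<psi>: "(U, \<psi>) \<in> \<Psi>" and x: "x \<in> U"
  shows "fibre_exp Z (x, vel \<psi> x y) = \<psi> x y"
proof -
  have "(THE z. \<exists>(U, \<psi>')\<in>\<Psi>. \<exists>y'. x \<in> U \<and> vel \<psi> x y = vel \<psi>' x y' \<and> z = \<psi>' x y') = \<psi> x y"
  proof (rule the_equality)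
    fix z assume "\<exists>(U, \<psi>')\<in>\<Psi>. \<exists>y'. x \<in> U \<and> vel \<psi> x y = vel \<psi>' x y' \<and> z = \<psi>' x y'"
    then obtain U' \<psi>' y' where \<psi>': "(U', \<psi>') \<in> \<Psi>" "x \<in> U'" "vel \<psi> x y = vel \<psi>' x y'" "z = \<psi>' x y'" by blast
    obtain G where G: "\<And>y. \<psi>' x y = \<psi> x (G *v y)" using torus_GLZ[OF \<psi> \<psi>'(1) x \<psi>'(2)] by blast
    have "vel \<psi> x y = vel \<psi> x (G *v y')"
      unfolding \<psi>'(3) by (rule vel_change[where \<psi> = \<psi> and \<psi>' = \<psi>', OF G matrix_vector_mul_linear])
    then have "y = G *v y'" by (rule injD[OF inj_vel[OF \<psi> x]])
    then show "z = \<psi> x y" using \<psi>'(4) G by simp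
  qed (use \<psi> x in blast)
  then show ?thesis by (simp add: fibre_exp_def)
qed

lemma vertical_vtrivs: "vtrivs V = (\<lambda>(U, \<psi>). (U, \<lambda>x. inv (vel \<psi> x))) ` \<Psi>"
  by (simp add: vertical_bundle_def)

lemma lattice_vel:
  assumes \<psi>: "(U, \<psi>) \<in> \<Psi>" and x: "x \<in> U"
  shows "vel \<psi> x y \<in> lattice_of Z x \<longleftrightarrow> y \<in> int_vecs"
proof -
  have "vel \<psi> x y \<in> fib V x"
    using linear_iso_on_inv_mem[OF vel_iso[OF \<psi> x], of y] unfolding inv_into_vel[OF \<psi> x] .
  then have "vel \<psi> x y \<in> lattice_of Z x \<longleftrightarrow> \<psi> x y = \<psi> x 0"
    by (simp add: lattice_of_def fibre_exp_vel[OF \<psi> x] torus_zero[OF \<psi> x])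
  then show ?thesis using torus_kernel[OF \<psi> x, of y 0] by simp
qed

lemma torus_quotient_simps [simp]:
  "lq_base (torus_quotient Z) = M" "lq_bundle (torus_quotient Z) = V" "lq_lattice (torus_quotient Z) = lattice_of Z"
  "lq_total (torus_quotient Z) = T" "lq_proj (torus_quotient Z) = tb_proj Z" "lq_map (torus_quotient Z) = fibre_exp Z"
  by (simp_all add: torus_quotient_def)

lemma vel_mem:
  assumes "(U, \<psi>) \<in> \<Psi>" "x \<in> U" "v \<in> fib V x"
  obtains y where "v = vel \<psi> x y"
  using linear_iso_on_left[OF vel_iso[OF assms(1,2)] assms(3)] unfolding inv_into_vel[OF assms(1,2)] by metis

lemma flat_lattice_bundle_torus: "flat_lattice_bundle (torus_quotient Z)"
proof (unfold_locales, unfold torus_quotient_simps vertical_vtrivs, goal_cases)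
  case 1
  show ?case by (rule smooth_atlas_base)
next
  case (2 U t)
  then show ?case using torus_open by auto
next
  case (3 U t x)
  then show ?case using vel_iso by auto
next
  case (4 U t x)
  then obtain \<psi> where \<psi>: "(U, \<psi>) \<in> \<Psi>" "t = (\<lambda>x. inv (vel \<psi> x))" by auto
  note inv = inv_f_f[OF inj_vel[OF \<psi>(1) 4(2)]]
  have sub: "lattice_of Z x \<subseteq> fib V x" by (auto simp: lattice_of_def)
  show ?case unfolding \<psi>(2)
  proof (intro equalityI subsetI)
    fix y assume "y \<in> inv (vel \<psi> x) ` lattice_of Z x"
    then obtain v where v: "v \<in> lattice_of Z x" "y = inv (vel \<psi> x) v" by blast
    obtain y' where y': "v = vel \<psi> x y'" using vel_mem[OF \<psi>(1) 4(2)] v(1) sub by blast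
    show "y \<in> int_vecs" using v(1) unfolding v(2) y' lattice_vel[OF \<psi>(1) 4(2)] inv .
  next
    fix y :: "real ^ 'n" assume "y \<in> int_vecs"
    then have "vel \<psi> x y \<in> lattice_of Z x" unfolding lattice_vel[OF \<psi>(1) 4(2)] .
    from imageI[OF this, of "inv (vel \<psi> x)"] show "y \<in> inv (vel \<psi> x) ` lattice_of Z x" unfolding inv .
  qed
next
  case (5 x)
  show ?case by (auto simp: lattice_of_def)
next
  case (6 x)
  then show ?case using torus_cover by force
next
  case (7 U t U' t' x)
  then obtain \<psi> \<psi>' where \<psi>: "(U, \<psi>) \<in> \<Psi>" "t = (\<lambda>x. inv (vel \<psi> x))"
    and \<psi>': "(U', \<psi>') \<in> \<Psi>" "t' = (\<lambda>x. inv (vel \<psi>' x))" by auto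
  \<comment> \<open>Coordinates change contrary to parametrizations, hence the exchanged order of
    \<open>\<psi>\<close> and \<open>\<psi>'\<close>.\<close>
  obtain N H where N: "openin (mtop M) N" "x \<in> N" "N \<subseteq> U' \<inter> U" and H: "linear H"
    "\<And>x y. x \<in> N \<Longrightarrow> \<psi> x y = \<psi>' x (H y)" using torus_change[OF \<psi>'(1) \<psi>(1) 7(4,3)] by blast
  have "t' y v = H (t y v)" if y: "y \<in> N" and v: "v \<in> fib V y" for y v
  proof -
    have yU: "y \<in> U" "y \<in> U'" using y N by auto
    obtain w where w: "v = vel \<psi> y w" using vel_mem[OF \<psi>(1) yU(1) v] by blast
    have "v = vel \<psi>' y (H w)" unfolding w by (rule vel_change[where \<psi> = \<psi>' and \<psi>' = \<psi> and H = H, OF H(2)[OF y] H(1)])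
    then have "t' y v = H w" unfolding \<psi>'(2) using inv_f_f[OF inj_vel[OF \<psi>'(1) yU(2)], of "H w"] by simp
    moreover have "t y v = w" unfolding \<psi>(2) w by (rule inv_f_f[OF inj_vel[OF \<psi>(1) yU(1)]])
    ultimately show ?thesis by simp
  qed
  then show ?case using N H(1) by (intro exI[of _ N] exI[of _ H]) auto
next
  case (8 x v v')
  obtain U \<psi> where \<psi>: "(U, \<psi>) \<in> \<Psi>" "x \<in> U" using torus_cover[OF 8(1)] by blast
  obtain y y' where y: "v = vel \<psi> x y" "v' = vel \<psi> x y'" using vel_mem[OF \<psi>] 8(2,3) by metis
  have "linear (vel \<psi> x)" using linear_iso_on_linear_inv[OF vel_iso[OF \<psi>]] unfolding inv_into_vel[OF \<psi>] .
  then have "v - v' = vel \<psi> x (y - y')" unfolding y by (rule linear_diff[symmetric])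
  then show ?case
    using torus_kernel[OF \<psi>, of y y'] lattice_vel[OF \<psi>, of "y - y'"]
    unfolding y fibre_exp_vel[OF \<psi>] by simp
next
  case (9 x v)
  obtain U \<psi> where \<psi>: "(U, \<psi>) \<in> \<Psi>" "x \<in> U" using torus_cover[OF 9(1)] by blast
  obtain y where y: "v = vel \<psi> x y" using vel_mem[OF \<psi>] 9(2) by metis
  show ?case unfolding y fibre_exp_vel[OF \<psi>] by (rule torus_proj[OF \<psi>])
qed

text \<open>Over each \<open>U\<close> the map
  \<open>y \<mapsto> fibre_exp Z (x, vel \<psi> x y)\<close> is \<open>\<psi> x\<close> itself, so
  the adapted charts of the quotient presentation are among those of the torus bundle.\<close>

lemma flat_quotient_torus: "flat_quotient (torus_quotient Z)"
proof (intro flat_quotient.intro flat_lattice_bundle_torus flat_quotient_axioms.intro; unfold torus_quotient_simps)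
  show "smooth_atlas T" by (rule smooth_atlas_total)
  have "adapted_charts M ((\<lambda>(U, t). (U, \<lambda>x y. fibre_exp Z (x, inv_into (fib V x) (t x) y))) ` vtrivs V)
      \<subseteq> adapted_charts M \<Psi>"
  proof (rule base.adapted_charts_mono)
    fix U \<psi> assume "(U, \<psi>) \<in> (\<lambda>(U, t). (U, \<lambda>x y. fibre_exp Z (x, inv_into (fib V x) (t x) y))) ` vtrivs V"
    then obtain \<phi> where \<phi>: "(U, \<phi>) \<in> \<Psi>"
      "\<psi> = (\<lambda>x y. fibre_exp Z (x, inv_into (fib V x) (inv (vel \<phi> x)) y))"
      unfolding vertical_vtrivs by auto
    have "\<psi> x = \<phi> x" if "x \<in> U" for x
      unfolding \<phi>(2) inv_into_vel[OF \<phi>(1) that] fibre_exp_vel[OF \<phi>(1) that] ..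
    then show "\<exists>\<psi>'. (U, \<psi>') \<in> \<Psi> \<and> (\<forall>x\<in>U. \<psi> x = \<psi>' x)" using \<phi>(1) by blast
  qed
  then show "adapted_charts M ((\<lambda>(U, t). (U, \<lambda>x y. fibre_exp Z (x, inv_into (fib V x) (t x) y))) ` vtrivs V) \<subseteq> T"
    using adapted by blast
  fix z assume z: "z \<in> carrier_of T"
  let ?x = "tb_proj Z z"
  obtain U \<psi> where \<psi>: "(U, \<psi>) \<in> \<Psi>" "?x \<in> U" using torus_cover[OF proj_carrier[OF z]] by blast
  have "z \<in> range (\<psi> ?x)" unfolding torus_range[OF \<psi>] using z by simp
  then obtain y where "z = \<psi> ?x y" by blast
  then have "z = fibre_exp Z (?x, vel \<psi> ?x y)" unfolding fibre_exp_vel[OF \<psi>] .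
  moreover have "vel \<psi> ?x y \<in> fib V ?x"
    using linear_iso_on_inv_mem[OF vel_iso[OF \<psi>], of y] unfolding inv_into_vel[OF \<psi>] .
  ultimately show "\<exists>x\<in>carrier_of M. \<exists>v\<in>fib V x. z = fibre_exp Z (x, v)" using proj_carrier[OF z] by blast
qed

end

section \<open>Mirror structures\<close>

lemma nijenhuis_cong:
  assumes "open S" "p \<in> S" "\<And>q u. q \<in> S \<Longrightarrow> K q u = K' q u"
  shows "nijenhuis K p u v = nijenhuis K' p u v"
proof -
  have "frechet_derivative (\<lambda>q. K q v) (at p) = frechet_derivative (\<lambda>q. K' q v) (at p)" for v
    by (rule frechet_derivative_cong_open[OF assms(1,2)]) (rule assms(3))
  then show ?thesis by (simp add: nijenhuis_def nijenhuis_half_def assms(3)[OF assms(2)])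
qed

lemma to_quad_mem:
  assumes S: "subspace S" and T: "subspace T" and u: "u \<in> (S \<times> T) \<times> dual_space (S \<times> T)"
  shows "to_quad u \<in> S \<times> T \<times> dual_space S \<times> dual_space T"
proof -
  obtain v a h where u': "u = ((v, a), h)" by (metis prod.exhaust)
  have va: "v \<in> S" "a \<in> T" and h: "h \<in> dual_space (S \<times> T)" using u u' by auto
  have add: "h (v + w, a + b) = h (v, a) + h (w, b)" if "v \<in> S" "w \<in> S" "a \<in> T" "b \<in> T" for v w a b
    using dual_spaceD(1)[OF h, of "(v, a)" "(w, b)"] that by simp
  have scale: "h (r *\<^sub>R v, r *\<^sub>R a) = r * h (v, a)" if "v \<in> S" "a \<in> T" for r v a
    using dual_spaceD(2)[OF h, of "(v, a)" r] that by simp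
  have out: "h (v, a) = 0" if "v \<notin> S \<or> a \<notin> T" for v a
    using dual_spaceD(3)[OF h, of "(v, a)"] that by auto
  note z = subspace_0[OF S] subspace_0[OF T]
  have "(\<lambda>v'. h (v', 0)) \<in> dual_space S"
    using add[OF _ _ z(2) z(2)] scale[OF _ z(2)] out unfolding dual_space_def by auto
  moreover have "(\<lambda>a'. h (0, a')) \<in> dual_space T"
    using add[OF z(1) z(1)] scale[OF z(1)] out unfolding dual_space_def by auto
  ultimately show ?thesis using va by (simp add: u' to_quad_def)
qed

lemma dual_pairing_quad:
  assumes S: "subspace S" and T: "subspace T"
    and u: "u \<in> (S \<times> T) \<times> dual_space (S \<times> T)" and w: "w \<in> (S \<times> T) \<times> dual_space (S \<times> T)"
  shows "dual_pairing u w = (case (to_quad u, to_quad w) of ((v, a, f, h), (v', a', f', h')) \<Rightarrow>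
    - (1/2) * (f v' + h a' + (f' v + h' a)))"
proof -
  obtain v a k where u': "u = ((v, a), k)" by (metis prod.exhaust)
  obtain v' a' k' where w': "w = ((v', a'), k')" by (metis prod.exhaust)
  have "h (x, y) = h (x, 0) + h (0, y)" if "h \<in> dual_space (S \<times> T)" "x \<in> S" "y \<in> T" for h x y
    using dual_spaceD(1)[OF that(1), of "(x, 0)" "(0, y)"] that subspace_0[OF S] subspace_0[OF T] by simp
  from this[of k v' a'] this[of k' v a] show ?thesis
    using u w by (simp add: u' w' dual_pairing_def to_quad_def)
qed

context flat_lattice_bundle
begin

abbreviation "TA \<equiv> tangent_bundle A"
abbreviation "VT \<equiv> sum_bundle V TA"
abbreviation "D x \<equiv> fib (double_bundle VT) x"

text \<open>Near each point the transition matrix is the constant \<open>H\<close>.\<close>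

lemma smooth_bundle_V: "smooth_bundle A V"
proof -
  have "smooth_on (snd c ` (U \<inter> U' \<inter> fst c)) ((\<lambda>x. t' x (tinv t x e)) \<circ> chart_inv c)"
    if t: "(U, t) \<in> vtrivs V" "(U', t') \<in> vtrivs V" and c: "c \<in> A" for U t U' t' c e
  proof (rule smooth_on_local)
    fix p assume "p \<in> snd c ` (U \<inter> U' \<inter> fst c)"
    then obtain x where x: "x \<in> U" "x \<in> U'" "x \<in> fst c" "p = snd c x" by blast
    obtain N H where N: "openin (mtop A) N" "x \<in> N" "N \<subseteq> U \<inter> U'"
      and H: "\<And>x v. x \<in> N \<Longrightarrow> v \<in> fib V x \<Longrightarrow> t' x v = H (t x v)" using triv_change[OF t x(1,2)] by blast
    have op: "open (snd c ` (N \<inter> fst c))" by (rule base.open_image_chart[OF N(1) c])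
    have "smooth_on (snd c ` (N \<inter> fst c)) ((\<lambda>x. t' x (tinv t x e)) \<circ> chart_inv c)"
    proof (rule smooth_on_eq[OF op smooth_on_const])
      fix q assume "q \<in> snd c ` (N \<inter> fst c)"
      then obtain y where y: "y \<in> N" "y \<in> U" "y \<in> fst c" "q = snd c y" using N by blast
      show "((\<lambda>x. t' x (tinv t x e)) \<circ> chart_inv c) q = H e"
        unfolding y(4) o_apply base.inv_left[OF c y(3)] H[OF y(1) tinv_mem[OF t(1) y(2)]] tinv_right[OF t(1) y(2)] ..
    qed
    then show "\<exists>T. open T \<and> p \<in> T \<and> smooth_on T ((\<lambda>x. t' x (tinv t x e)) \<circ> chart_inv c)"
      using op x N(2) by blast
  qed
  then show ?thesis
    unfolding smooth_bundle_def using triv_open triv_iso by blast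
qed

lemma smooth_bundle_VT: "smooth_bundle A (double_bundle VT)"
  by (intro base.smooth_bundle_double base.smooth_bundle_sum smooth_bundle_V base.smooth_bundle_tangent)

lemma D_eq: "D x = (fib V x \<times> tangent_space A x) \<times> dual_space (fib V x \<times> tangent_space A x)"
  by (simp add: fib_double) (simp add: sum_bundle_def fib_tangent)

section \<open>Trivializations of the double of \<open>VT\<close> and their relation to
  quads\<close>

abbreviation "DU c U \<equiv> (U \<inter> fst c) \<inter> (U \<inter> fst c)"
abbreviation "vt c t x \<equiv> \<lambda>(v, a). (t x v, a c)"
abbreviation "dt c t x \<equiv> \<lambda>(a, h). (vt c t x a, \<Sum>b\<in>Basis. h (inv_into (fib VT x) (vt c t x) b) *\<^sub>R b)"

text \<open>\<open>double_bundle\<close> groups the model coordinates into a vector and a covector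
  of the sum; \<open>pack\<close> produces this grouping from the list of four used by
  \<open>quad_coord\<close>.\<close>

definition pack :: "'e \<times> 'd \<times> 'e \<times> 'd \<Rightarrow> ('e \<times> 'd) \<times> ('e \<times> 'd)" where
  "pack = (\<lambda>(v, a, f, h). ((v, a), (f, h)))"

definition unpack :: "('e \<times> 'd) \<times> ('e \<times> 'd) \<Rightarrow> 'e \<times> 'd \<times> 'e \<times> 'd" where
  "unpack = (\<lambda>((v, a), (f, h)). (v, a, f, h))"

lemma pack_unpack [simp]: "pack (unpack s) = s" "unpack (pack u) = u"
  by (simp_all add: pack_def unpack_def split_beta)

lemma linear_unpack: "linear (unpack :: ('e::real_vector \<times> 'd::real_vector) \<times> _ \<Rightarrow> _)"
  by (rule linearI) (simp_all add: unpack_def split_beta prod_eq_iff)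

context
  fixes c U t
  assumes c: "c \<in> A" and t: "(U, t) \<in> vtrivs V"
begin

lemma dt_triv: "(DU c U, dt c t) \<in> vtrivs (double_bundle VT)"
proof -
  have "(fst c, \<lambda>x v. v c) \<in> vtrivs TA" using c by (auto simp: tangent_bundle_def)
  then have 1: "(U \<inter> fst c, vt c t) \<in> vtrivs VT"
    unfolding sum_bundle_def vbundle.simps
    by (intro image_eqI[where x = "((U, t), (fst c, \<lambda>x v. v c))"] SigmaI t) (simp only: prod.case)
  then have 2: "(U \<inter> fst c, \<lambda>x h. \<Sum>b\<in>Basis. h (inv_into (fib VT x) (vt c t x) b) *\<^sub>R b) \<in> vtrivs (dual_bundle VT)"
    unfolding dual_bundle_def vbundle.simps
    by (intro image_eqI[where x = "(U \<inter> fst c, vt c t)"]) (simp only: prod.case)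
  show ?thesis
    unfolding double_bundle_def sum_bundle_def[of VT "dual_bundle VT"] vbundle.simps
    by (rule image_eqI[OF _ SigmaI[OF 1 2]]) (simp only: prod.case)
qed

lemma dt_iso: "x \<in> U \<Longrightarrow> x \<in> fst c \<Longrightarrow> linear_iso_on (D x) (dt c t x)"
  using smooth_bundleD(2)[OF smooth_bundle_VT dt_triv] by simp

text \<open>Smoothness of \<open>Jb\<close> refers to the bundle trivialization \<open>dt\<close>,
  the matrix \<open>endo_coord\<close> to \<open>qcoord\<close>. They agree up to regrouping because
  the two restrictions in \<open>to_quad\<close> pick out the two blocks of the dual
  coordinates.\<close>

lemma dt_quad:
  assumes x: "x \<in> U" "x \<in> fst c"
  shows "qcoord c t x (to_quad u) = unpack (dt c t x u)"
proof -
  obtain v a h where u: "u = ((v, a), h)" by (metis prod.exhaust)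
  note T = base.linear_iso_on_tangent[OF c x(2)] and S = triv_iso[OF t x(1)]
  have fVT: "fib VT x = fib V x \<times> tangent_space A x" by (simp add: sum_bundle_def fib_tangent)
  have inv: "inv_into (fib VT x) (vt c t x) (b1, b2) = (tinv t x b1, tvec A c x b2)" for b1 b2
    unfolding fVT by (simp only: linear_iso_on_Times(2)[OF S T] base.inv_into_tangent[OF c x(2)] prod.case)
  have 0: "tinv t x 0 = 0" "tvec A c x 0 = 0"
    using linear_0[OF linear_iso_on_linear_inv[OF S]] linear_0[OF linear_iso_on_linear_inv[OF T]]
    unfolding base.inv_into_tangent[OF c x(2)] by auto
  have "(\<Sum>b\<in>Basis. h (inv_into (fib VT x) (vt c t x) b) *\<^sub>R b)
      = (\<Sum>b\<in>Basis. h (tinv t x b, 0) *\<^sub>R b, \<Sum>b\<in>Basis. h (0, tvec A c x b) *\<^sub>R b)"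
    by (simp add: sum_Basis_prod inv 0 prod_eq_iff fst_sum snd_sum)
  then show ?thesis by (simp add: u to_quad_def quad_coord_def unpack_def)
qed

lemma quad_iso:
  assumes x: "x \<in> U" "x \<in> fst c"
  shows "linear_iso_on (D x) (\<lambda>u. qcoord c t x (to_quad u))"
    and "inv_into (D x) (\<lambda>u. qcoord c t x (to_quad u)) = (\<lambda>s. inv_into (D x) (dt c t x) (pack s))"
proof -
  note iso = dt_iso[OF x]
  have *: "unpack (a + b) = unpack a + unpack b" "unpack (r *\<^sub>R a) = r *\<^sub>R unpack a"
    for a b :: "((real ^ 'n) \<times> (real ^ 'n)) \<times> ((real ^ 'n) \<times> (real ^ 'n))" and r
    using linear_add[OF linear_unpack] linear_scale[OF linear_unpack] by blast+
  note lin = linear_iso_onI[where S = "D x" and f = "\<lambda>u. unpack (dt c t x u)"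
      and g = "\<lambda>s. inv_into (D x) (dt c t x) (pack s)", OF linear_iso_on_subspace[OF iso]]
  show "linear_iso_on (D x) (\<lambda>u. qcoord c t x (to_quad u))"
    "inv_into (D x) (\<lambda>u. qcoord c t x (to_quad u)) = (\<lambda>s. inv_into (D x) (dt c t x) (pack s))"
    unfolding dt_quad[OF x]
    by (rule lin(1), simp_all only: linear_iso_on_add[OF iso] linear_iso_on_scale[OF iso] *
        linear_iso_on_inv_mem[OF iso] linear_iso_on_right[OF iso] linear_iso_on_left[OF iso] pack_unpack)
      (rule lin(2), simp_all only: linear_iso_on_add[OF iso] linear_iso_on_scale[OF iso] *
        linear_iso_on_inv_mem[OF iso] linear_iso_on_right[OF iso] linear_iso_on_left[OF iso] pack_unpack)
qed

end

context
  fixes Jb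
  assumes J: "generalized_almost_complex A VT Jb"
begin

abbreviation "K \<equiv> quad_endo V TA Jb"

lemma
  assumes "x \<in> carrier_of A"
  shows J_mem: "a \<in> D x \<Longrightarrow> Jb x a \<in> D x"
    and J_add: "a \<in> D x \<Longrightarrow> b \<in> D x \<Longrightarrow> Jb x (a + b) = Jb x a + Jb x b"
    and J_scale: "a \<in> D x \<Longrightarrow> Jb x (r *\<^sub>R a) = r *\<^sub>R Jb x a"
    and J_pairing: "a \<in> D x \<Longrightarrow> b \<in> D x \<Longrightarrow> dual_pairing (Jb x a) (Jb x b) = dual_pairing a b"
    and J_square: "a \<in> D x \<Longrightarrow> Jb x (Jb x a) = - a"
  using J assms unfolding generalized_almost_complex_def by blast+

lemma to_quad_qfib:
  assumes "(U, t) \<in> vtrivs V" "x \<in> U" "u \<in> D x"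
  shows "to_quad u \<in> qfib x"
  unfolding quad_fib_eq
  using to_quad_mem[OF linear_iso_on_subspace[OF triv_iso[OF assms(1,2)]]
      base.subspace_tangent_space[OF triv_carrier[OF assms(1,2)]]] assms(3) unfolding D_eq .

context
  fixes c U t x
  assumes c: "c \<in> A" and t: "(U, t) \<in> vtrivs V" and x: "x \<in> U" "x \<in> fst c"
begin

text \<open>\<open>quad_endo\<close> inverts \<open>to_quad\<close> by \<open>inv_into\<close>; that
  this is a genuine inverse on \<open>qfib x\<close> is seen in coordinates.\<close>

lemma quad_endo_apply:
  assumes s: "s \<in> qfib x"
  defines "u \<equiv> inv_into (D x) (\<lambda>u. qcoord c t x (to_quad u)) (qcoord c t x s)"
  shows "K x s = to_quad (Jb x u)" "u \<in> D x" "to_quad u = s"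
proof -
  note iso = quad_iso(1)[OF c t x] and q = linear_iso_on_qcoord[OF c t x(2,1)]
  show u: "u \<in> D x" unfolding u_def by (rule linear_iso_on_inv_mem[OF iso])
  show us: "to_quad u = s"
    by (rule linear_iso_on_eqI[OF q to_quad_qfib[OF t x(1) u] s])
      (unfold u_def, rule linear_iso_on_right[OF iso])
  let ?u = "inv_into (D x) to_quad s"
  have s': "s \<in> to_quad ` D x" using u us by blast
  have "?u = u"
    by (rule linear_iso_on_eqI[OF iso inv_into_into[OF s'] u]) (simp only: f_inv_into_f[OF s'] us)
  then show "K x s = to_quad (Jb x u)" by (simp add: quad_endo_def)
qed

lemma endo_coord_quad:
  "endo_coord K c t (snd c x) s
    = qcoord c t x (to_quad (Jb x (inv_into (D x) (\<lambda>u. qcoord c t x (to_quad u)) s)))"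
proof -
  note q = linear_iso_on_qcoord[OF c t x(2,1)]
  let ?s = "inv_into (qfib x) (qcoord c t x) s"
  have "endo_coord K c t (snd c x) s = qcoord c t x (K x ?s)"
    by (simp add: endo_coord_def base.inv_left[OF c x(2)])
  then show ?thesis
    unfolding quad_endo_apply(1)[OF linear_iso_on_inv_mem[OF q]] linear_iso_on_right[OF q] .
qed

lemma quad_endo_mem: "K x ` qfib x \<subseteq> qfib x"
proof
  fix s assume "s \<in> K x ` qfib x"
  then obtain s' where s': "s' \<in> qfib x" "s = K x s'" by blast
  show "s \<in> qfib x"
    unfolding s'(2) quad_endo_apply(1)[OF s'(1)]
    by (intro to_quad_qfib[OF t x(1)] J_mem triv_carrier[OF t x(1)] quad_endo_apply(2)[OF s'(1)])
qed

text \<open>The factor \<open>- 1/2\<close> left out of \<open>pairing\<close> reappears here; it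
  cancels when orthogonality is transferred to the matrices.\<close>

lemma dual_pairing_coord:
  assumes u: "u \<in> D x" and w: "w \<in> D x"
  shows "dual_pairing u w
    = - (1/2) * pairing (unshuffle (qcoord c t x (to_quad u))) (unshuffle (qcoord c t x (to_quad w)))"
proof -
  note T = base.linear_iso_on_tangent[OF c x(2)] and S = triv_iso[OF t x(1)]
  obtain v a f h where u': "to_quad u = (v, a, f, h)" by (metis prod.exhaust)
  obtain v' a' f' h' where w': "to_quad w = (v', a', f', h')" by (metis prod.exhaust)
  have mem: "v \<in> fib V x" "a \<in> tangent_space A x" "f \<in> dual_space (fib V x)" "h \<in> dual_space (tangent_space A x)"
    "v' \<in> fib V x" "a' \<in> tangent_space A x" "f' \<in> dual_space (fib V x)" "h' \<in> dual_space (tangent_space A x)"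
    using to_quad_qfib[OF t x(1) u] to_quad_qfib[OF t x(1) w] unfolding u' w' quad_fib_eq by auto
  have h: "h b = (\<Sum>e\<in>Basis. h (tvec A c x e) *\<^sub>R e) \<bullet> b c"
    if "h \<in> dual_space (tangent_space A x)" "b \<in> tangent_space A x" for h b
    using fun_cong[OF linear_iso_on_left[OF linear_iso_on_dual(1)[OF T] that(1)], of b] that(2)
    unfolding linear_iso_on_dual(2)[OF T] unfolding base.inv_into_tangent[OF c x(2)] by simp
  have f: "f b = (\<Sum>e\<in>Basis. f (tinv t x e) *\<^sub>R e) \<bullet> t x b"
    if "f \<in> dual_space (fib V x)" "b \<in> fib V x" for f b
    by (rule dual_apply[OF t x(1) that])
  have "dual_pairing u w = - (1/2) * (f v' + h a' + (f' v + h' a))"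
    using dual_pairing_quad[OF linear_iso_on_subspace[OF S] linear_iso_on_subspace[OF T]
        u[unfolded D_eq] w[unfolded D_eq]] unfolding u' w' by simp
  also have "\<dots> = - (1/2) * pairing (unshuffle (qcoord c t x (to_quad u))) (unshuffle (qcoord c t x (to_quad w)))"
    unfolding f[OF mem(3,5)] h[OF mem(4,6)] f[OF mem(7,1)] h[OF mem(8,2)] u' w'
    by (simp only: quad_coord_def pairing_def unshuffle_def inner_prod_def prod.case fst_conv snd_conv)
      (simp only: ac_simps)
  finally show ?thesis .
qed

lemma pairing_complex_quad_endo:
  "pairing_complex (\<lambda>u. unshuffle (endo_coord K c t (snd c x) (shuffle u)))"
proof -
  let ?\<Phi> = "\<lambda>u. qcoord c t x (to_quad u)"
  let ?inv = "inv_into (D x) ?\<Phi>"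
  let ?G = "\<lambda>u. unshuffle (?\<Phi> (Jb x (?inv (shuffle u))))"
  note iso = quad_iso(1)[OF c t x] and xA = triv_carrier[OF t x(1)]
  note mem = linear_iso_on_inv_mem[OF iso] and right = linear_iso_on_right[OF iso]
  note Jm = J_mem[OF xA mem]
  have sh: "shuffle (a + b) = shuffle a + shuffle b" "shuffle (r *\<^sub>R a) = r *\<^sub>R shuffle a"
    for a b :: "((real ^ 'n) \<times> (real ^ 'n)) \<times> ((real ^ 'n) \<times> (real ^ 'n))" and r
    by (simp_all add: shuffle_def split_beta)
  note li = linear_iso_on_linear_inv[OF iso]
  have "linear ?G"
    by (rule linearI)
      (simp_all only: sh linear_add[OF li] linear_scale[OF li] J_add[OF xA mem mem] J_scale[OF xA mem]
        linear_iso_on_add[OF iso Jm Jm] linear_iso_on_scale[OF iso Jm] linear_add[OF linear_unshuffle]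
        linear_scale[OF linear_unshuffle])
  moreover have "pairing (?G a) (?G b) = pairing a b" for a b
    using dual_pairing_coord[OF Jm Jm, of "shuffle a" "shuffle b"]
      dual_pairing_coord[OF mem mem, of "shuffle a" "shuffle b"] J_pairing[OF xA mem mem, of "shuffle a" "shuffle b"]
    unfolding right by simp
  moreover have "?G (?G a) = - a" for a
  proof -
    have "?G (?G a) = unshuffle (?\<Phi> (Jb x (Jb x (?inv (shuffle a)))))"
      by (simp only: shuffle_unshuffle linear_iso_on_left[OF iso Jm])
    also have "\<dots> = unshuffle (?\<Phi> ((-1) *\<^sub>R ?inv (shuffle a)))" by (simp add: J_square[OF xA mem])
    also have "\<dots> = (-1) *\<^sub>R unshuffle (shuffle a)"
      by (simp only: linear_iso_on_scale[OF iso mem] right linear_scale[OF linear_unshuffle])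
    finally show ?thesis by simp
  qed
  ultimately show ?thesis
    unfolding pairing_complex_def endo_coord_quad by blast
qed

end

lemma smooth_quad_endo:
  assumes c: "c \<in> A" and t: "(U, t) \<in> vtrivs V"
  shows "smooth_on (snd c ` (fst c \<inter> U)) (\<lambda>\<xi>. endo_coord K c t \<xi> s)"
proof -
  let ?O = "DU c U"
  \<comment> \<open>Smoothness of \<open>Jb\<close> is given only through its action on sections, so
    the value of the matrix on \<open>s\<close> is obtained from the section with constant
    coordinates \<open>pack s\<close>.\<close>
  let ?\<sigma> = "\<lambda>x. inv_into (D x) (dt c t x) (pack s)"
  have O: "openin (mtop A) ?O" by (intro openin_Int triv_open[OF t] base.openin_chart[OF c])
  note tr = dt_triv[OF c t]
  have img: "snd c ` (?O \<inter> ?O \<inter> fst c) = snd c ` (fst c \<inter> U)" by (rule arg_cong[where f = "(`) (snd c)"]) blast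
  have "smooth_section A (double_bundle VT) ?O ?\<sigma>"
    unfolding smooth_section_def
  proof (intro conjI ballI, goal_cases)
    case (1 x)
    then show ?case using linear_iso_on_inv_mem[OF dt_iso[OF c t]] by blast
  next
    case (2 c' T)
    then show ?case using smooth_bundleD(3)[OF smooth_bundle_VT tr, of _ _ c' "pack s"] by (auto simp del: o_apply)
  qed
  then have "smooth_section A (double_bundle VT) ?O (\<lambda>x. Jb x (?\<sigma> x))"
    using J O unfolding generalized_almost_complex_def by blast
  then have "smooth_on (snd c ` (?O \<inter> ?O \<inter> fst c)) ((\<lambda>x. dt c t x (Jb x (?\<sigma> x))) \<circ> chart_inv c)"
    using tr c unfolding smooth_section_def by fast
  then have sm: "smooth_on (snd c ` (fst c \<inter> U)) ((\<lambda>x. dt c t x (Jb x (?\<sigma> x))) \<circ> chart_inv c)"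
    unfolding img .
  have op: "open (snd c ` (fst c \<inter> U))"
    using base.open_image_chart[OF triv_open[OF t] c] by (simp add: Int_commute)
  from smooth_on_linear[OF op linear_unpack sm] show ?thesis
  proof (rule smooth_on_eq[OF op])
    fix q assume "q \<in> snd c ` (fst c \<inter> U)"
    then obtain x where x: "x \<in> U" "x \<in> fst c" "q = snd c x" by blast
    show "endo_coord K c t q s = unpack (((\<lambda>x. dt c t x (Jb x (?\<sigma> x))) \<circ> chart_inv c) q)"
      unfolding x(3) endo_coord_quad[OF c t x(1,2)] o_apply base.inv_left[OF c x(2)]
        quad_iso(2)[OF c t x(1,2)]
      unfolding dt_quad[OF c t x(1,2)] ..
  qed
qed

end

text \<open>In contragredient coordinates, evaluation at \<open>v\<close> has the coordinates
  \<open>t x v\<close>, so the identification of \<open>V\<close> with its bidual becomes the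
  identity.\<close>

lemma
  assumes c: "c \<in> A" and t: "(U, t) \<in> vtrivs V" and x: "x \<in> U" "x \<in> fst c" and s: "s \<in> qfib x"
  shows tau_mem: "tau (fib V x) s \<in> quad_fib (dual_bundle V) TA x"
    and tau_coord: "quad_coord A c x (dual_space (fib V x)) (dtriv t x) (tau (fib V x) s) = swap_quad (qcoord c t x s)"
proof -
  note S = triv_iso[OF t x(1)]
  obtain v a f h where s': "s = (v, a, f, h)" by (metis prod.exhaust)
  have v: "v \<in> fib V x" using s by (simp add: s' quad_fib_eq)
  let ?ev = "\<lambda>h. if h \<in> dual_space (fib V x) then h v else 0"
  note sub = subspace_dual_space[OF linear_iso_on_subspace[OF S]]
  have "?ev \<in> dual_space (dual_space (fib V x))"
    unfolding dual_space_def[of "dual_space (fib V x)"]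
    using subspace_add[OF sub] subspace_scale[OF sub] by (auto simp: plus_fun_def scaleR_fun_def)
  then show "tau (fib V x) s \<in> quad_fib (dual_bundle V) TA x"
    using s by (simp add: s' tau_def quad_fib_def fib_dual)
  have "(\<Sum>b\<in>Basis. ?ev (inv_into (dual_space (fib V x)) (dtriv t x) b) *\<^sub>R b) = (\<Sum>b\<in>Basis. (t x v \<bullet> b) *\<^sub>R b)"
  proof (intro sum.cong refl arg_cong[where f = "\<lambda>r. r *\<^sub>R _"])
    fix b :: "real ^ 'n"
    have "inv_into (dual_space (fib V x)) (dtriv t x) b \<in> dual_space (fib V x)"
      by (rule linear_iso_on_inv_mem[OF dtriv_iso[OF t x(1)]])
    then show "?ev (inv_into (dual_space (fib V x)) (dtriv t x) b) = t x v \<bullet> b"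
      using v unfolding inv_into_dtriv[OF t x(1)] by (simp add: inner_commute)
  qed
  then show "quad_coord A c x (dual_space (fib V x)) (dtriv t x) (tau (fib V x) s) = swap_quad (qcoord c t x s)"
    by (simp add: s' tau_def quad_coord_def swap_quad_def euclidean_representation)
qed

lemma
  assumes c: "c \<in> A" and t: "(U, t) \<in> vtrivs V" and x: "x \<in> U" "x \<in> fst c"
    and E: "E x ` qfib x \<subseteq> qfib x"
  shows mirror_mem: "mirror_endo V TA E x ` quad_fib (dual_bundle V) TA x \<subseteq> quad_fib (dual_bundle V) TA x"
    and endo_coord_mirror: "flat_lattice_bundle.endo_coord DQ (mirror_endo V TA E) c (dtriv t) (snd c x) e
      = swap_quad (endo_coord E c t (snd c x) (swap_quad e))"
proof -
  interpret dual: flat_lattice_bundle DQ by (rule flat_lattice_bundle_dual)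
  have t': "(U, dtriv t) \<in> vtrivs (lq_bundle DQ)" unfolding DQ_simps vtrivs_dual using t by force
  have cD: "c \<in> lq_base DQ" using c by simp
  note q = linear_iso_on_qcoord[OF c t x(2,1)]
  note q' = dual.linear_iso_on_qcoord[OF cD t' x(2,1), unfolded DQ_simps fib_dual]
  note tm = tau_mem[OF c t x] and tc = tau_coord[OF c t x]
  have sw: "swap_quad (swap_quad a) = a" for a :: "(real ^ 'n) \<times> (real ^ 'n) \<times> (real ^ 'n) \<times> (real ^ 'n)"
    by (simp add: swap_quad_def split_beta)
  have app: "\<exists>u\<in>qfib x. tau (fib V x) u = s \<and> mirror_endo V TA E x s = tau (fib V x) (E x u)"
    if s: "s \<in> quad_fib (dual_bundle V) TA x" for s
  proof -
    \<comment> \<open>Surjectivity of \<open>tau\<close>, whose third component lies in the bidual: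
      the preimage is written down by swapping coordinates.\<close>
    let ?u = "inv_into (qfib x) (qcoord c t x) (swap_quad (quad_coord A c x (dual_space (fib V x)) (dtriv t x) s))"
    have u: "?u \<in> qfib x" by (rule linear_iso_on_inv_mem[OF q])
    have tu: "tau (fib V x) ?u = s"
      by (rule linear_iso_on_eqI[OF q' tm[OF u] s]) (simp only: tc[OF u] linear_iso_on_right[OF q] sw)
    have s': "s \<in> tau (fib V x) ` qfib x" 
    proof (rule image_eqI)
      show "s = tau (fib V x) ?u" by (rule tu[symmetric])
    qed (rule u)
    have "mirror_endo V TA E x s = tau (fib V x) (E x (inv_into (qfib x) (tau (fib V x)) s))"
      by (simp add: mirror_endo_def)
    then show ?thesis using inv_into_into[OF s'] f_inv_into_f[OF s'] by blast
  qed
  show "mirror_endo V TA E x ` quad_fib (dual_bundle V) TA x \<subseteq> quad_fib (dual_bundle V) TA x"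
  proof
    fix r assume "r \<in> mirror_endo V TA E x ` quad_fib (dual_bundle V) TA x"
    then obtain s where s: "s \<in> quad_fib (dual_bundle V) TA x" "r = mirror_endo V TA E x s" by blast
    from app[OF s(1)] obtain u where u: "u \<in> qfib x" "mirror_endo V TA E x s = tau (fib V x) (E x u)" by blast
    have "E x u \<in> qfib x" using E u(1) by blast
    then show "r \<in> quad_fib (dual_bundle V) TA x" unfolding s(2) u(2) by (rule tm)
  qed
  let ?s = "inv_into (quad_fib (dual_bundle V) TA x) (quad_coord A c x (dual_space (fib V x)) (dtriv t x)) e"
  have s: "?s \<in> quad_fib (dual_bundle V) TA x" by (rule linear_iso_on_inv_mem[OF q'])
  from app[OF s] obtain u where u: "u \<in> qfib x" "tau (fib V x) u = ?s"
    "mirror_endo V TA E x ?s = tau (fib V x) (E x u)" by blast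
  have Ku: "E x u \<in> qfib x" using E u(1) by blast
  have "swap_quad (qcoord c t x u) = e"
    unfolding tc[OF u(1), symmetric] u(2) by (rule linear_iso_on_right[OF q'])
  then have e: "qcoord c t x u = swap_quad e" using sw by metis
  have "dual.endo_coord (mirror_endo V TA E) c (dtriv t) (snd c x) e
      = quad_coord A c x (dual_space (fib V x)) (dtriv t x) (mirror_endo V TA E x ?s)"
    unfolding dual.endo_coord_def Let_def base.inv_left[OF c x(2)] DQ_simps fib_dual ..
  also have "\<dots> = swap_quad (qcoord c t x (E x u))" unfolding u(3) by (rule tc[OF Ku])
  also have "\<dots> = swap_quad (endo_coord E c t (snd c x) (swap_quad e))"
    unfolding endo_coord[OF c t x(2,1) u(1)] e ..
  finally show "dual.endo_coord (mirror_endo V TA E) c (dtriv t) (snd c x) e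
      = swap_quad (endo_coord E c t (snd c x) (swap_quad e))" .
qed

end

text \<open>Both sides become the vanishing of \<open>nijenhuis\<close> over the same charts of the
  base, since every trivialization of the dual bundle is some \<open>dtriv t\<close>. By
  \<open>endo_coord_mirror\<close> the matrices are conjugate under \<open>swap_fibre\<close>, and
  \<open>nijenhuis_swap\<close> transfers this to the Nijenhuis expressions.\<close>

theorem (in flat_quotient) integrable_mirror_iff:
  assumes J: "generalized_almost_complex A VT Jb"
  shows "integrable_gcs B (lq_structure Q (quad_endo V TA Jb))
    \<longleftrightarrow> integrable_gcs (lq_total DQ) (lq_structure DQ (mirror_endo V TA (quad_endo V TA Jb)))"
proof -
  interpret dual: flat_quotient DQ by (rule flat_quotient_dual)
  let ?K = "quad_endo V TA Jb" and ?K' = "mirror_endo V TA (quad_endo V TA Jb)"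
  let ?g = "\<lambda>c t \<xi> u. unshuffle (endo_coord ?K c t \<xi> (shuffle u))"
  let ?g' = "\<lambda>c t \<xi> u. unshuffle (dual.endo_coord ?K' c t \<xi> (shuffle u))"
  have carrier: "\<exists>c U t. c \<in> A \<and> (U, t) \<in> vtrivs V \<and> x \<in> U \<and> x \<in> fst c" if "x \<in> carrier_of A" for x
    using triv_cover[OF that] base.chart_at[OF that] by blast
  note qm = quad_endo_mem[OF J] and pc = pairing_complex_quad_endo[OF J] and sm = smooth_quad_endo[OF J]
  have op: "open (snd c ` (fst c \<inter> U))" if "c \<in> A" "(U, t) \<in> vtrivs V" for c U t
    using base.open_image_chart[OF triv_open[OF that(2)] that(1)] by (simp add: Int_commute)
  have g': "?g' c (dtriv t) \<xi> u = swap_fibre (?g c t \<xi> (swap_fibre u))"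
    if ct: "c \<in> A" "(U, t) \<in> vtrivs V" and \<xi>: "\<xi> \<in> snd c ` (fst c \<inter> U)" for c U t \<xi> u
  proof -
    obtain x where x: "x \<in> U" "x \<in> fst c" "\<xi> = snd c x" using \<xi> by blast
    show ?thesis
      unfolding x(3) endo_coord_mirror[where E = ?K, OF ct x(1,2) qm[OF ct x(1,2)]] swap_quad_shuffle ..
  qed
  have 1: "integrable_gcs B (lq_structure Q ?K) \<longleftrightarrow>
    (\<forall>c\<in>A. \<forall>(U, t)\<in>vtrivs V. \<forall>x\<in>fst c \<inter> U. \<forall>y u v. nijenhuis (\<lambda>p. ?g c t (fst p)) (snd c x, y) u v = 0)"
  proof (rule integrable_lq_structure_iff)
    show "?K x ` qfib x \<subseteq> qfib x" if "x \<in> carrier_of A" for x using carrier[OF that] qm by blast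
  qed (use pc sm in blast)+
  have 2: "integrable_gcs (lq_total DQ) (lq_structure DQ ?K') \<longleftrightarrow>
    (\<forall>c\<in>A. \<forall>(U, t)\<in>vtrivs (dual_bundle V). \<forall>x\<in>fst c \<inter> U. \<forall>y u v. nijenhuis (\<lambda>p. ?g' c t (fst p)) (snd c x, y) u v = 0)"
  proof (rule dual.integrable_lq_structure_iff[unfolded DQ_simps])
    show "?K' x ` quad_fib (dual_bundle V) TA x \<subseteq> quad_fib (dual_bundle V) TA x" if "x \<in> carrier_of A" for x
      using carrier[OF that] mirror_mem qm by metis
  next
    fix c U t' x assume c: "c \<in> A" and t': "(U, t') \<in> vtrivs (dual_bundle V)" and x: "x \<in> fst c" "x \<in> U"
    obtain t where t: "(U, t) \<in> vtrivs V" "t' = dtriv t" using t' unfolding vtrivs_dual by auto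
    have "snd c x \<in> snd c ` (fst c \<inter> U)" using x by blast
    from pairing_complex_swap[OF pc[OF c t(1) x(2,1)]]
    show "pairing_complex (\<lambda>u. ?g' c t' (snd c x) u)"
      unfolding t(2) g'[OF c t(1) \<open>snd c x \<in> snd c ` (fst c \<inter> U)\<close>] .
  next
    fix c U t' s assume c: "c \<in> A" and t': "(U, t') \<in> vtrivs (dual_bundle V)"
    obtain t where t: "(U, t) \<in> vtrivs V" "t' = dtriv t" using t' unfolding vtrivs_dual by auto
    note op = op[OF c t(1)]
    have "smooth_on (snd c ` (fst c \<inter> U)) (\<lambda>\<xi>. swap_quad (endo_coord ?K c t \<xi> (swap_quad s)))"
      by (rule smooth_on_linear[OF op linear_swap_quad sm[OF c t(1)]])
    then show "smooth_on (snd c ` (fst c \<inter> U)) (\<lambda>\<xi>. dual.endo_coord ?K' c t' \<xi> s)"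
    proof (rule smooth_on_eq[OF op])
      fix \<xi> assume "\<xi> \<in> snd c ` (fst c \<inter> U)"
      then obtain x where x: "x \<in> U" "x \<in> fst c" "\<xi> = snd c x" by blast
      show "dual.endo_coord ?K' c t' \<xi> s = swap_quad (endo_coord ?K c t \<xi> (swap_quad s))"
        unfolding x(3) t(2) by (rule endo_coord_mirror[where E = ?K, OF c t(1) x(1,2) qm[OF c t(1) x(1,2)]])
    qed
  qed
  have nij: "nijenhuis (\<lambda>p. ?g' c (dtriv t) (fst p)) (snd c x, y) u v
      = swap_fibre (nijenhuis (\<lambda>p. ?g c t (fst p)) (snd c x, y) (swap_fibre u) (swap_fibre v))"
    if ct: "c \<in> A" "(U, t) \<in> vtrivs V" and x: "x \<in> fst c" "x \<in> U" for c U t x and y :: "real ^ 'n" and u v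
  proof -
    let ?S = "snd c ` (fst c \<inter> U)"
    have xS: "snd c x \<in> ?S" using x by blast
    \<comment> \<open>The conjugacy \<open>g'\<close> holds over the chart domain only, which is an
      open set and hence enough for the derivative at \<open>snd c x\<close>.\<close>
    have "nijenhuis (\<lambda>p. ?g' c (dtriv t) (fst p)) (snd c x, y) u v
        = nijenhuis (\<lambda>p u. swap_fibre (?g c t (fst p) (swap_fibre u))) (snd c x, y) u v"
      by (rule nijenhuis_cong[OF open_Times[OF op[OF ct] open_UNIV]]) (use xS g'[OF ct] in auto)
    also have "\<dots> = swap_fibre (nijenhuis (\<lambda>p. ?g c t (fst p)) (snd c x, y) (swap_fibre u) (swap_fibre v))"
      using nijenhuis_swap[where g = "?g c t" and y = y and u = "swap_fibre u" and v = "swap_fibre v",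
          OF op[OF ct] xS smooth_on_linear[OF op[OF ct] linear_unshuffle sm[OF ct]]]
      unfolding swap_fibre_involution .
    finally show ?thesis .
  qed
  have zero: "swap_fibre w = 0 \<longleftrightarrow> w = 0" for w :: "((real ^ 'n) \<times> (real ^ 'n)) \<times> ((real ^ 'n) \<times> (real ^ 'n))"
    using linear_0[OF linear_swap_fibre] swap_fibre_involution by metis
  \<comment> \<open>As \<open>u\<close> and \<open>v\<close> range over all vectors, so do their
    images under the involution.\<close>
  have "(\<forall>y u v. nijenhuis (\<lambda>p. ?g' c (dtriv t) (fst p)) (snd c x, y) u v = 0)
      \<longleftrightarrow> (\<forall>y u v. nijenhuis (\<lambda>p. ?g c t (fst p)) (snd c x, y) u v = 0)"
    if "c \<in> A" "(U, t) \<in> vtrivs V" "x \<in> fst c" "x \<in> U" for c U t x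
    unfolding nij[OF that] zero using swap_fibre_involution by metis
  note e = this
  have 3: "(\<forall>(U, t)\<in>vtrivs (dual_bundle V). P U t) \<longleftrightarrow> (\<forall>(U, t)\<in>vtrivs V. P U (dtriv t))" for P
    unfolding vtrivs_dual by auto
  let ?L = "\<lambda>c U t. \<forall>x\<in>fst c \<inter> U. \<forall>y u v. nijenhuis (\<lambda>p. ?g c t (fst p)) (snd c x, y) u v = 0"
  let ?R = "\<lambda>c U t. \<forall>x\<in>fst c \<inter> U. \<forall>y u v. nijenhuis (\<lambda>p. ?g' c (dtriv t) (fst p)) (snd c x, y) u v = 0"
  show ?thesis
    unfolding 1 2 3
  proof (rule ball_cong[OF refl], rule ball_cong[OF refl])
    fix c p assume c: "c \<in> A" and p: "p \<in> vtrivs V"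
    obtain U t where p': "p = (U, t)" by force
    have "?L c U t \<longleftrightarrow> ?R c U t"
      by (rule ball_cong[OF refl]) (rule e[OF c p[unfolded p'], symmetric], auto)
    then show "(case p of (U, t) \<Rightarrow> ?L c U t) \<longleftrightarrow> (case p of (U, t) \<Rightarrow> ?R c U t)"
      unfolding p' prod.case .
  qed
qed

text \<open>\<open>semi_flat\<close> prescribes \<open>J\<close> on the fibres only, while
  endomorphisms are total functions; the values of sections lie in the fibres.\<close>

lemma integrable_gcs_cong:
  assumes A: "smooth_atlas A"
    and eq: "\<And>x u. x \<in> carrier_of A \<Longrightarrow> u \<in> fib (double_tangent A) x \<Longrightarrow> J x u = J' x u"
  shows "integrable_gcs A J \<longleftrightarrow> integrable_gcs A J'"
proof -
  interpret atlas A by standard (rule A)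
  have "eigenbundle_section A J U a \<longleftrightarrow> eigenbundle_section A J' U a" if U: "openin (mtop A) U" for U a
  proof -
    have "J x (\<sigma> x) = J' x (\<sigma> x)" if "smooth_section A (double_tangent A) U \<sigma>" "x \<in> U" for \<sigma> x
      using eq section_mem[OF U that] openin_subset_carrier[OF U] that(2) by blast
    then show ?thesis by (auto simp: eigenbundle_section_def)
  qed
  then show ?thesis unfolding integrable_gcs_def by blast
qed

theorem corollary1p2:
  fixes Z :: "('m, 'z, 'n::finite) torus_bundle_data"
  assumes "torus_bundle Z"
    and "semi_flat Z Jb J"
  shows "integrable_gcs (tb_total Z) J \<longleftrightarrow> integrable_gcs (dual_torus Z) (mirror_structure Z Jb)"
proof -
  interpret torus Z by standard (rule assms(1))
  interpret quotient: flat_quotient "torus_quotient Z" by (rule flat_quotient_torus)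
  let ?K = "quad_endo V (tangent_bundle M) Jb"
  have gac: "generalized_almost_complex M (sum_bundle V (tangent_bundle M)) Jb"
    and J: "\<And>z u. z \<in> carrier_of T \<Longrightarrow> u \<in> fib (double_tangent T) z \<Longrightarrow> J z u = lq_structure (torus_quotient Z) ?K z u"
    using assms(2) unfolding semi_flat_def Let_def by blast+
  \<comment> \<open>The dual torus bundle is the abstract dual \<open>DQ\<close> formed from
    \<open>torus_quotient Z\<close>.\<close>
  have dual: "dual_torus_quotient Z = quotient.DQ"
    unfolding dual_torus_quotient_def torus_quotient_simps ..
  have "integrable_gcs T J \<longleftrightarrow> integrable_gcs T (lq_structure (torus_quotient Z) ?K)"
    by (rule integrable_gcs_cong[OF smooth_atlas_total J])
  also have "\<dots> \<longleftrightarrow> integrable_gcs (dual_torus Z) (mirror_structure Z Jb)"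
    using quotient.integrable_mirror_iff[unfolded torus_quotient_simps, OF gac]
    unfolding dual_torus_def mirror_structure_def Let_def dual torus_quotient_simps .
  finally show ?thesis .
qed

end
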